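(* Let $m>0$ be fixed and let $A_m$ be the imaginary Airy-Dirac operator in $L^2(\mathbb{R},\mathbb{C}^2)$ $$A_m=-i\partial_x\sigma_1+m\sigma_3+ixI_2,\qquad \mathrm{Dom}(A_m)=H^1(\mathbb{R},\mathbb{C}^2)\cap\mathrm{Dom}(xI_2).$$ Then (with $\lambda\in\mathbb{R}$) $$\|(A_m-\lambda)^{-1}\|=\frac{\Gamma\left(\frac{m^2}{2}+1\right)}{2^{\frac{m^2}{2}}\,m}\,\frac{\exp(\lambda^2)}{|\lambda|^{m^2}}\left(1+\mathcal{O}\left(\frac1{|\lambda|^2}\right)\right),\qquad\lambda\to\pm\infty.$$
   Context: $\sigma_1=\begin{pmatrix}0&1\\1&0\end{pmatrix}$, $\sigma_3=\begin{pmatrix}1&0\\0&-1\end{pmatrix}$, $I_2$ is the $2\times2$ identity matrix, so $A_mu=\big((m+ix)u_1-iu_2',\,-iu_1'+(-m+ix)u_2\big)^t$ for $u=(u_1,u_2)^t$. $\mathrm{Dom}(xI_2)=\{u\in L^2(\mathbb{R},\mathbb{C}^2):xu\in L^2(\mathbb{R},\mathbb{C}^2)\}$. $\|\cdot\|$ is the operator norm on $L^2(\mathbb{R},\mathbb{C}^2)$; $\Gamma$ is the Gamma function. *)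

theory Defs
  imports "HOL-Analysis.Analysis" "HOL-Library.Landau_Symbols"
begin

definition square_integrable :: "(real \<Rightarrow> complex^2) \<Rightarrow> bool" where
  "square_integrable f \<longleftrightarrow>
     f \<in> borel_measurable lborel \<and> integrable lborel (\<lambda>x. (norm (f x))\<^sup>2)"

definition L2_eq :: "(real \<Rightarrow> complex^2) \<Rightarrow> (real \<Rightarrow> complex^2) \<Rightarrow> bool" where
  "L2_eq f g \<longleftrightarrow> square_integrable f \<and> square_integrable g \<and> (AE x in lborel. f x = g x)"

lemma square_integrable_zero: "square_integrable (\<lambda>x. 0)"
  by (simp add: square_integrable_def)

lemma square_integrable_uminus: "square_integrable f \<Longrightarrow> square_integrable (\<lambda>x. - f x)"
  by (auto simp: square_integrable_def)

lemma square_integrable_scaleR: "square_integrable f \<Longrightarrow> square_integrable (\<lambda>x. c *\<^sub>R f x)"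
  by (auto simp: square_integrable_def power_mult_distrib)

lemma square_integrable_add:
  assumes "square_integrable f" "square_integrable g"
  shows "square_integrable (\<lambda>x. f x + g x)"
proof -
  have [measurable]: "f \<in> borel_measurable lborel" "g \<in> borel_measurable lborel"
    using assms by (auto simp: square_integrable_def)
  have "integrable lborel (\<lambda>x. (norm (f x + g x))\<^sup>2)"
  proof (rule Bochner_Integration.integrable_bound)
    show "integrable lborel (\<lambda>x. 2 * (norm (f x))\<^sup>2 + 2 * (norm (g x))\<^sup>2)"
      using assms by (auto simp: square_integrable_def)
    have "(norm (f x + g x))\<^sup>2 \<le> 2 * (norm (f x))\<^sup>2 + 2 * (norm (g x))\<^sup>2" for x
    proof -
      have "(norm (f x + g x))\<^sup>2 \<le> (norm (f x) + norm (g x))\<^sup>2"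
        by (intro power_mono norm_triangle_ineq) auto
      also have "\<dots> \<le> 2 * (norm (f x))\<^sup>2 + 2 * (norm (g x))\<^sup>2"
        using zero_le_power2[of "norm (f x) - norm (g x)"]
        by (simp add: power2_sum power2_diff)
      finally show ?thesis .
    qed
    then show "AE x in lborel. norm ((norm (f x + g x))\<^sup>2)
        \<le> norm (2 * (norm (f x))\<^sup>2 + 2 * (norm (g x))\<^sup>2)"
      by auto
  qed measurable
  then show ?thesis
    by (simp add: square_integrable_def)
qed

lemma square_integrable_diff:
  "square_integrable f \<Longrightarrow> square_integrable g \<Longrightarrow> square_integrable (\<lambda>x. f x - g x)"
  using square_integrable_add[OF _ square_integrable_uminus, of f g] by simp

lemma square_integrable_inner:
  assumes "square_integrable f" "square_integrable g"
  shows "integrable lborel (\<lambda>x. inner (f x) (g x))"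
proof -
  have [measurable]: "f \<in> borel_measurable lborel" "g \<in> borel_measurable lborel"
    using assms by (auto simp: square_integrable_def)
  show ?thesis
  proof (rule Bochner_Integration.integrable_bound)
    show "integrable lborel (\<lambda>x. (norm (f x))\<^sup>2 + (norm (g x))\<^sup>2)"
      using assms by (auto simp: square_integrable_def)
    have "norm (inner (f x) (g x)) \<le> (norm (f x))\<^sup>2 + (norm (g x))\<^sup>2" for x
    proof -
      have "norm (inner (f x) (g x)) \<le> norm (f x) * norm (g x)"
        using Cauchy_Schwarz_ineq2 by simp
      also have "\<dots> \<le> (norm (f x))\<^sup>2 + (norm (g x))\<^sup>2"
        using sum_squares_bound[of "norm (f x)" "norm (g x)"]
          mult_nonneg_nonneg[OF norm_ge_zero[of "f x"] norm_ge_zero[of "g x"]] by linarith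
      finally show ?thesis .
    qed
    then show "AE x in lborel. norm (inner (f x) (g x))
        \<le> norm ((norm (f x))\<^sup>2 + (norm (g x))\<^sup>2)"
      by (auto intro!: AE_I2 order_trans[OF _ abs_ge_self])
  qed measurable
qed

quotient_type L2 = "real \<Rightarrow> complex^2" / partial: L2_eq
  morphisms rep_L2 abs_L2
proof (rule part_equivpI)
  show "\<exists>f. L2_eq f f"
    by (rule exI[of _ "\<lambda>x. 0"]) (simp add: L2_eq_def square_integrable_zero)
  show "symp L2_eq"
    by (auto simp: symp_def L2_eq_def eq_commute)
  show "transp L2_eq"
    unfolding transp_def L2_eq_def
  proof (intro allI impI conjI; elim conjE)
    fix f g h :: "real \<Rightarrow> complex^2"
    assume "AE x in lborel. f x = g x" "AE x in lborel. g x = h x"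
    then show "AE x in lborel. f x = h x" by eventually_elim simp
  qed
qed

text \<open>The elements of \<open>L2\<close> are the classes of square-integrable functions modulo equality
  almost everywhere, i.e. the space L^2(R, C^2).\<close>

instantiation L2 :: real_inner
begin

lift_definition zero_L2 :: L2 is "\<lambda>x. 0"
  by (simp add: L2_eq_def square_integrable_zero)

lift_definition plus_L2 :: "L2 \<Rightarrow> L2 \<Rightarrow> L2" is "\<lambda>f g x. f x + g x"
  by (auto simp: L2_eq_def square_integrable_add)

lift_definition uminus_L2 :: "L2 \<Rightarrow> L2" is "\<lambda>f x. - f x"
  by (auto simp: L2_eq_def square_integrable_uminus)

lift_definition minus_L2 :: "L2 \<Rightarrow> L2 \<Rightarrow> L2" is "\<lambda>f g x. f x - g x"
  by (auto simp: L2_eq_def square_integrable_diff)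

lift_definition scaleR_L2 :: "real \<Rightarrow> L2 \<Rightarrow> L2" is "\<lambda>c f x. c *\<^sub>R f x"
  by (auto simp: L2_eq_def square_integrable_scaleR)

lift_definition norm_L2 :: "L2 \<Rightarrow> real" is "\<lambda>f. sqrt (\<integral>x. (norm (f x))\<^sup>2 \<partial>lborel)"
  by (auto simp: L2_eq_def square_integrable_def intro!: integral_cong_AE)

text \<open>The inner product on \<^typ>\<open>complex^2\<close> is the real part of the Hermitian one, so this
  is the real part of the usual inner product; it induces the usual norm.\<close>

lift_definition inner_L2 :: "L2 \<Rightarrow> L2 \<Rightarrow> real" is "\<lambda>f g. \<integral>x. inner (f x) (g x) \<partial>lborel"
  by (auto simp: L2_eq_def square_integrable_def intro!: integral_cong_AE)

definition dist_L2 :: "L2 \<Rightarrow> L2 \<Rightarrow> real" where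
  "dist_L2 u v = norm (u - v)"

definition sgn_L2 :: "L2 \<Rightarrow> L2" where
  "sgn_L2 u = inverse (norm u) *\<^sub>R u"

definition uniformity_L2 :: "(L2 \<times> L2) filter" where
  "uniformity_L2 = (INF e\<in>{0<..}. principal {(u, v). dist u v < e})"

definition open_L2 :: "L2 set \<Rightarrow> bool" where
  "open_L2 U \<longleftrightarrow> (\<forall>u\<in>U. eventually (\<lambda>(u', v). u' = u \<longrightarrow> v \<in> U) uniformity)"

instance
proof
  fix u v w :: L2 and a b :: real and U :: "L2 set"
  note si = L2_eq_def square_integrable_zero square_integrable_add square_integrable_uminus
    square_integrable_diff square_integrable_scaleR
  show "u + v + w = u + (v + w)" by transfer (auto simp: si add.assoc)
  show "u + v = v + u" by transfer (auto simp: si add.commute)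
  show "0 + u = u" by transfer (auto simp: si)
  show "- u + u = 0" by transfer (auto simp: si)
  show "u - v = u + - v" by transfer (auto simp: si)
  show "a *\<^sub>R (u + v) = a *\<^sub>R u + a *\<^sub>R v" by transfer (auto simp: si scaleR_add_right)
  show "(a + b) *\<^sub>R u = a *\<^sub>R u + b *\<^sub>R u" by transfer (auto simp: si scaleR_add_left)
  show "a *\<^sub>R b *\<^sub>R u = (a * b) *\<^sub>R u" by transfer (auto simp: si)
  show "1 *\<^sub>R u = u" by transfer (auto simp: si)
  show "sgn u = inverse (norm u) *\<^sub>R u" by (rule sgn_L2_def)
  show "dist u v = norm (u - v)" by (rule dist_L2_def)
  show "uniformity = (INF e\<in>{0<..}. principal {(u, v :: L2). dist u v < e})"
    by (rule uniformity_L2_def)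
  show "open U \<longleftrightarrow> (\<forall>u\<in>U. eventually (\<lambda>(u', v). u' = u \<longrightarrow> v \<in> U) uniformity)"
    by (rule open_L2_def)
  show "inner u v = inner v u" by transfer (simp add: inner_commute)
  show "inner (u + v) w = inner u w + inner v w"
    by transfer (simp add: L2_eq_def inner_add_left square_integrable_inner)
  show "inner (a *\<^sub>R u) v = a * inner u v" by transfer simp
  show "0 \<le> inner u u" by transfer simp
  show "inner u u = 0 \<longleftrightarrow> u = 0"
  proof transfer
    fix f assume "L2_eq f f"
    then have f: "square_integrable f" by (simp add: L2_eq_def)
    have "(\<integral>x. inner (f x) (f x) \<partial>lborel) = 0 \<longleftrightarrow> (AE x in lborel. inner (f x) (f x) = 0)"
      by (rule integral_nonneg_eq_0_iff_AE) (auto intro: square_integrable_inner f)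
    then show "(\<integral>x. inner (f x) (f x) \<partial>lborel) = 0 \<longleftrightarrow> L2_eq f (\<lambda>x. 0)"
      by (simp add: L2_eq_def f square_integrable_zero)
  qed
  show "norm u = sqrt (inner u u)"
    by transfer (simp add: power2_norm_eq_inner)
qed

end

definition test_function :: "(real \<Rightarrow> real) \<Rightarrow> bool" where
  "test_function \<phi> \<longleftrightarrow>
     (\<forall>n x. (deriv ^^ n) \<phi> differentiable at x) \<and> compact (closure {x. \<phi> x \<noteq> 0})"

text \<open>Real-valued test functions suffice: the identity for complex-valued ones follows by
  linearity, and for \<^typ>\<open>complex^2\<close>-valued functions it holds componentwise.\<close>

definition has_weak_derivative :: "L2 \<Rightarrow> L2 \<Rightarrow> bool" where
  "has_weak_derivative u v \<longleftrightarrow>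
     (\<forall>\<phi>. test_function \<phi> \<longrightarrow>
       (\<integral>x. deriv \<phi> x *\<^sub>R rep_L2 u x \<partial>lborel) = - (\<integral>x. \<phi> x *\<^sub>R rep_L2 v x \<partial>lborel))"

definition H1 :: "L2 set" where
  "H1 = {u. \<exists>v. has_weak_derivative u v}"

definition weak_derivative :: "L2 \<Rightarrow> L2" where
  "weak_derivative u = (THE v. has_weak_derivative u v)"

text \<open>An unbounded operator is given by its domain \<open>D\<close> and its action \<open>A\<close>, whose values
  outside \<open>D\<close> are irrelevant. Only real spectral parameters are considered,
  so real scalar multiplication is enough. For a complex-linear operator the inverse is again
  complex-linear, and its operator norm does not depend on the scalar field.\<close>

definition resolvent :: "'a::real_normed_vector set \<Rightarrow> ('a \<Rightarrow> 'a) \<Rightarrow> real \<Rightarrow> 'a \<Rightarrow> 'a" where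
  "resolvent D A z = inv_into D (\<lambda>u. A u - z *\<^sub>R u)"

definition real_resolvent_set :: "'a::real_normed_vector set \<Rightarrow> ('a \<Rightarrow> 'a) \<Rightarrow> real set" where
  "real_resolvent_set D A =
     {z. bij_betw (\<lambda>u. A u - z *\<^sub>R u) D UNIV \<and> bounded_linear (resolvent D A z)}"

definition sigma1 :: "complex^2^2" where
  "sigma1 = vector [vector [0, 1], vector [1, 0]]"

definition sigma3 :: "complex^2^2" where
  "sigma3 = vector [vector [1, 0], vector [0, -1]]"

definition Dom_x :: "L2 set" where
  "Dom_x = {u. square_integrable (\<lambda>x. x *\<^sub>R rep_L2 u x)}"

definition Dom_airy_dirac :: "L2 set" where
  "Dom_airy_dirac = H1 \<inter> Dom_x"

text \<open>On \<^term>\<open>Dom_airy_dirac\<close> the function below is square-integrable and the weak derivative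
  is unique, so there the choices made by \<^term>\<open>abs_L2\<close>, \<^term>\<open>rep_L2\<close> and
  \<^term>\<open>weak_derivative\<close> are immaterial.\<close>

definition airy_dirac :: "real \<Rightarrow> L2 \<Rightarrow> L2" where
  "airy_dirac m u = abs_L2 (\<lambda>x.
      - (\<i> *s (sigma1 *v rep_L2 (weak_derivative u) x))
      + complex_of_real m *s (sigma3 *v rep_L2 u x)
      + (\<i> * complex_of_real x) *s rep_L2 u x)"

end

theory Submission
  imports Defs "HOL-Probability.Distributions" "HOL-Real_Asymp.Real_Asymp"
begin

text \<open>With \<open>z = x + i \<lambda>\<close> the equation \<open>(A\<^sub>m - \<lambda>) P = 0\<close> reads \<open>P\<^sub>1' = (z + i m) P\<^sub>2\<close>,
  \<open>P\<^sub>2' = (z - i m) P\<^sub>1\<close>. Its coefficients are entire in \<open>z\<close>, so for every \<open>\<lambda>\<close> the solution decaying at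
  \<open>+\<infinity>\<close> is the restriction to the line \<open>Im z = \<lambda>\<close> of one entire function, given by parabolic cylinder
  functions, and its reflection \<open>Q\<close> decays at \<open>-\<infinity>\<close>. The resolvent is the Green operator built from
  \<open>P\<close> and \<open>Q\<close>. For large \<open>|\<lambda>|\<close> there is a unimodular \<open>a\<close> such that \<open>Q - a P\<close> is of size
  \<open>exp (- \<lambda>\<^sup>2 / 2)\<close> near \<open>x = 0\<close>, whereas \<open>P\<close> is of size \<open>exp (\<lambda>\<^sup>2 / 2)\<close> there. Replacing \<open>Q\<close> by \<open>a P\<close> on
  the right half-line and \<open>P\<close> by \<open>Q / a\<close> on the left one turns the Green kernel into a kernel of rank one,
  whose norm \<open>2 \<integral>\<^sub>0\<^sup>\<infinity> |P|\<^sup>2\<close> (divided by the Wronskian of \<open>P\<close> and \<open>Q\<close>) follows from the asymptotics of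
  \<open>P\<close> in \<open>Re z \<ge> 0\<close>. The error has a kernel bounded by a constant times \<open>|\<lambda>| powr (m\<^sup>2 / 2) exp (- |x\<^sup>2 - t\<^sup>2| / 2)\<close>
  and is negligible by Schur's test.\<close>

section \<open>Parabolic cylinder integrals\<close>

text \<open>The Wronskian of \<open>P\<close> and \<open>Q\<close> does not depend on
  \<open>\<lambda>\<close>: it is the restriction of an entire function of \<open>z\<close> with
  derivative zero, so its value, \<open>- \<i>\<close> times
  \<open>2 sqrt pi Gamma (m\<^sup>2 / 2) / m\<close>, can be read off at \<open>z = 0\<close>. The
  main term of the norm therefore depends on \<open>\<lambda>\<close> only through the integral of
  \<open>|P|\<^sup>2\<close>. The quotient of the two leading terms is the constant of the theorem,
  and the relative error \<open>1 / \<lambda>\<^sup>2\<close> is that of the integral; the remainder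
  is smaller, of relative order
  \<open>|\<lambda>| powr (3 m\<^sup>2 / 2) exp (- \<lambda>\<^sup>2)\<close>. The obstacle is to
  control the growth of \<open>Q - a P\<close> away from \<open>x = 0\<close> uniformly in
  \<open>\<lambda>\<close>. What helps is that \<open>\<lambda>\<close> cancels from the derivative
  of \<open>|Q - a P|\<^sup>2\<close>, so the growth factor depends on \<open>m\<close> alone. As
  the operator is defined through weak derivatives, the Green function also has to be placed in the
  domain: a weighted form of the Schur estimate controls \<open>x u\<close>, and the equation itself
  then controls \<open>u'\<close>.\<close>

lemma has_field_derivative_integral:
  fixes f f' :: "complex \<Rightarrow> 'a \<Rightarrow> complex"
  assumes \<delta>: "\<delta> > 0"
    and f: "\<And>z. z \<in> ball z0 \<delta> \<Longrightarrow> integrable M (f z)"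
    and f': "f' z0 \<in> borel_measurable M"
    and deriv: "\<And>z r. z \<in> ball z0 \<delta> \<Longrightarrow> ((\<lambda>z. f z r) has_field_derivative f' z r) (at z)"
    and bound: "\<And>z r. z \<in> ball z0 \<delta> \<Longrightarrow> norm (f' z r) \<le> g r"
    and g: "integrable M g"
  shows "((\<lambda>z. \<integral>r. f z r \<partial>M) has_field_derivative (\<integral>r. f' z0 r \<partial>M)) (at z0)"
proof -
  have z0: "z0 \<in> ball z0 \<delta>" using \<delta> by simp
  have "((\<lambda>z. ((\<integral>r. f z r \<partial>M) - (\<integral>r. f z0 r \<partial>M)) / (z - z0)) \<longlongrightarrow> (\<integral>r. f' z0 r \<partial>M))
          (at z0 within ball z0 \<delta>)"
    unfolding tendsto_at_iff_sequentially o_def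
  proof (intro allI impI)
    fix X :: "nat \<Rightarrow> complex"
    assume X: "\<forall>i. X i \<in> ball z0 \<delta> - {z0}" and lim: "X \<longlonglongrightarrow> z0"
    have eq: "((\<integral>r. f (X i) r \<partial>M) - (\<integral>r. f z0 r \<partial>M)) / (X i - z0)
        = (\<integral>r. (f (X i) r - f z0 r) / (X i - z0) \<partial>M)" for i
      using X f[of "X i"] f[OF z0] by (simp add: Bochner_Integration.integral_diff)
    have "(\<lambda>i. \<integral>r. (f (X i) r - f z0 r) / (X i - z0) \<partial>M) \<longlonglongrightarrow> (\<integral>r. f' z0 r \<partial>M)"
    proof (rule integral_dominated_convergence[OF f' _ g])
      show "(\<lambda>r. (f (X i) r - f z0 r) / (X i - z0)) \<in> borel_measurable M" for i
        using X f[of "X i"] f[OF z0] by (intro borel_measurable_divide borel_measurable_diff) auto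
      show "AE r in M. (\<lambda>i. (f (X i) r - f z0 r) / (X i - z0)) \<longlonglongrightarrow> f' z0 r"
      proof (intro AE_I2)
        fix r
        have "((\<lambda>z. (f z r - f z0 r) / (z - z0)) \<longlongrightarrow> f' z0 r) (at z0 within ball z0 \<delta>)"
          using deriv[OF z0, of r] \<delta> by (simp add: has_field_derivative_iff at_within_open[OF z0])
        then show "(\<lambda>i. (f (X i) r - f z0 r) / (X i - z0)) \<longlonglongrightarrow> f' z0 r"
          using X lim unfolding tendsto_at_iff_sequentially o_def by blast
      qed
      show "AE r in M. norm ((f (X i) r - f z0 r) / (X i - z0)) \<le> g r" for i
      proof (intro AE_I2)
        fix r
        \<comment> \<open>The mean value inequality on the convex ball bounds every difference
          quotient by the majorant \<open>g\<close> of the derivative, so dominated convergence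
          applies.\<close>
        have "norm (f (X i) r - f z0 r) \<le> g r * norm (X i - z0)"
        proof (rule field_differentiable_bound[where S="ball z0 \<delta>" and f'="\<lambda>z. f' z r"])
          show "((\<lambda>z. f z r) has_field_derivative f' z r) (at z within ball z0 \<delta>)"
            if "z \<in> ball z0 \<delta>" for z
            using deriv[OF that] by (rule has_field_derivative_at_within)
        qed (use bound X z0 in auto)
        then show "norm ((f (X i) r - f z0 r) / (X i - z0)) \<le> g r"
          using X by (simp add: norm_divide divide_le_eq)
      qed
    qed
    then show "(\<lambda>i. ((\<integral>r. f (X i) r \<partial>M) - (\<integral>r. f z0 r \<partial>M)) / (X i - z0)) \<longlonglongrightarrow> (\<integral>r. f' z0 r \<partial>M)"
      by (simp add: eq)
  qed
  then show ?thesis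
    using \<delta> by (simp add: has_field_derivative_iff at_within_open[OF z0])
qed

text \<open>Euler's integral, rescaled by \<open>\<epsilon>\<close>. These functions are the
  majorants of all parameter integrals below, and their values turn pointwise errors into powers of
  \<open>norm z\<close>.\<close>

lemma Gamma_kernel_integrable:
  fixes s \<epsilon> :: real
  assumes s: "s > 0" and \<epsilon>: "\<epsilon> > 0"
  shows "integrable lborel (\<lambda>r. indicator {0<..} r * (r powr (s - 1) * exp (- (\<epsilon> * r))))"
    and "(\<integral>r. indicator {0<..} r * (r powr (s - 1) * exp (- (\<epsilon> * r))) \<partial>lborel) = Gamma s / \<epsilon> powr s"
proof -
  let ?f = "\<lambda>r. indicator {0<..} r * (r powr (s - 1) * exp (- r))"
  have "((\<lambda>t. t powr (s - 1) / exp t) has_integral Gamma s) {0..}"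
    using Gamma_integral_real[OF s] .
  moreover have n1: "negligible {x \<in> {0..} - {0<..}. x powr (s - 1) / exp x \<noteq> 0}"
    by (rule negligible_subset[of "{0}"]) auto
  moreover have n2: "negligible {x \<in> {0<..} - {0..}. x powr (s - 1) / exp x \<noteq> 0}"
    by (rule negligible_subset[of "{0}"]) auto
  ultimately have "((\<lambda>t. t powr (s - 1) / exp t) has_integral Gamma s) {0<..}"
    by (simp only: has_integral_spike_set_eq[OF n1 n2])
  then have "(?f has_integral Gamma s) UNIV"
    by (subst (asm) has_integral_restrict_UNIV[symmetric])
      (auto elim!: has_integral_eq[rotated] simp: indicator_def exp_minus field_simps)
  then have *: "has_bochner_integral lborel ?f (Gamma s)"
    using Gamma_real_pos[OF s]
    by (intro has_bochner_integral_nn_integral)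
      (auto intro!: nn_integral_has_integral_lborel simp: less_imp_le)
  have "has_bochner_integral lborel (\<lambda>r. ?f (0 + \<epsilon> * r)) (Gamma s /\<^sub>R \<bar>\<epsilon>\<bar>)"
    using lborel_has_bochner_integral_real_affine_iff[of \<epsilon> ?f "Gamma s" 0] * \<epsilon> by simp
  then have "has_bochner_integral lborel (\<lambda>r. \<epsilon> powr (1 - s) * ?f (0 + \<epsilon> * r)) (\<epsilon> powr (1 - s) * (Gamma s /\<^sub>R \<bar>\<epsilon>\<bar>))"
    by (rule has_bochner_integral_mult_right)
  moreover have "\<epsilon> powr (1 - s) * (Gamma s /\<^sub>R \<bar>\<epsilon>\<bar>) = Gamma s / \<epsilon> powr s"
    using \<epsilon> by (simp add: powr_diff field_simps)
  moreover have "\<epsilon> powr (1 - s) * ?f (0 + \<epsilon> * r) = indicator {0<..} r * (r powr (s - 1) * exp (- (\<epsilon> * r)))" for r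
    using \<epsilon> by (auto simp: indicator_def powr_mult zero_less_mult_iff powr_diff field_simps)
  ultimately have "has_bochner_integral lborel (\<lambda>r. indicator {0<..} r * (r powr (s - 1) * exp (- (\<epsilon> * r)))) (Gamma s / \<epsilon> powr s)"
    by (simp only:)
  then show "integrable lborel (\<lambda>r. indicator {0<..} r * (r powr (s - 1) * exp (- (\<epsilon> * r))))"
    and "(\<integral>r. indicator {0<..} r * (r powr (s - 1) * exp (- (\<epsilon> * r))) \<partial>lborel) = Gamma s / \<epsilon> powr s"
    by (auto simp: has_bochner_integral_iff)
qed

section \<open>Half-line moments with a Gaussian factor\<close>

text \<open>Both coefficients are kept free: \<open>A = 1/2\<close> gives the parabolic cylinder
  integral, \<open>A = \<omega>\<^sup>2 / 2\<close> its rotated form, and \<open>A = 0\<close> the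
  leading term of its asymptotics.\<close>

definition moment_kernel :: "real \<Rightarrow> complex \<Rightarrow> complex \<Rightarrow> real \<Rightarrow> complex" where
  "moment_kernel s A B r =
     indicator {0<..} r *\<^sub>R (of_real (r powr (s - 1)) * exp (- (A * of_real r ^ 2) - B * of_real r))"

definition moment :: "real \<Rightarrow> complex \<Rightarrow> complex \<Rightarrow> complex" where
  "moment s A B = (\<integral>r. moment_kernel s A B r \<partial>lborel)"

text \<open>One condition for two kinds of decay: from a quadratic coefficient with positive real
  part, whatever \<open>B\<close> is, or from a linear one with positive real part while
  \<open>Re A \<ge> 0\<close>. The constant \<open>K\<close> costs only a factor
  \<open>exp K\<close>.\<close>

definition exp_dominated :: "complex \<Rightarrow> complex \<Rightarrow> real \<Rightarrow> real \<Rightarrow> bool" where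
  "exp_dominated A B \<epsilon> K \<longleftrightarrow> (\<forall>r\<ge>0. \<epsilon> * r - K \<le> Re A * r\<^sup>2 + Re B * r)"

lemma moment_kernel_measurable [measurable]: "moment_kernel s A B \<in> borel_measurable lborel"
  unfolding moment_kernel_def[abs_def] by measurable

lemma norm_moment_kernel:
  "norm (moment_kernel s A B r) =
     indicator {0<..} r * (r powr (s - 1) * exp (- (Re A * r\<^sup>2 + Re B * r)))"
  by (auto simp: moment_kernel_def norm_mult indicator_def power2_eq_square)

lemma norm_moment_kernel_le:
  assumes "exp_dominated A B \<epsilon> K"
  shows "norm (moment_kernel s A B r) \<le> exp K * (indicator {0<..} r * (r powr (s - 1) * exp (- (\<epsilon> * r))))"
proof (cases "r > 0")
  case True
  then have "exp (- (Re A * r\<^sup>2 + Re B * r)) \<le> exp (K - \<epsilon> * r)"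
    using assms by (auto simp: exp_dominated_def dest!: spec[of _ r])
  also have "\<dots> = exp K * exp (- (\<epsilon> * r))"
    by (simp add: exp_diff exp_minus field_simps)
  finally show ?thesis
    using True by (simp add: norm_moment_kernel mult.left_commute[of "exp K"] mult_left_mono)
qed (simp add: norm_moment_kernel)

lemma integrable_moment_kernel:
  assumes "s > 0" "\<epsilon> > 0" "exp_dominated A B \<epsilon> K"
  shows "integrable lborel (moment_kernel s A B)"
  by (rule Bochner_Integration.integrable_bound[OF integrable_mult_right[OF Gamma_kernel_integrable(1)[OF assms(1,2)]]])
    (use norm_moment_kernel_le[OF assms(3)] in \<open>auto intro!: AE_I2 intro: order_trans[OF _ abs_ge_self]\<close>)

text \<open>The constant comes from completing the square in
  \<open>\<eta> * r\<^sup>2 - (b + 1) * r\<close>.\<close>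

lemma exp_dominated_quadratic:
  assumes "\<eta> > 0" "\<eta> \<le> Re A" "norm B \<le> b"
  shows "exp_dominated A B 1 ((b + 1)\<^sup>2 / (4 * \<eta>))"
  unfolding exp_dominated_def
proof (intro allI impI)
  fix r :: real assume r: "r \<ge> 0"
  have "\<eta> * r\<^sup>2 \<le> Re A * r\<^sup>2" using assms by (intro mult_right_mono) auto
  moreover have "- b * r \<le> Re B * r"
    using abs_Re_le_cmod[of B] assms r by (intro mult_right_mono) auto
  moreover have "(b + 1) * r - (b + 1)\<^sup>2 / (4 * \<eta>) \<le> \<eta> * r\<^sup>2"
  proof -
    have "0 \<le> (2 * \<eta> * r - (b + 1))\<^sup>2 / (4 * \<eta>)" using assms by simp
    also have "\<dots> = \<eta> * r\<^sup>2 - (b + 1) * r + (b + 1)\<^sup>2 / (4 * \<eta>)"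
      using assms by (simp add: field_simps power2_eq_square)
    finally show ?thesis by simp
  qed
  ultimately show "1 * r - (b + 1)\<^sup>2 / (4 * \<eta>) \<le> Re A * r\<^sup>2 + Re B * r"
    by (simp add: algebra_simps)
qed

text \<open>Letting both coefficients vary covers differentiation in \<open>z\<close>, where only
  \<open>B\<close> moves, and rotation of the ray, where both move. Differentiating the exponent
  produces factors \<open>r\<^sup>2\<close> and \<open>r\<close>, which raise the index by
  \<open>2\<close> and \<open>1\<close>.\<close>

lemma has_field_derivative_moment_aux:
  fixes \<alpha> \<beta> \<alpha>' \<beta>' :: "complex \<Rightarrow> complex"
  assumes s: "s > 0" and \<delta>: "\<delta> > 0" and \<epsilon>: "\<epsilon> > 0"
    and dom: "\<And>\<omega>. \<omega> \<in> ball \<omega>0 \<delta> \<Longrightarrow> exp_dominated (\<alpha> \<omega>) (\<beta> \<omega>) \<epsilon> K"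
    and \<alpha>: "\<And>\<omega>. \<omega> \<in> ball \<omega>0 \<delta> \<Longrightarrow> (\<alpha> has_field_derivative \<alpha>' \<omega>) (at \<omega>)"
    and \<beta>: "\<And>\<omega>. \<omega> \<in> ball \<omega>0 \<delta> \<Longrightarrow> (\<beta> has_field_derivative \<beta>' \<omega>) (at \<omega>)"
    and bd: "\<And>\<omega>. \<omega> \<in> ball \<omega>0 \<delta> \<Longrightarrow> norm (\<alpha>' \<omega>) \<le> D" "\<And>\<omega>. \<omega> \<in> ball \<omega>0 \<delta> \<Longrightarrow> norm (\<beta>' \<omega>) \<le> D"
  shows "((\<lambda>\<omega>. moment s (\<alpha> \<omega>) (\<beta> \<omega>)) has_field_derivative
           - (\<alpha>' \<omega>0 * moment (s + 2) (\<alpha> \<omega>0) (\<beta> \<omega>0) + \<beta>' \<omega>0 * moment (s + 1) (\<alpha> \<omega>0) (\<beta> \<omega>0))) (at \<omega>0)"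
proof -
  let ?f' = "\<lambda>\<omega> r. - (\<alpha>' \<omega> * moment_kernel (s + 2) (\<alpha> \<omega>) (\<beta> \<omega>) r + \<beta>' \<omega> * moment_kernel (s + 1) (\<alpha> \<omega>) (\<beta> \<omega>) r)"
  let ?h = "\<lambda>s r. indicator {0<..} r * (r powr (s - 1) * exp (- (\<epsilon> * r)))"
  have in0: "\<omega>0 \<in> ball \<omega>0 \<delta>" using \<delta> by simp
  have "((\<lambda>\<omega>. \<integral>r. moment_kernel s (\<alpha> \<omega>) (\<beta> \<omega>) r \<partial>lborel) has_field_derivative (\<integral>r. ?f' \<omega>0 r \<partial>lborel)) (at \<omega>0)"
  proof (rule has_field_derivative_integral[OF \<delta>, where f'="?f'"
        and g="\<lambda>r. D * (exp K * ?h (s + 2) r) + D * (exp K * ?h (s + 1) r)"])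
    show "integrable lborel (moment_kernel s (\<alpha> z) (\<beta> z))" if "z \<in> ball \<omega>0 \<delta>" for z
      by (rule integrable_moment_kernel[OF s \<epsilon> dom[OF that]])
    show "?f' \<omega>0 \<in> borel_measurable lborel" by measurable
    show "integrable lborel (\<lambda>r. D * (exp K * ?h (s + 2) r) + D * (exp K * ?h (s + 1) r))"
      using s \<epsilon> by (intro Bochner_Integration.integrable_add integrable_mult_right Gamma_kernel_integrable(1)) auto
  next
    fix z r assume z: "z \<in> ball \<omega>0 \<delta>"
    have "norm (?f' z r) \<le> norm (\<alpha>' z) * norm (moment_kernel (s + 2) (\<alpha> z) (\<beta> z) r) + norm (\<beta>' z) * norm (moment_kernel (s + 1) (\<alpha> z) (\<beta> z) r)"
      using norm_triangle_ineq by (auto simp: norm_mult simp del: norm_minus_cancel simp: norm_minus_cancel intro!: order_trans[OF norm_triangle_ineq4] order_trans[OF norm_triangle_ineq])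
    also have "\<dots> \<le> D * (exp K * ?h (s + 2) r) + D * (exp K * ?h (s + 1) r)"
      using bd(1)[OF z] bd(2)[OF z] norm_ge_zero[of "\<alpha>' z"]
      by (intro add_mono mult_mono norm_moment_kernel_le dom z) (auto intro: order_trans[OF norm_ge_zero])
    finally show "norm (?f' z r) \<le> D * (exp K * ?h (s + 2) r) + D * (exp K * ?h (s + 1) r)" .
    show "((\<lambda>\<omega>. moment_kernel s (\<alpha> \<omega>) (\<beta> \<omega>) r) has_field_derivative ?f' z r) (at z)"
    proof (cases "r > 0")
      case True
      have pw: "r powr (s + 2 - 1) = r powr (s - 1) * r\<^sup>2" "r powr (s + 1 - 1) = r powr (s - 1) * r"
        using True by (simp_all add: powr_diff powr_add field_simps power2_eq_square)
      have "((\<lambda>\<omega>. of_real (r powr (s - 1)) * exp (- (\<alpha> \<omega> * of_real r ^ 2) - \<beta> \<omega> * of_real r)) has_field_derivative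
          of_real (r powr (s - 1)) * (exp (- (\<alpha> z * of_real r ^ 2) - \<beta> z * of_real r) * (- (\<alpha>' z * of_real r ^ 2) - \<beta>' z * of_real r))) (at z)"
        by (auto intro!: derivative_eq_intros \<alpha> \<beta> z)
      moreover have "of_real (r powr (s - 1)) * (exp (- (\<alpha> z * of_real r ^ 2) - \<beta> z * of_real r) * (- (\<alpha>' z * of_real r ^ 2) - \<beta>' z * of_real r)) = ?f' z r"
        using True unfolding moment_kernel_def pw by (simp add: algebra_simps)
      ultimately show ?thesis
        using True by (simp add: moment_kernel_def[abs_def])
    qed (simp add: moment_kernel_def)
  qed
  moreover have "(\<integral>r. ?f' \<omega>0 r \<partial>lborel) = - (\<alpha>' \<omega>0 * moment (s + 2) (\<alpha> \<omega>0) (\<beta> \<omega>0) + \<beta>' \<omega>0 * moment (s + 1) (\<alpha> \<omega>0) (\<beta> \<omega>0))"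
    using s integrable_moment_kernel[OF _ \<epsilon> dom[OF in0], of "s + 1"] integrable_moment_kernel[OF _ \<epsilon> dom[OF in0], of "s + 2"]
    unfolding moment_def
    by (subst Bochner_Integration.integral_minus, subst Bochner_Integration.integral_add) simp_all
  ultimately show ?thesis
    by (simp add: moment_def[abs_def])
qed

text \<open>Integrate the derivative of \<open>r powr s * exp (- A r\<^sup>2 - B r)\<close> over the
  half-line: \<open>s > 0\<close> removes the boundary term at \<open>0\<close>, the domination the
  one at infinity.\<close>

lemma moment_recurrence:
  assumes s: "s > 0" and \<epsilon>: "\<epsilon> > 0" and dom: "exp_dominated A B \<epsilon> K"
  shows "s * moment s A B = 2 * A * moment (s + 2) A B + B * moment (s + 1) A B"
proof -
  define F where "F r = of_real (r powr s) * exp (- (A * of_real r ^ 2) - B * of_real r)" for r :: real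
  define f where "f r = s * (of_real (r powr (s - 1)) * exp (- (A * of_real r ^ 2) - B * of_real r))
     - (2 * A * (of_real (r powr (s + 1)) * exp (- (A * of_real r ^ 2) - B * of_real r))
      + B * (of_real (r powr s) * exp (- (A * of_real r ^ 2) - B * of_real r)))" for r :: real
  have f_eq: "indicator {0<..} r *\<^sub>R f r = s * moment_kernel s A B r
      - (2 * A * moment_kernel (s + 2) A B r + B * moment_kernel (s + 1) A B r)" for r
    by (simp add: f_def moment_kernel_def indicator_def add.commute)
  have int: "integrable lborel (moment_kernel s A B)" "integrable lborel (moment_kernel (s+1) A B)"
    "integrable lborel (moment_kernel (s+2) A B)"
    using s by (auto intro!: integrable_moment_kernel[OF _ \<epsilon> dom])
  have normF: "norm (F r) \<le> exp K * (r powr s * exp (- (\<epsilon> * r)))" if "r > 0" for r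
    using norm_moment_kernel_le[OF dom, of "s + 1" r] that by (simp add: F_def moment_kernel_def)
  have "(LBINT x=0..\<infinity>. f x) = 0 - 0"
  proof (rule interval_integral_FTC_integrable[where F=F])
    show "(0::ereal) < \<infinity>" by simp
    fix x :: real assume "0 < ereal x" 
    then have x: "x > 0" by simp
    show "(F has_vector_derivative f x) (at x)"
    proof -
      have 1: "((\<lambda>r. of_real (r powr s) :: complex) has_vector_derivative of_real (s * x powr (s - 1))) (at x)"
        using x by (intro has_vector_derivative_of_real) (auto intro!: derivative_eq_intros simp: has_real_derivative_iff_has_vector_derivative[symmetric])
      have 2: "((\<lambda>w. exp (- (A * w ^ 2) - B * w)) has_field_derivative
          exp (- (A * of_real x ^ 2) - B * of_real x) * (- (A * (2 * of_real x)) - B)) (at (of_real x))"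
        by (auto intro!: derivative_eq_intros)
      have "(F has_vector_derivative of_real (x powr s) * (exp (- (A * of_real x ^ 2) - B * of_real x) * (- (A * (2 * of_real x)) - B))
         + of_real (s * x powr (s - 1)) * exp (- (A * of_real x ^ 2) - B * of_real x)) (at x)"
        unfolding F_def[abs_def]
        by (rule has_vector_derivative_mult[OF 1 has_vector_derivative_real_field[OF 2]])
      moreover have "x powr (s + 1) = x powr s * x" using x by (simp add: powr_add)
      ultimately show ?thesis by (simp add: f_def algebra_simps)
    qed
    show "isCont f x"
      unfolding f_def using x by (intro continuous_intros) auto
  next
    show "set_integrable lborel (einterval 0 \<infinity>) f"
      unfolding einterval_eq_Ici[of 0, simplified zero_ereal_def[symmetric]] 
      using int by (simp add: set_integrable_def f_eq zero_ereal_def)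
    have *: "((\<lambda>x. exp K * (x powr s * exp (- (\<epsilon> * x)))) \<longlongrightarrow> 0) (at_right 0)"
      using s \<epsilon> by real_asymp
    have "(F \<longlongrightarrow> 0) (at_right 0)"
      by (rule Lim_null_comparison[OF _ *]) (auto intro!: eventually_at_right_less[THEN eventually_mono] normF)
    then show "((F \<circ> real_of_ereal) \<longlongrightarrow> 0) (at_right 0)"
      unfolding zero_ereal_def by (simp add: ereal_tendsto_simps)
    have *: "((\<lambda>x. exp K * (x powr s * exp (- (\<epsilon> * x)))) \<longlongrightarrow> 0) at_top"
      using s \<epsilon> by real_asymp
    have "(F \<longlongrightarrow> 0) at_top"
      by (rule Lim_null_comparison[OF _ *]) (auto intro!: eventually_gt_at_top[of 0, THEN eventually_mono] normF)
    then show "((F \<circ> real_of_ereal) \<longlongrightarrow> 0) (at_left \<infinity>)"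
      by (simp add: ereal_tendsto_simps)
  qed
  then have "(\<integral>r. indicator {0<..} r *\<^sub>R f r \<partial>lborel) = 0"
    by (simp add: zero_ereal_def interval_integral_to_infinity_eq set_lebesgue_integral_def)
  then show ?thesis
    using int by (simp add: f_eq moment_def algebra_simps)
qed

lemma has_field_derivative_moment_linear:
  assumes "s > 0"
  shows "((\<lambda>z. moment s (1/2) (c * z)) has_field_derivative - (c * moment (s + 1) (1/2) (c * z))) (at z)"
proof -
  have "((\<lambda>z. moment s ((\<lambda>_. 1/2) z) (c * z)) has_field_derivative
     - ((\<lambda>_. 0) z * moment (s + 2) ((\<lambda>_. 1/2) z) (c * z) + (\<lambda>_. c) z * moment (s + 1) ((\<lambda>_. 1/2) z) (c * z))) (at z)"
  proof (rule has_field_derivative_moment_aux[OF assms zero_less_one zero_less_one, where D="norm c"])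
    fix w assume w: "w \<in> ball z 1"
    then have "norm w \<le> norm z + 1"
      using norm_triangle_sub[of w z] by (simp add: dist_norm norm_minus_commute)
    then have "norm (c * w) \<le> norm c * (norm z + 1)"
      by (simp add: norm_mult mult_left_mono)
    then show "exp_dominated (1/2) (c * w) 1 ((norm c * (norm z + 1) + 1)\<^sup>2 / (4 * (1/2)))"
      by (intro exp_dominated_quadratic) auto
  qed (auto intro!: derivative_eq_intros)
  then show ?thesis by simp
qed

lemma exp_dominated_linear:
  assumes "\<epsilon> \<le> Re B" "0 \<le> Re A"
  shows "exp_dominated A B \<epsilon> 0"
  using assms by (auto simp: exp_dominated_def intro!: add_increasing mult_right_mono)

text \<open>By the recurrence with \<open>A = 0\<close>, the function
  \<open>z powr s * moment s 0 z\<close> has derivative zero on the right half-plane, so it equals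
  its value at \<open>1\<close>, which is Euler's integral.\<close>

lemma moment_Gamma:
  assumes s: "s > 0" and c: "Re c > 0"
  shows "moment s 0 c = of_real (Gamma s) * c powr (- of_real s)"
proof -
  let ?S = "{z. Re z > 0}"
  let ?h = "\<lambda>z. z powr (of_real s) * moment s 0 z"
  have "\<exists>k. \<forall>z\<in>?S. ?h z = k"
  proof (rule has_field_derivative_zero_constant)
    show "convex ?S" by (rule convex_halfspace_Re_gt)
    fix z :: complex assume "z \<in> ?S"
    then have z: "Re z > 0" by simp
    then have z': "z \<notin> \<real>\<^sub>\<le>\<^sub>0" by (auto simp: complex_nonpos_Reals_iff)
    have dom: "exp_dominated 0 w (Re z / 2) 0" if "w \<in> ball z (Re z / 2)" for w
    proof (rule exp_dominated_linear)
      have "Re z - Re w \<le> norm (z - w)" using complex_Re_le_cmod[of "z - w"] by simp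
      then show "Re z / 2 \<le> Re w" using that by (simp add: dist_norm field_simps)
    qed simp
    have 1: "((\<lambda>z. moment s ((\<lambda>_. 0) z) ((\<lambda>z. z) z)) has_field_derivative
     - ((\<lambda>_. 0) z * moment (s + 2) ((\<lambda>_. 0) z) ((\<lambda>z. z) z) + (\<lambda>_. 1) z * moment (s + 1) ((\<lambda>_. 0) z) ((\<lambda>z. z) z))) (at z)"
      by (rule has_field_derivative_moment_aux[OF s _ _ dom, where D=1 and \<delta>="Re z / 2"]) (use z in \<open>auto intro!: derivative_eq_intros\<close>)
    have 2: "(?h has_field_derivative z powr s * - moment (s + 1) 0 z + (s * z powr (s - 1)) * moment s 0 z) (at z)"
      using DERIV_mult[OF has_field_derivative_powr[OF z', of s] 1] by (simp add: algebra_simps)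
    have "s * moment s 0 z = z * moment (s + 1) 0 z"
      using moment_recurrence[OF s _ dom[of z]] z by simp
    moreover have "z powr s = z * z powr (s - 1)"
      using z by (auto simp: powr_diff)
    ultimately have "z powr s * - moment (s + 1) 0 z + (s * z powr (s - 1)) * moment s 0 z = 0"
      by (simp add: algebra_simps)
    with 2 show "(?h has_field_derivative 0) (at z within ?S)"
      by (simp add: has_field_derivative_at_within)
  qed
  then obtain k where k: "\<And>z. z \<in> ?S \<Longrightarrow> ?h z = k" by blast
  have "moment s 0 1 = of_real (Gamma s)"
  proof -
    have "moment_kernel s 0 1 = (\<lambda>r. of_real (indicator {0<..} r * (r powr (s - 1) * exp (- (1 * r)))))"
      by (auto simp: moment_kernel_def fun_eq_iff indicator_def exp_of_real[symmetric])
    then show ?thesis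
      using Gamma_kernel_integrable(2)[OF s, of 1] by (simp only: moment_def integral_complex_of_real) simp
  qed
  with k[of 1] have "k = of_real (Gamma s)" by simp
  moreover have "c powr (of_real s) \<noteq> 0" using c by auto
  ultimately show ?thesis using k[of c] c
    by (simp add: powr_minus field_simps)
qed

text \<open>The right-hand side has derivative \<open>0\<close> in \<open>\<omega>\<close>, by the recurrence for the moments.\<close>

lemma moment_rotate:
  assumes s: "s > 0" and \<omega>: "\<bar>Im \<omega>\<bar> < Re \<omega>"
  shows "moment s (1/2) c = \<omega> powr (of_real s) * moment s (\<omega>\<^sup>2 / 2) (c * \<omega>)"
proof -
  let ?S = "{z. \<bar>Im z\<bar> < Re z}"
  let ?h = "\<lambda>z. z powr (of_real s) * moment s (z\<^sup>2 / 2) (c * z)"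
  have "\<exists>k. \<forall>z\<in>?S. ?h z = k"
  proof (rule has_field_derivative_zero_constant)
    show "convex ?S"
    proof -
      have "?S = {z. inner (Complex 1 1) z > 0} \<inter> {z. inner (Complex 1 (-1)) z > 0}"
        by (auto simp: inner_complex_def)
      then show ?thesis by (simp add: convex_Int convex_halfspace_gt)
    qed
    fix z :: complex assume "z \<in> ?S"
    then have z: "\<bar>Im z\<bar> < Re z" by simp
    then have z': "z \<notin> \<real>\<^sub>\<le>\<^sub>0" by (auto simp: complex_nonpos_Reals_iff)
    have pos: "Re (z\<^sup>2) > 0"
      using power_strict_mono[of "\<bar>Im z\<bar>" "Re z" 2] z by (simp add: power2_eq_square)
    \<comment> \<open>A neighbourhood on which \<open>Re (w\<^sup>2)\<close> stays above half its
      value at \<open>z\<close> makes the domination uniform, as differentiation under the integral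
      requires.\<close>
    have "((\<lambda>w. Re (w\<^sup>2)) \<longlongrightarrow> Re (z\<^sup>2)) (at z)" by (intro tendsto_intros)
    then have "\<forall>\<^sub>F w in at z. Re (w\<^sup>2) > Re (z\<^sup>2) / 2"
      by (rule order_tendstoD) (use pos in simp)
    then obtain d where d: "d > 0" "\<And>w. w \<noteq> z \<Longrightarrow> dist w z < d \<Longrightarrow> Re (w\<^sup>2) > Re (z\<^sup>2) / 2"
      unfolding eventually_at by auto
    define \<delta> where "\<delta> = min d 1"
    have \<delta>: "\<delta> > 0" using d by (simp add: \<delta>_def)
    have nw: "norm w \<le> norm z + 1" if "w \<in> ball z \<delta>" for w
      using norm_triangle_sub[of w z] that by (simp add: dist_norm norm_minus_commute \<delta>_def)
    have dom: "exp_dominated (w\<^sup>2 / 2) (c * w) 1 ((norm c * (norm z + 1) + 1)\<^sup>2 / (4 * (Re (z\<^sup>2) / 4)))"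
      if w: "w \<in> ball z \<delta>" for w
    proof (rule exp_dominated_quadratic)
      show "Re (z\<^sup>2) / 4 > 0" using pos by simp
      show "Re (z\<^sup>2) / 4 \<le> Re (w\<^sup>2 / 2)"
        using d(2)[of w] w pos by (cases "w = z") (auto simp: \<delta>_def dist_commute)
      show "norm (c * w) \<le> norm c * (norm z + 1)"
        using nw[OF w] by (simp add: norm_mult mult_left_mono)
    qed
    have 1: "((\<lambda>z. moment s ((\<lambda>z. z\<^sup>2 / 2) z) ((\<lambda>z. c * z) z)) has_field_derivative
     - ((\<lambda>z. z) z * moment (s + 2) ((\<lambda>z. z\<^sup>2 / 2) z) ((\<lambda>z. c * z) z) + (\<lambda>_. c) z * moment (s + 1) ((\<lambda>z. z\<^sup>2 / 2) z) ((\<lambda>z. c * z) z))) (at z)"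
      by (rule has_field_derivative_moment_aux[OF s \<delta> zero_less_one dom, where D="norm z + 1 + norm c"])
        (use nw in \<open>auto intro!: derivative_eq_intros intro: order_trans[OF nw] simp: add_nonneg_nonneg\<close>)
    have 2: "(?h has_field_derivative z powr s * - (z * moment (s + 2) (z\<^sup>2/2) (c * z) + c * moment (s + 1) (z\<^sup>2/2) (c * z)) + (s * z powr (s - 1)) * moment s (z\<^sup>2/2) (c * z)) (at z)"
      using DERIV_mult[OF has_field_derivative_powr[OF z', of s] 1] by (simp add: algebra_simps)
    have "s * moment s (z\<^sup>2/2) (c * z) = z * (z * moment (s + 2) (z\<^sup>2/2) (c * z) + c * moment (s + 1) (z\<^sup>2/2) (c * z))"
      using moment_recurrence[OF s zero_less_one dom[of z]] \<delta> by (simp add: algebra_simps power2_eq_square)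
    moreover have "z powr s = z * z powr (s - 1)"
      using z by (auto simp: powr_diff)
    ultimately have "z powr s * - (z * moment (s + 2) (z\<^sup>2/2) (c * z) + c * moment (s + 1) (z\<^sup>2/2) (c * z)) + (s * z powr (s - 1)) * moment s (z\<^sup>2/2) (c * z) = 0"
      by (simp only: mult.assoc mult.left_commute[of s "z powr (s - 1)"]) (simp add: algebra_simps)
    with 2 show "(?h has_field_derivative 0) (at z within ?S)"
      by (simp add: has_field_derivative_at_within)
  qed
  then obtain k where k: "\<And>z. z \<in> ?S \<Longrightarrow> ?h z = k" by blast
  from k[of 1] k[of \<omega>] \<omega> show ?thesis by simp
qed

text \<open>On the convex right half-plane the derivative of \<open>exp (- w)\<close> has norm at
  most \<open>1\<close>.\<close>

lemma norm_exp_minus_1_le: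
  fixes \<zeta> :: complex
  assumes "Re \<zeta> \<ge> 0"
  shows "norm (exp (- \<zeta>) - 1) \<le> norm \<zeta>"
proof -
  have "norm (exp (- \<zeta>) - exp (- 0)) \<le> 1 * norm (\<zeta> - 0)"
  proof (rule field_differentiable_bound[where S="{z. Re z \<ge> 0}" and f'="\<lambda>w. - exp (- w)"])
    show "convex {z. Re z \<ge> 0}" by (rule convex_halfspace_Re_ge)
  qed (use assms in \<open>auto intro!: derivative_eq_intros\<close>)
  then show ?thesis by simp
qed

section \<open>Parabolic cylinder functions and their asymptotics\<close>

text \<open>In classical notation this is \<open>Gamma s * exp (z\<^sup>2 / 2)\<close> times the
  parabolic cylinder function \<open>D\<close> of order \<open>- s\<close> at
  \<open>sqrt 2 * z\<close>.\<close>

definition cyl :: "real \<Rightarrow> complex \<Rightarrow> complex" where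
  "cyl s z = moment s (1/2) (of_real (sqrt 2) * z)"

lemma has_field_derivative_cyl:
  "s > 0 \<Longrightarrow> (cyl s has_field_derivative - (of_real (sqrt 2) * cyl (s + 1) z)) (at z)"
  unfolding cyl_def[abs_def] by (rule has_field_derivative_moment_linear)

lemma cyl_recurrence:
  assumes "s > 0"
  shows "s * cyl s z = cyl (s + 2) z + of_real (sqrt 2) * z * cyl (s + 1) z"
proof -
  have "exp_dominated (1/2) (of_real (sqrt 2) * z) 1 ((norm (of_real (sqrt 2) * z) + 1)\<^sup>2 / (4 * (1/2)))"
    by (rule exp_dominated_quadratic) auto
  from moment_recurrence[OF assms zero_less_one this] show ?thesis
    by (simp add: cyl_def)
qed

lemma cyl_cnj: "cyl s (cnj z) = cnj (cyl s z)"
proof -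
  have "moment_kernel s (1/2) (of_real (sqrt 2) * cnj z) r = cnj (moment_kernel s (1/2) (of_real (sqrt 2) * z) r)" for r
    by (simp add: moment_kernel_def exp_cnj)
  then show ?thesis by (simp add: cyl_def moment_def)
qed

text \<open>On the imaginary axis the integral defining \<^const>\<open>cyl\<close> only oscillates. Rotating the ray of
  integration by \<open>- \<pi> / 8\<close> restores exponential decay uniformly in the closed quadrant.\<close>

lemma cyl_asymp_quadrant:
  assumes s: "s > 0"
  obtains C where "C \<ge> 0" and "\<And>z. Re z \<ge> 0 \<Longrightarrow> Im z \<ge> 0 \<Longrightarrow> z \<noteq> 0 \<Longrightarrow>
    \<bar>norm (cyl s z) - Gamma s * (sqrt 2 * norm z) powr (- s)\<bar> \<le> C * norm z powr (- (s + 2))"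
proof -
  \<comment> \<open>Any fixed angle strictly between \<open>- pi / 4\<close> and \<open>0\<close>
    would serve: the Gaussian factor stays bounded since
    \<open>Re (\<omega>\<^sup>2) \<ge> 0\<close>, while \<open>Re (z * \<omega>)\<close> is at least
    a positive multiple of \<open>Re z + Im z\<close>.\<close>
  define \<omega> where "\<omega> = cis (- pi / 8)"
  define \<kappa> where "\<kappa> = sqrt 2 * sin (pi / 8)"
  have sin_pos: "sin (pi / 8) > 0" by (rule sin_gt_zero) (auto intro: order.strict_trans2[OF _ pi_ge_two])
  have sin_less: "sin (pi / 8) < cos (pi / 8)"
    unfolding cos_sin_eq[of "pi / 8"] by (rule sin_monotone_2pi) (use pi_gt_zero in auto)
  have \<kappa>: "\<kappa> > 0" using sin_pos by (simp add: \<kappa>_def)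
  have \<omega>1: "\<bar>Im \<omega>\<bar> < Re \<omega>" using sin_less sin_pos by (simp add: \<omega>_def)
  have norm_\<omega>: "norm \<omega> = 1" by (simp add: \<omega>_def)
  have \<omega>2: "Re (\<omega>\<^sup>2) \<ge> 0"
    using power_strict_mono[of "\<bar>Im \<omega>\<bar>" "Re \<omega>" 2] \<omega>1 by (simp add: power2_eq_square)
  define C where "C = Gamma (s + 2) / \<kappa> powr (s + 2)"
  show ?thesis
  proof
    show "C \<ge> 0" using s Gamma_real_pos[of "s + 2"] by (simp add: C_def)
    fix z assume z: "Re z \<ge> 0" "Im z \<ge> 0" "z \<noteq> 0"
    define B where "B = of_real (sqrt 2) * z * \<omega>"
    have B: "\<kappa> * norm z \<le> Re B"
    proof -
      have "norm z * sin (pi/8) \<le> (Re z + Im z) * sin (pi/8)"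
        using cmod_le[of z] z sin_pos by (intro mult_right_mono) auto
      also have "\<dots> \<le> Re z * cos (pi/8) + Im z * sin (pi/8)"
        using z sin_less by (simp add: distrib_right mult_left_mono)
      also have "sqrt 2 * \<dots> = Re B" by (simp add: B_def \<omega>_def algebra_simps)
      finally show ?thesis by (simp add: \<kappa>_def mult_ac) 
    qed
    have \<epsilon>: "\<kappa> * norm z > 0" using \<kappa> z by simp
    have d0: "exp_dominated 0 B (\<kappa> * norm z) 0" and d1: "exp_dominated (\<omega>\<^sup>2/2) B (\<kappa> * norm z) 0"
      using B \<omega>2 by (auto intro!: exp_dominated_linear)
    note i0 = integrable_moment_kernel[OF s \<epsilon> d0] and i1 = integrable_moment_kernel[OF s \<epsilon> d1]
    \<comment> \<open>The extra factor \<open>r\<^sup>2\<close> bounds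
      \<open>exp (- \<omega>\<^sup>2 r\<^sup>2 / 2) - 1\<close>. It raises the index of the Gamma
      integral from \<open>s\<close> to \<open>s + 2\<close> and thereby gains
      \<open>norm z powr (- 2)\<close>.\<close>
    let ?g = "\<lambda>r. indicator {0<..} r * (r powr (s + 2 - 1) * exp (- ((\<kappa> * norm z) * r)))"
    have "norm (moment s (\<omega>\<^sup>2/2) B - moment s 0 B) = norm (\<integral>r. moment_kernel s (\<omega>\<^sup>2/2) B r - moment_kernel s 0 B r \<partial>lborel)"
      using i0 i1 by (simp add: moment_def)
    also have "\<dots> \<le> (\<integral>r. ?g r \<partial>lborel)"
    proof (rule Bochner_Integration.integral_norm_bound_integral)
      show "integrable lborel (\<lambda>r. moment_kernel s (\<omega>\<^sup>2/2) B r - moment_kernel s 0 B r)" using i0 i1 by simp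
      show "integrable lborel ?g" using s \<epsilon> by (intro Gamma_kernel_integrable(1)) auto
      fix r :: real
      show "norm (moment_kernel s (\<omega>\<^sup>2/2) B r - moment_kernel s 0 B r) \<le> ?g r"
      proof (cases "r > 0")
        case True
        have "moment_kernel s (\<omega>\<^sup>2/2) B r - moment_kernel s 0 B r = moment_kernel s 0 B r * (exp (- (\<omega>\<^sup>2/2 * of_real r ^ 2)) - 1)"
        proof -
          have "exp (- x - y) = exp (- 0 - y) * exp (- x)" for x y :: complex
            by (simp add: exp_add[symmetric] algebra_simps)
          from this[of "\<omega>\<^sup>2 / 2 * of_real r ^ 2" "B * of_real r"] show ?thesis
            using True by (simp only: moment_kernel_def mult_zero_left indicator_simps greaterThan_iff scaleR_one right_diff_distrib mult.assoc mult_1_right)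
        qed
        also have "norm \<dots> \<le> norm (moment_kernel s 0 B r) * norm (\<omega>\<^sup>2/2 * of_real r ^ 2)"
        proof -
          have "Re (\<omega>\<^sup>2/2 * of_real r ^ 2) \<ge> 0"
            using \<omega>2 by (simp flip: of_real_power)
          from norm_exp_minus_1_le[OF this] show ?thesis
            unfolding norm_mult[of "moment_kernel s 0 B r"] by (rule mult_left_mono) simp
        qed
        also have "norm (\<omega>\<^sup>2/2 * of_real r ^ 2) \<le> r\<^sup>2"
          by (simp add: norm_mult norm_divide norm_power norm_\<omega>)
        also have "norm (moment_kernel s 0 B r) * r\<^sup>2 \<le> r powr (s - 1) * exp (- ((\<kappa> * norm z) * r)) * r\<^sup>2"
          using norm_moment_kernel_le[OF d0, of s r] True by (intro mult_right_mono) auto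
        also have "\<dots> = ?g r"
          using True by (simp add: powr_add powr_diff field_simps power2_eq_square)
        finally show ?thesis by (simp add: mult_left_mono)
      qed (simp add: moment_kernel_def)
    qed
    also have "\<dots> = Gamma (s + 2) / (\<kappa> * norm z) powr (s + 2)"
      using s \<epsilon> by (intro Gamma_kernel_integrable(2)) auto
    also have "\<dots> = C * norm z powr (- (s + 2))"
      using \<kappa> powr_minus_divide[of "norm z" "s + 2"] by (simp add: C_def powr_mult)
    finally have 1: "norm (moment s (\<omega>\<^sup>2/2) B - moment s 0 B) \<le> C * norm z powr (- (s + 2))" .
    have "norm (cyl s z) = norm (moment s (\<omega>\<^sup>2/2) B)"
      using moment_rotate[OF s \<omega>1, of "of_real (sqrt 2) * z"] norm_\<omega>
      by (simp add: cyl_def B_def norm_mult norm_powr_real_powr')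
    moreover have "norm (moment s 0 B) = Gamma s * (sqrt 2 * norm z) powr (- s)"
    proof -
      have "moment s 0 B = of_real (Gamma s) * B powr (- of_real s)"
        using B \<epsilon> by (intro moment_Gamma s) auto
      moreover have "norm B = sqrt 2 * norm z" by (simp add: B_def norm_mult norm_\<omega>)
      ultimately show ?thesis
        using Gamma_real_pos[OF s] by (simp add: norm_mult norm_powr_real_powr')
    qed
    moreover have "\<bar>norm (moment s (\<omega>\<^sup>2/2) B) - norm (moment s 0 B)\<bar> \<le> norm (moment s (\<omega>\<^sup>2/2) B - moment s 0 B)"
      by (rule norm_triangle_ineq3)
    ultimately show "\<bar>norm (cyl s z) - Gamma s * (sqrt 2 * norm z) powr (- s)\<bar> \<le> C * norm z powr (- (s + 2))"
      using 1 by simp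
  qed
qed

text \<open>Conjugation carries the upper quadrant to the lower one.\<close>

lemma cyl_asymp:
  assumes s: "s > 0"
  obtains C where "C \<ge> 0" and "\<And>z. Re z \<ge> 0 \<Longrightarrow> z \<noteq> 0 \<Longrightarrow>
    \<bar>norm (cyl s z) - Gamma s * (sqrt 2 * norm z) powr (- s)\<bar> \<le> C * norm z powr (- (s + 2))"
proof -
  obtain C where C: "C \<ge> 0" "\<And>z. Re z \<ge> 0 \<Longrightarrow> Im z \<ge> 0 \<Longrightarrow> z \<noteq> 0 \<Longrightarrow>
    \<bar>norm (cyl s z) - Gamma s * (sqrt 2 * norm z) powr (- s)\<bar> \<le> C * norm z powr (- (s + 2))"
    using cyl_asymp_quadrant[OF s] by blast
  show ?thesis
  proof (rule that[OF C(1)])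
    fix z assume z: "Re z \<ge> 0" "z \<noteq> 0"
    show "\<bar>norm (cyl s z) - Gamma s * (sqrt 2 * norm z) powr (- s)\<bar> \<le> C * norm z powr (- (s + 2))"
      using C(2)[of z] C(2)[of "cnj z"] z by (cases "Im z \<ge> 0") (auto simp: cyl_cnj)
  qed
qed

text \<open>The substitution \<open>t = r\<^sup>2 / 2\<close> turns the Gaussian moment into Euler's
  integral at \<open>s / 2\<close>.\<close>

lemma cyl_0:
  assumes s: "s > 0"
  shows "cyl s 0 = of_real (2 powr (s / 2 - 1) * Gamma (s / 2))"
proof -
  let ?f = "\<lambda>t. 2 powr (s / 2 - 1) * (t powr (s / 2 - 1) * exp (- t)) :: real"
  let ?k = "\<lambda>r. r powr (s - 1) * exp (- (r\<^sup>2 / 2)) :: real"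
  have s2: "s / 2 > 0" using s by simp
  have "set_integrable lebesgue {0<..} ?f \<and> integral {0<..} ?f = 2 powr (s / 2 - 1) * Gamma (s / 2)"
  proof -
    have i: "set_integrable lborel {0<..} ?f"
      using integrable_mult_right[OF Gamma_kernel_integrable(1)[OF s2 zero_less_one], of "2 powr (s / 2 - 1)"]
      by (simp add: set_integrable_def mult.left_commute)
    have v: "(LBINT t:{0<..}. ?f t) = 2 powr (s / 2 - 1) * Gamma (s / 2)"
      using Gamma_kernel_integrable(2)[OF s2 zero_less_one]
      by (simp add: set_lebesgue_integral_def mult.left_commute[of _ "2 powr (s / 2 - 1)"])
    show ?thesis
      using set_borel_integral_eq_integral(2)[OF i] v i
      by (auto simp: set_integrable_def intro: integrable_completion[THEN iffD2])
  qed
  moreover have "(\<lambda>r::real. r\<^sup>2 / 2) ` {0<..} = {0<..}"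
  proof (intro equalityI subsetI)
    fix t :: real assume "t \<in> {0<..}"
    then show "t \<in> (\<lambda>r::real. r\<^sup>2 / 2) ` {0<..}"
      by (intro image_eqI[where x="sqrt (2 * t)"]) auto
  qed auto
  ultimately have "(\<lambda>r. \<bar>r\<bar> * ?f (r\<^sup>2 / 2)) absolutely_integrable_on {0<..} \<and>
      integral {0<..} (\<lambda>r. \<bar>r\<bar> * ?f (r\<^sup>2 / 2)) = 2 powr (s / 2 - 1) * Gamma (s / 2)"
    by (subst has_absolute_integral_change_of_variables_1'[where g="\<lambda>r. r\<^sup>2 / 2"])
      (auto intro!: derivative_eq_intros inj_onI simp: power2_eq_iff_nonneg)
  moreover have eq: "\<bar>r\<bar> * ?f (r\<^sup>2 / 2) = ?k r" if "r \<in> {0<..}" for r :: real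
  proof -
    have "(r\<^sup>2 / 2) powr (s / 2 - 1) = r powr (s - 2) / 2 powr (s / 2 - 1)"
      using that by (simp add: powr_divide powr_powr flip: powr_numeral)
    moreover have "r powr (s - 1) = r * r powr (s - 2)"
      using that by (simp add: powr_diff field_simps power2_eq_square)
    ultimately show ?thesis using that by simp
  qed
  moreover have "(\<lambda>r. \<bar>r\<bar> * ?f (r\<^sup>2 / 2)) absolutely_integrable_on {0<..} \<longleftrightarrow> ?k absolutely_integrable_on {0<..}"
    by (rule set_integrable_cong) (simp_all only: eq)
  moreover have "integral {0<..} (\<lambda>r. \<bar>r\<bar> * ?f (r\<^sup>2 / 2)) = integral {0<..} ?k"
    by (rule Henstock_Kurzweil_Integration.integral_cong) (simp only: eq)
  ultimately have 1: "?k absolutely_integrable_on {0<..}" "integral {0<..} ?k = 2 powr (s / 2 - 1) * Gamma (s / 2)"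
    by (simp_all only:)
  then have "(\<integral>r. indicator {0<..} r * ?k r \<partial>lborel) = 2 powr (s / 2 - 1) * Gamma (s / 2)"
    using set_lebesgue_integral_eq_integral(2)[OF 1(1)]
    by (simp add: set_lebesgue_integral_def integral_completion)
  moreover have "moment_kernel s (1/2) 0 = (\<lambda>r. of_real (indicator {0<..} r * ?k r))"
    by (auto simp: moment_kernel_def fun_eq_iff indicator_def exp_of_real[symmetric])
  ultimately have "moment s (1/2) 0 = of_real (2 powr (s / 2 - 1) * Gamma (s / 2))"
    by (simp only: moment_def integral_complex_of_real)
  then show ?thesis by (simp add: cyl_def)
qed

text \<open>Legendre's duplication formula merges \<open>Gamma (s / 2)\<close> and
  \<open>Gamma (s / 2 + 1/2)\<close>. The Wronskian at \<open>z = 0\<close> is a multiple of this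
  product.\<close>

lemma cyl_0_mult:
  assumes s: "s > 0"
  shows "cyl s 0 * cyl (s + 1) 0 = of_real (sqrt pi * Gamma s / sqrt 2)"
proof -
  have ni: "complex_of_real (s / 2) \<notin> \<int>\<^sub>\<le>\<^sub>0" "complex_of_real (s / 2) + 1/2 \<notin> \<int>\<^sub>\<le>\<^sub>0"
    using s by (auto elim!: nonpos_Ints_cases simp: complex_eq_iff)
  have "complex_of_real (Gamma (s / 2) * Gamma (s / 2 + 1/2)) = of_real (exp ((1 - s) * ln 2) * sqrt pi * Gamma s)"
    using Gamma_legendre_duplication[OF ni]
    by (simp flip: Gamma_complex_of_real exp_of_real)
  then have "Gamma (s / 2) * Gamma (s / 2 + 1/2) = exp ((1 - s) * ln 2) * sqrt pi * Gamma s"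
    using of_real_eq_iff by blast
  also have "exp ((1 - s) * ln 2) = 2 powr (1 - s)" by (simp add: powr_def)
  finally have g: "Gamma (s / 2) * Gamma (s / 2 + 1/2) = 2 powr (1 - s) * sqrt pi * Gamma s" .
  have "2 powr (s / 2 - 1) * 2 powr ((s + 1) / 2 - 1) * 2 powr (1 - s) = 2 powr (- (1/2))"
    by (simp add: powr_add[symmetric] field_simps)
  also have "\<dots> = 1 / sqrt 2" by (simp add: powr_minus powr_half_sqrt field_simps)
  finally have p: "2 powr (s / 2 - 1) * 2 powr ((s + 1) / 2 - 1) * 2 powr (1 - s) = 1 / sqrt 2" .
  have "cyl s 0 * cyl (s + 1) 0 = of_real ((2 powr (s / 2 - 1) * 2 powr ((s + 1) / 2 - 1)) * (Gamma (s / 2) * Gamma (s / 2 + 1/2)))"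
    using s by (simp add: cyl_0 add_divide_distrib)
  also have "(2 powr (s / 2 - 1) * 2 powr ((s + 1) / 2 - 1)) * (Gamma (s / 2) * Gamma (s / 2 + 1/2)) = (2 powr (s / 2 - 1) * 2 powr ((s + 1) / 2 - 1) * 2 powr (1 - s)) * (sqrt pi * Gamma s)"
    unfolding g by simp
  finally show ?thesis unfolding p by simp
qed

section \<open>Solutions of the Dirac system\<close>

text \<open>The pair \<open>(u, w)\<close> solves \<open>u' = z u + m w\<close>, \<open>w' = - z w + m u\<close>; it is the decaying solution in the
  basis that diagonalises \<open>\<sigma>\<^sub>1\<close>, and \<open>sol1\<close>, \<open>sol2\<close> are its components in the original basis.\<close>

definition sol_u :: "real \<Rightarrow> complex \<Rightarrow> complex" where
  "sol_u m z = - of_real (sqrt 2 / m) * (exp (- (z\<^sup>2 / 2)) * cyl (m\<^sup>2 / 2 + 1) z)"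

definition sol_w :: "real \<Rightarrow> complex \<Rightarrow> complex" where
  "sol_w m z = exp (- (z\<^sup>2 / 2)) * cyl (m\<^sup>2 / 2) z"

definition sol1 :: "real \<Rightarrow> complex \<Rightarrow> complex" where
  "sol1 m z = (sol_u m z + \<i> * sol_w m z) / of_real (sqrt 2)"

definition sol2 :: "real \<Rightarrow> complex \<Rightarrow> complex" where
  "sol2 m z = (sol_u m z - \<i> * sol_w m z) / of_real (sqrt 2)"

lemma has_field_derivative_sol_w:
  assumes "m > 0"
  shows "(sol_w m has_field_derivative (- z * sol_w m z + m * sol_u m z)) (at z)"
proof -
  have s: "m\<^sup>2 / 2 > 0" using assms by simp
  have "(sol_w m has_field_derivative (exp (- (z\<^sup>2 / 2)) * (- z) * cyl (m\<^sup>2 / 2) z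
      + - (of_real (sqrt 2) * cyl (m\<^sup>2 / 2 + 1) z) * exp (- (z\<^sup>2 / 2)))) (at z)"
    unfolding sol_w_def[abs_def]
    by (rule DERIV_mult[OF _ has_field_derivative_cyl[OF s]]) (auto intro!: derivative_eq_intros)
  then show ?thesis
    using assms by (simp add: sol_w_def sol_u_def field_simps)
qed

lemma has_field_derivative_sol_u:
  assumes "m > 0"
  shows "(sol_u m has_field_derivative (z * sol_u m z + m * sol_w m z)) (at z)"
proof -
  have s: "m\<^sup>2 / 2 > 0" "m\<^sup>2 / 2 + 1 > 0" using assms by (auto simp: add_pos_pos)
  define e where "e = exp (- (z\<^sup>2 / 2))"
  have "(sol_u m has_field_derivative - of_real (sqrt 2 / m) * (exp (- (z\<^sup>2 / 2)) * (- z) * cyl (m\<^sup>2 / 2 + 1) z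
      + - (of_real (sqrt 2) * cyl (m\<^sup>2 / 2 + 1 + 1) z) * exp (- (z\<^sup>2 / 2)))) (at z)"
    unfolding sol_u_def[abs_def]
    by (rule DERIV_cmult, rule DERIV_mult[OF _ has_field_derivative_cyl[OF s(2)]]) (auto intro!: derivative_eq_intros)
  \<comment> \<open>The recurrence reduces the index produced by differentiation to the two that
    occur in \<open>sol_u\<close> and \<open>sol_w\<close>. The factor \<open>sqrt 2 / m\<close> in
    \<open>sol_u\<close> makes the coupling constant equal to \<open>m\<close> in both
    equations.\<close>
  moreover have "cyl (m\<^sup>2 / 2 + 1 + 1) z = (m\<^sup>2 / 2) * cyl (m\<^sup>2 / 2) z - of_real (sqrt 2) * z * cyl (m\<^sup>2 / 2 + 1) z"
    using cyl_recurrence[OF s(1), of z] by (simp add: add.assoc eq_diff_eq)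
  moreover have "- of_real (sqrt 2 / m) * (e * (- z) * c1
      + - (of_real (sqrt 2) * ((m\<^sup>2 / 2) * c0 - of_real (sqrt 2) * z * c1)) * e)
    = z * (- of_real (sqrt 2 / m) * (e * c1)) + m * (e * c0)" for c0 c1 :: complex
  proof -
    have r: "complex_of_real (sqrt 2) * of_real (sqrt 2) = 2" by (simp flip: of_real_mult)
    have "- of_real (sqrt 2 / m) * (e * (- z) * c1 + - (of_real (sqrt 2) * ((m\<^sup>2 / 2) * c0 - of_real (sqrt 2) * z * c1)) * e)
      = of_real (sqrt 2 / m) * e * z * c1 + (of_real (sqrt 2) * of_real (sqrt 2)) / of_real m * e * (m\<^sup>2 / 2) * c0
         - of_real (sqrt 2 / m) * ((of_real (sqrt 2) * of_real (sqrt 2)) * z * c1 * e)"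
      by (simp add: algebra_simps)
    also have "\<dots> = z * (- of_real (sqrt 2 / m) * (e * c1)) + m * (e * c0)"
      unfolding r using assms by (simp add: field_simps power2_eq_square)
    finally show ?thesis .
  qed
  ultimately show ?thesis
    by (simp add: sol_w_def sol_u_def flip: e_def)
qed

lemma has_field_derivative_sol1:
  assumes "m > 0"
  shows "(sol1 m has_field_derivative ((z + \<i> * m) * sol2 m z)) (at z)"
proof -
  have "(sol1 m has_field_derivative ((z * sol_u m z + m * sol_w m z) + \<i> * (- z * sol_w m z + m * sol_u m z)) / of_real (sqrt 2)) (at z)"
    unfolding sol1_def[abs_def]
    by (intro DERIV_cdivide DERIV_add DERIV_cmult has_field_derivative_sol_u has_field_derivative_sol_w assms)
  then show ?thesis by (simp add: sol2_def algebra_simps add_divide_distrib diff_divide_distrib)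
qed

lemma has_field_derivative_sol2:
  assumes "m > 0"
  shows "(sol2 m has_field_derivative ((z - \<i> * m) * sol1 m z)) (at z)"
proof -
  have "(sol2 m has_field_derivative ((z * sol_u m z + m * sol_w m z) - \<i> * (- z * sol_w m z + m * sol_u m z)) / of_real (sqrt 2)) (at z)"
    unfolding sol2_def[abs_def]
    by (intro DERIV_cdivide DERIV_diff DERIV_cmult has_field_derivative_sol_u has_field_derivative_sol_w assms)
  then show ?thesis by (simp add: sol1_def algebra_simps add_divide_distrib diff_divide_distrib)
qed

text \<open>\<open>sol_u\<close> and \<open>sol_w\<close> commute with conjugation, so only the sign
  of \<open>\<i>\<close> changes, which exchanges the components. On a line
  \<open>Im z = \<lambda>\<close> this expresses the reflected solution through the values at
  \<open>- z\<close>.\<close>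

lemma sol_cnj: "sol1 m (cnj z) = cnj (sol2 m z)"
  by (simp add: sol1_def sol2_def sol_u_def sol_w_def cyl_cnj exp_cnj)

text \<open>The left-hand side is the determinant of the solution and of
  \<open>(sol2 m (- z), sol1 m (- z))\<close>, which solves the same system. The coefficient matrix
  has trace zero, so the determinant is constant on the whole plane and may be evaluated at
  \<open>0\<close>.\<close>

lemma sol_wronskian:
  assumes m: "m > 0"
  shows "sol1 m z * sol1 m (- z) - sol2 m z * sol2 m (- z) = - \<i> * of_real (2 / m * sqrt pi * Gamma (m\<^sup>2 / 2))"
proof -
  let ?W = "\<lambda>z. sol1 m z * sol1 m (- z) - sol2 m z * sol2 m (- z)"
  have s: "m\<^sup>2 / 2 > 0" using assms by simp
  have "\<exists>k. \<forall>z\<in>UNIV. ?W z = k"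
  proof (rule has_field_derivative_zero_constant)
    fix z
    have 1: "((\<lambda>z. sol1 m (- z)) has_field_derivative (- z + \<i> * m) * sol2 m (- z) * (-1)) (at z)"
      by (rule DERIV_chain2[OF has_field_derivative_sol1[OF m]]) (auto intro!: derivative_eq_intros)
    have 2: "((\<lambda>z. sol2 m (- z)) has_field_derivative (- z - \<i> * m) * sol1 m (- z) * (-1)) (at z)"
      by (rule DERIV_chain2[OF has_field_derivative_sol2[OF m]]) (auto intro!: derivative_eq_intros)
    have "(?W has_field_derivative 0) (at z)"
      by (rule DERIV_cong[OF DERIV_diff[OF DERIV_mult[OF has_field_derivative_sol1[OF m] 1] DERIV_mult[OF has_field_derivative_sol2[OF m] 2]]])
        (simp add: algebra_simps)
    then show "(?W has_field_derivative 0) (at z within UNIV)" by simp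
  qed simp
  then obtain k where k: "\<And>z. ?W z = k" by auto
  have "?W z = ?W 0" by (simp only: k)
  also have "\<dots> = 2 * \<i> * (sol_u m 0 * sol_w m 0)"
    by (simp add: sol1_def sol2_def field_simps flip: of_real_mult power2_eq_square of_real_power)
      (simp add: power2_eq_square algebra_simps)
  also have "sol_u m 0 * sol_w m 0 = - of_real (sqrt 2 / m) * (cyl (m\<^sup>2 / 2) 0 * cyl (m\<^sup>2 / 2 + 1) 0)"
    by (simp add: sol_u_def sol_w_def)
  also have "\<dots> = - of_real (sqrt pi * Gamma (m\<^sup>2 / 2) / m)"
    unfolding cyl_0_mult[OF s] by simp
  finally show ?thesis by (simp add: mult_ac)
qed

section \<open>Size of the decaying solution\<close>

definition sol_norm2 :: "real \<Rightarrow> complex \<Rightarrow> real" where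
  "sol_norm2 m z = (norm (sol_u m z))\<^sup>2 + (norm (sol_w m z))\<^sup>2"

lemma sol_norm2_eq: "(norm (sol1 m z))\<^sup>2 + (norm (sol2 m z))\<^sup>2 = sol_norm2 m z"
  by (simp add: sol1_def sol2_def sol_norm2_def norm_divide power_divide cmod_power2)
    (simp add: power2_eq_square field_simps)

lemma norm_exp_half_square: "(norm (exp (- (z\<^sup>2 / 2))))\<^sup>2 = exp ((Im z)\<^sup>2 - (Re z)\<^sup>2)"
proof -
  have "(norm (exp (- (z\<^sup>2 / 2))))\<^sup>2 = exp (2 * Re (- (z\<^sup>2 / 2)))"
    by (simp only: norm_exp_eq_Re exp_double)
  moreover have "2 * Re (- (z\<^sup>2 / 2)) = (Im z)\<^sup>2 - (Re z)\<^sup>2" by (simp add: Re_power2 field_simps)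
  ultimately show ?thesis by (simp only:)
qed

text \<open>\<open>sol_w\<close> carries the leading term. The index in \<open>sol_u\<close> is
  larger by one, so \<open>sol_u\<close> gains a factor \<open>1 / norm z\<close>, and its square is
  already of the order of the error.\<close>

lemma sol_norm2_asymp:
  assumes m: "m > 0"
  obtains C where "C \<ge> 0" and "\<And>z. Re z \<ge> 0 \<Longrightarrow> norm z \<ge> 1 \<Longrightarrow>
    \<bar>sol_norm2 m z - (Gamma (m\<^sup>2 / 2))\<^sup>2 / 2 powr (m\<^sup>2 / 2) * norm z powr (- (m\<^sup>2)) * exp ((Im z)\<^sup>2 - (Re z)\<^sup>2)\<bar>
      \<le> C * norm z powr (- (m\<^sup>2) - 2) * exp ((Im z)\<^sup>2 - (Re z)\<^sup>2)"
proof -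
  define s where "s = m\<^sup>2 / 2"
  have s: "s > 0" "s + 1 > 0" using m by (auto simp: s_def add_pos_pos)
  obtain C0 where C0: "C0 \<ge> 0" "\<And>z. Re z \<ge> 0 \<Longrightarrow> z \<noteq> 0 \<Longrightarrow>
    \<bar>norm (cyl s z) - Gamma s * (sqrt 2 * norm z) powr (- s)\<bar> \<le> C0 * norm z powr (- (s + 2))"
    using cyl_asymp[OF s(1)] by blast
  obtain C1 where C1: "C1 \<ge> 0" "\<And>z. Re z \<ge> 0 \<Longrightarrow> z \<noteq> 0 \<Longrightarrow>
    \<bar>norm (cyl (s + 1) z) - Gamma (s + 1) * (sqrt 2 * norm z) powr (- (s + 1))\<bar> \<le> C1 * norm z powr (- (s + 1 + 2))"
    using cyl_asymp[OF s(2)] by blast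
  define K0 where "K0 = Gamma s * sqrt 2 powr (- s)"
  define K1 where "K1 = Gamma (s + 1) * sqrt 2 powr (- (s + 1)) + C1"
  have K0: "K0 \<ge> 0" using Gamma_real_pos[OF s(1)] by (simp add: K0_def)
  have K1: "K1 \<ge> 0" using Gamma_real_pos[OF s(2)] C1 by (simp add: K1_def)
  define C where "C = 2 / m\<^sup>2 * K1\<^sup>2 + (2 * K0 + C0) * C0"
  show ?thesis
  proof
    show "C \<ge> 0" using K0 C0 by (simp add: C_def)
    fix z assume z: "Re z \<ge> 0" "norm z \<ge> 1"
    define \<rho> where "\<rho> = norm z"
    have \<rho>: "\<rho> \<ge> 1" using z by (simp add: \<rho>_def)
    define E where "E = exp ((Im z)\<^sup>2 - (Re z)\<^sup>2)"
    have E: "E > 0" by (simp add: E_def)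
    have z0: "z \<noteq> 0" using z by auto
    define g where "g = K0 * \<rho> powr (- s)"
    have g: "g \<ge> 0" using K0 by (simp add: g_def)
    have w: "\<bar>norm (cyl s z) - g\<bar> \<le> C0 * \<rho> powr (- s - 2)"
      using C0(2)[OF z(1) z0] by (simp add: K0_def g_def \<rho>_def powr_mult algebra_simps)
    have u: "norm (cyl (s + 1) z) \<le> K1 * \<rho> powr (- (s + 1))"
    proof -
      have "C1 * \<rho> powr (- (s + 1 + 2)) \<le> C1 * \<rho> powr (- (s + 1))"
        using C1 \<rho> by (intro mult_left_mono powr_mono) auto
      then show ?thesis
        using C1(2)[OF z(1) z0] by (simp add: K1_def \<rho>_def powr_mult algebra_simps)
    qed
    have w2: "\<bar>(norm (cyl s z))\<^sup>2 - g\<^sup>2\<bar> \<le> (2 * K0 + C0) * C0 * \<rho> powr (- 2 * s - 2)"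
    proof -
      have "C0 * \<rho> powr (- s - 2) \<le> C0 * \<rho> powr (- s)" using C0 \<rho> by (intro mult_left_mono powr_mono) auto
      then have sum: "\<bar>norm (cyl s z) + g\<bar> \<le> (2 * K0 + C0) * \<rho> powr (- s)"
        using w g by (simp add: g_def algebra_simps)
      have "\<bar>(norm (cyl s z))\<^sup>2 - g\<^sup>2\<bar> = \<bar>norm (cyl s z) + g\<bar> * \<bar>norm (cyl s z) - g\<bar>"
        by (simp add: power2_eq_square abs_mult[symmetric] algebra_simps)
      also have "\<dots> \<le> ((2 * K0 + C0) * \<rho> powr (- s)) * (C0 * \<rho> powr (- s - 2))"
        by (rule mult_mono[OF sum w]) (use K0 C0 in auto)
      also have "\<dots> = (2 * K0 + C0) * C0 * (\<rho> powr (- s) * \<rho> powr (- s - 2))" by simp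
      also have "\<rho> powr (- s) * \<rho> powr (- s - 2) = \<rho> powr (- 2 * s - 2)" by (simp flip: powr_add)
      finally show ?thesis .
    qed
    have u2: "(norm (cyl (s + 1) z))\<^sup>2 \<le> K1\<^sup>2 * \<rho> powr (- 2 * s - 2)"
    proof -
      have "(norm (cyl (s + 1) z))\<^sup>2 \<le> (K1 * \<rho> powr (- (s + 1)))\<^sup>2"
        by (rule power_mono[OF u]) simp
      also have "\<dots> = K1\<^sup>2 * (\<rho> powr (- (s + 1)) * \<rho> powr (- (s + 1)))" by (simp add: power2_eq_square)
      also have "\<rho> powr (- (s + 1)) * \<rho> powr (- (s + 1)) = \<rho> powr (- 2 * s - 2)" by (simp flip: powr_add)
      finally show ?thesis .
    qed
    have "sol_norm2 m z = E * (2 / m\<^sup>2 * (norm (cyl (s + 1) z))\<^sup>2 + (norm (cyl s z))\<^sup>2)"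
      using norm_exp_half_square[of z] m
      by (simp add: sol_norm2_def sol_u_def sol_w_def norm_mult norm_divide power_mult_distrib power_divide E_def s_def algebra_simps)
    moreover have "g\<^sup>2 = (Gamma s)\<^sup>2 / 2 powr s * \<rho> powr (- (m\<^sup>2))"
    proof -
      have "(sqrt 2 powr (- s))\<^sup>2 = 1 / 2 powr s"
        by (simp add: powr_minus power_divide powr_half_sqrt[symmetric] powr_powr inverse_eq_divide flip: powr_numeral)
      moreover have "(\<rho> powr (- s))\<^sup>2 = \<rho> powr (- (m\<^sup>2))"
        by (simp add: s_def power2_eq_square flip: powr_add)
      ultimately show ?thesis by (simp add: g_def K0_def power_mult_distrib)
    qed
    ultimately have "\<bar>sol_norm2 m z - (Gamma s)\<^sup>2 / 2 powr s * \<rho> powr (- (m\<^sup>2)) * E\<bar>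
      = E * \<bar>2 / m\<^sup>2 * (norm (cyl (s + 1) z))\<^sup>2 + ((norm (cyl s z))\<^sup>2 - g\<^sup>2)\<bar>"
      using E by (simp add: abs_mult[of E, unfolded abs_of_pos[OF E], symmetric] algebra_simps)
    also have "\<dots> \<le> E * (C * \<rho> powr (- 2 * s - 2))"
    proof (rule mult_left_mono)
      have "2 / m\<^sup>2 * (norm (cyl (s + 1) z))\<^sup>2 \<le> 2 / m\<^sup>2 * (K1\<^sup>2 * \<rho> powr (- 2 * s - 2))"
        by (rule mult_left_mono[OF u2]) simp
      moreover have "0 \<le> 2 / m\<^sup>2 * (norm (cyl (s + 1) z))\<^sup>2" by simp
      moreover have "C * \<rho> powr (- 2 * s - 2) = 2 / m\<^sup>2 * (K1\<^sup>2 * \<rho> powr (- 2 * s - 2)) + (2 * K0 + C0) * C0 * \<rho> powr (- 2 * s - 2)"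
        by (simp only: C_def distrib_right mult.assoc)
      ultimately show "\<bar>2 / m\<^sup>2 * (norm (cyl (s + 1) z))\<^sup>2 + ((norm (cyl s z))\<^sup>2 - g\<^sup>2)\<bar> \<le> C * \<rho> powr (- 2 * s - 2)"
        using w2 by linarith
    qed (use E in simp)
    finally show "\<bar>sol_norm2 m z - (Gamma (m\<^sup>2 / 2))\<^sup>2 / 2 powr (m\<^sup>2 / 2) * norm z powr (- (m\<^sup>2)) * exp ((Im z)\<^sup>2 - (Re z)\<^sup>2)\<bar>
      \<le> C * norm z powr (- (m\<^sup>2) - 2) * exp ((Im z)\<^sup>2 - (Re z)\<^sup>2)"
      by (simp add: E_def s_def \<rho>_def mult_ac)
  qed
qed

text \<open>For large \<open>\<bar>l\<bar>\<close> the error in the asymptotics is at most half of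
  the leading term. Only a lower bound at \<open>x = 0\<close> is needed, since the size of
  \<open>Q - a P\<close> there is inversely proportional to this norm.\<close>

lemma norm_sol_w_imaginary_ge:
  assumes m: "m > 0"
  obtains c L where "c > 0" "L \<ge> 1" and "\<And>l. \<bar>l\<bar> \<ge> L \<Longrightarrow>
    c * \<bar>l\<bar> powr (- (m\<^sup>2 / 2)) * exp (l\<^sup>2 / 2) \<le> norm (sol_w m (Complex 0 l))"
proof -
  define s where "s = m\<^sup>2 / 2"
  have s: "s > 0" using m by (auto simp: s_def)
  obtain C0 where C0: "C0 \<ge> 0" "\<And>z. Re z \<ge> 0 \<Longrightarrow> z \<noteq> 0 \<Longrightarrow>
    \<bar>norm (cyl s z) - Gamma s * (sqrt 2 * norm z) powr (- s)\<bar> \<le> C0 * norm z powr (- (s + 2))"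
    using cyl_asymp[OF s] by blast
  define K0 where "K0 = Gamma s * sqrt 2 powr (- s)"
  have K0: "K0 > 0" using Gamma_real_pos[OF s] by (simp add: K0_def)
  define L where "L = max 1 (2 * C0 / K0)"
  show ?thesis
  proof
    show "K0 / 2 > 0" "L \<ge> 1" using K0 by (auto simp: L_def)
    fix l :: real assume l: "\<bar>l\<bar> \<ge> L"
    then have l1: "\<bar>l\<bar> \<ge> 1" and l2: "2 * C0 / K0 \<le> \<bar>l\<bar>" by (auto simp: L_def)
    have nz: "norm (Complex 0 l) = \<bar>l\<bar>" by (simp add: complex_norm)
    have "C0 * \<bar>l\<bar> powr (- (s + 2)) \<le> K0 / 2 * \<bar>l\<bar> powr (- s)"
    proof -
      have "C0 \<le> K0 / 2 * \<bar>l\<bar>" using l2 K0 by (simp add: field_simps)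
      also have "\<dots> \<le> K0 / 2 * \<bar>l\<bar> powr 2"
        using l1 K0 self_le_power[of "\<bar>l\<bar>" 2] by (intro mult_left_mono) auto
      finally have "C0 * \<bar>l\<bar> powr (- (s + 2)) \<le> K0 / 2 * \<bar>l\<bar> powr 2 * \<bar>l\<bar> powr (- (s + 2))"
        by (rule mult_right_mono) simp
      also have "\<dots> = K0 / 2 * \<bar>l\<bar> powr (- s)" by (simp only: mult.assoc flip: powr_add) simp
      finally show ?thesis .
    qed
    moreover have "\<bar>norm (cyl s (Complex 0 l)) - K0 * \<bar>l\<bar> powr (- s)\<bar> \<le> C0 * \<bar>l\<bar> powr (- (s + 2))"
      using C0(2)[of "Complex 0 l"] l1 nz by (simp add: K0_def powr_mult complex_eq_iff mult.assoc)
    ultimately have 1: "K0 / 2 * \<bar>l\<bar> powr (- s) \<le> norm (cyl s (Complex 0 l))" by simp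
    have 2: "norm (exp (- ((Complex 0 l)\<^sup>2 / 2))) = exp (l\<^sup>2 / 2)"
      by (simp add: norm_exp_eq_Re Re_power2)
    then show "K0 / 2 * \<bar>l\<bar> powr (- (m\<^sup>2 / 2)) * exp (l\<^sup>2 / 2) \<le> norm (sol_w m (Complex 0 l))"
      using mult_right_mono[OF 1, of "exp (l\<^sup>2 / 2)"]
      unfolding sol_w_def norm_mult 2 by (simp add: s_def mult.commute)
  qed
qed

section \<open>The Dirac system on a horizontal line\<close>

lemma norm_complex_2: "(norm (v :: complex^2))\<^sup>2 = (norm (v $ 1))\<^sup>2 + (norm (v $ 2))\<^sup>2"
  by (simp add: norm_vec_def L2_set_def sum_2)

text \<open>The symmetry of the system for a real spectral parameter: reflection of the line
  combined with conjugation. It exchanges decay at the two ends.\<close>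

definition reflect :: "(real \<Rightarrow> complex^2) \<Rightarrow> real \<Rightarrow> complex^2" where
  "reflect P x = (\<chi> i. cnj (P (- x) $ i))"

lemma norm_reflect [simp]: "norm (reflect P x) = norm (P (- x))"
  by (simp add: reflect_def norm_vec_def)

lemma reflect_nth [simp]: "reflect P x $ i = cnj (P (- x) $ i)"
  by (simp add: reflect_def)

definition solves_dirac :: "real \<Rightarrow> real \<Rightarrow> (real \<Rightarrow> complex^2) \<Rightarrow> bool" where
  "solves_dirac m l P \<longleftrightarrow>
     (\<forall>x. ((\<lambda>x. P x $ 1) has_vector_derivative Complex x (l + m) * P x $ 2) (at x) \<and>
          ((\<lambda>x. P x $ 2) has_vector_derivative Complex x (l - m) * P x $ 1) (at x))"

lemma solves_diracD:
  assumes "solves_dirac m l P"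
  shows "((\<lambda>x. P x $ 1) has_vector_derivative Complex x (l + m) * P x $ 2) (at x)"
    "((\<lambda>x. P x $ 2) has_vector_derivative Complex x (l - m) * P x $ 1) (at x)"
  using assms by (auto simp: solves_dirac_def)

lemma solves_dirac_continuous:
  assumes "solves_dirac m l P"
  shows "continuous_on UNIV P"
proof -
  have "continuous_on UNIV (\<lambda>x. P x $ i)" for i
  proof -
    have "continuous_on UNIV (\<lambda>x. P x $ 1)" "continuous_on UNIV (\<lambda>x. P x $ 2)"
      using solves_diracD[OF assms] by (auto intro!: continuous_at_imp_continuous_on has_vector_derivative_continuous)
    then show ?thesis using exhaust_2[of i] by auto
  qed
  then have "continuous_on UNIV (\<lambda>x. \<chi> i. P x $ i)" by (rule continuous_on_vec_lambda)
  then show ?thesis by simp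
qed

lemma solves_dirac_diff:
  assumes "solves_dirac m l P" "solves_dirac m l Q"
  shows "solves_dirac m l (\<lambda>x. Q x - a *s P x)"
  unfolding solves_dirac_def
proof (intro allI conjI)
  fix x
  note d = solves_diracD[OF assms(1), of x] solves_diracD[OF assms(2), of x]
  show "((\<lambda>x. (Q x - a *s P x) $ 1) has_vector_derivative Complex x (l + m) * (Q x - a *s P x) $ 2) (at x)"
    by (auto intro!: derivative_eq_intros d simp: algebra_simps)
  show "((\<lambda>x. (Q x - a *s P x) $ 2) has_vector_derivative Complex x (l - m) * (Q x - a *s P x) $ 1) (at x)"
    by (auto intro!: derivative_eq_intros d simp: algebra_simps)
qed

lemma solves_dirac_reflect:
  assumes "solves_dirac m l P"
  shows "solves_dirac m l (reflect P)"
proof -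
  have *: "((\<lambda>x. cnj (f (- x))) has_vector_derivative - cnj f') (at x)"
    if "(f has_vector_derivative f') (at (- x))" for f f' x
  proof -
    have "(uminus has_vector_derivative - 1) (at x)"
      by (rule has_vector_derivative_minus[OF has_vector_derivative_id])
    from vector_diff_chain_at[OF this that]
    have "((\<lambda>x. f (- x)) has_vector_derivative (-1) *\<^sub>R f') (at x)" by (simp add: o_def)
    from has_vector_derivative_cnj[OF this] show ?thesis by simp
  qed
  have c: "- cnj (Complex (- x) b * w) = Complex x b * cnj w" for x b w
    by (simp add: complex_eq_iff)
  show ?thesis
    unfolding solves_dirac_def reflect_nth
    using *[OF solves_diracD(1)[OF assms]] *[OF solves_diracD(2)[OF assms]]
    unfolding c by blast
qed

lemma has_real_derivative_norm_sq:
  assumes "(f has_vector_derivative f') (at x)"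
  shows "((\<lambda>x. (norm (f x :: complex))\<^sup>2) has_real_derivative 2 * inner (f x) f') (at x)"
proof -
  have "((\<lambda>x. inner (f x) (f x)) has_vector_derivative inner (f x) f' + inner f' (f x)) (at x)"
    by (rule bounded_bilinear.has_vector_derivative[OF bounded_bilinear_inner assms assms])
  then show ?thesis
    by (simp add: power2_norm_eq_inner has_real_derivative_iff_has_vector_derivative inner_commute)
qed

text \<open>The function \<open>h\<close> in the proof satisfies \<open>h' x \<ge> 2 sqrt (x\<^sup>2 + m\<^sup>2)\<close> with the sharp power of \<open>1 + x\<^sup>2\<close>;
  a larger power would not be compensated by the decay of the other solution.\<close>

lemma solves_dirac_growth:
  assumes sol: "solves_dirac m l R" and x: "x \<ge> 0"
  shows "(norm (R x))\<^sup>2 \<le> (norm (R 0))\<^sup>2 * exp (4 * (1 + m\<^sup>2)) * exp (x\<^sup>2) * (1 + x\<^sup>2) powr (m\<^sup>2 / 2)"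
proof -
  define c where "c = 1 + m\<^sup>2"
  have c: "c \<ge> 1" by (simp add: c_def)
  define F where "F x = (norm (R x))\<^sup>2" for x
  define F' where "F' x = 2 * inner (R x $ 1) (Complex x (l + m) * R x $ 2) + 2 * inner (R x $ 2) (Complex x (l - m) * R x $ 1)" for x
  have F: "(F has_real_derivative F' x) (at x)" for x
    unfolding F_def[abs_def] norm_complex_2 F'_def
    by (intro DERIV_add has_real_derivative_norm_sq solves_diracD[OF sol])
  have F'_le: "F' x \<le> 2 * sqrt (x\<^sup>2 + m\<^sup>2) * F x" for x
  proof -
    \<comment> \<open>The contributions of \<open>l\<close> cancel in the real part; from here on
      the estimate is uniform in the spectral parameter.\<close>
    have "F' x = 4 * inner (R x $ 1) (Complex x m * R x $ 2)"
      by (simp add: F'_def inner_complex_def algebra_simps)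
    also have "\<dots> \<le> 4 * (norm (R x $ 1) * (norm (Complex x m) * norm (R x $ 2)))"
      using Cauchy_Schwarz_ineq2[of "R x $ 1" "Complex x m * R x $ 2"] by (simp add: norm_mult)
    also have "\<dots> = 2 * sqrt (x\<^sup>2 + m\<^sup>2) * (2 * norm (R x $ 1) * norm (R x $ 2))"
      by (simp add: complex_norm)
    also have "\<dots> \<le> 2 * sqrt (x\<^sup>2 + m\<^sup>2) * F x"
      unfolding F_def norm_complex_2 by (intro mult_left_mono sum_squares_bound) auto
    finally show ?thesis .
  qed
  \<comment> \<open>At infinity \<open>sqrt (x\<^sup>2 + m\<^sup>2)\<close> behaves like
    \<open>x + m\<^sup>2 / (2 * x)\<close>. The square and the logarithm integrate twice these two
    terms, and the bounded \<open>arctan\<close> term pays for the region near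
    \<open>0\<close>.\<close>
  define h where "h x = x\<^sup>2 + 2 * c * arctan x + m\<^sup>2 / 2 * ln (1 + x\<^sup>2)" for x :: real
  define h' where "h' x = 2 * x + 2 * c * inverse (1 + x\<^sup>2) + m\<^sup>2 * x / (1 + x\<^sup>2)" for x :: real
  have pos: "1 + x\<^sup>2 > 0" for x :: real by (simp add: add_pos_nonneg)
  have h: "(h has_real_derivative h' x) (at x)" for x
  proof -
    have d1: "((\<lambda>x::real. x\<^sup>2) has_real_derivative 2 * x) (at x)"
      by (auto intro!: derivative_eq_intros)
    have d2: "((\<lambda>x. ln (1 + x\<^sup>2)) has_real_derivative inverse (1 + x\<^sup>2) * (2 * x)) (at x)"
      by (rule DERIV_chain2[where f=ln], rule DERIV_ln[OF pos]) (auto intro!: derivative_eq_intros)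
    have "(h has_real_derivative 2 * x + 2 * c * inverse (1 + x\<^sup>2) + m\<^sup>2 / 2 * (inverse (1 + x\<^sup>2) * (2 * x))) (at x)"
      unfolding h_def[abs_def]
      by (rule DERIV_add[OF DERIV_add[OF d1 DERIV_cmult[OF DERIV_arctan]] DERIV_cmult[OF d2]])
    moreover have "m\<^sup>2 / 2 * (i * (2 * x)) = m\<^sup>2 * x * i" for i :: real by simp
    ultimately show ?thesis
      by (simp only: h'_def divide_inverse[of "m\<^sup>2 * x"])
  qed
  have sqrt_le: "2 * sqrt (y\<^sup>2 + m\<^sup>2) \<le> h' y" if y: "y \<ge> 0" for y
  proof -
    \<comment> \<open>\<open>q\<close> is the excess of \<open>h' y / 2\<close> over
      \<open>y\<close>, and the claim amounts to
      \<open>m\<^sup>2 \<le> 2 * y * q + q\<^sup>2\<close>. For \<open>y \<ge> 1 / 2\<close> the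
      mixed term suffices because \<open>2 * y * c \<ge> m\<^sup>2\<close>; for smaller
      \<open>y\<close> the square does, because \<open>c\<^sup>2 \<ge> 4 * m\<^sup>2\<close> and
      \<open>1 + y\<^sup>2 \<le> 5 / 4\<close>.\<close>
    define q where "q = (c + m\<^sup>2 * y / 2) / (1 + y\<^sup>2)"
    have q: "q \<ge> 0" using y c pos[of y] by (simp add: q_def)
    have "m\<^sup>2 \<le> 2 * y * q + q\<^sup>2"
    proof (cases "y \<ge> 1 / 2")
      case True
      have "m\<^sup>2 * (1 + y\<^sup>2) \<le> 2 * y * c + m\<^sup>2 * y\<^sup>2"
        using mult_mono[of 1 "2 * y" "m\<^sup>2" c] True by (simp add: c_def algebra_simps)
      also have "\<dots> = 2 * y * (c + m\<^sup>2 * y / 2)" by (simp add: algebra_simps power2_eq_square)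
      finally have "m\<^sup>2 \<le> 2 * y * q" using pos[of y] by (simp add: q_def field_simps)
      then show ?thesis using zero_le_power2[of q] by linarith
    next
      case False
      then have "y\<^sup>2 \<le> (1/2)\<^sup>2" using y by (intro power_mono) auto
      then have "1 + y\<^sup>2 \<le> 5/4" by (simp add: power2_eq_square)
      then have "c / (5/4) \<le> c / (1 + y\<^sup>2)"
        using c pos[of y] by (intro divide_left_mono) auto
      also have "\<dots> \<le> q" unfolding q_def using y pos[of y] by (intro divide_right_mono) auto
      finally have "(c / (5/4))\<^sup>2 \<le> q\<^sup>2" using c by (intro power_mono) auto
      moreover have "m\<^sup>2 \<le> (c / (5/4))\<^sup>2"
      proof -
        have e: "(c / (5/4))\<^sup>2 = 16/25 * (4 * m\<^sup>2 + (1 - m\<^sup>2)\<^sup>2)"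
          by (simp add: c_def power2_eq_square algebra_simps)
        have "m\<^sup>2 \<le> 16/25 * (4 * m\<^sup>2 + t)" if "t \<ge> 0" for t
          using that zero_le_power2[of m] by (simp add: field_simps del: zero_le_power2)
        then show ?thesis unfolding e by simp
      qed
      moreover have "0 \<le> 2 * y * q" using y q by simp
      ultimately show ?thesis by (meson add_increasing order_trans)
    qed
    then have "y\<^sup>2 + m\<^sup>2 \<le> (y + q)\<^sup>2" by (simp add: power2_eq_square algebra_simps)
    then have "sqrt (y\<^sup>2 + m\<^sup>2) \<le> y + q" using y q by (intro real_le_lsqrt) auto
    moreover have "h' y = 2 * (y + q)"
    proof -
      have "2 * y + 2 * c * inverse t + m\<^sup>2 * y / t = 2 * (y + (c + m\<^sup>2 * y / 2) / t)" if "t > 0" for t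
        using that by (simp add: field_simps)
      from this[OF pos[of y]] show ?thesis by (simp only: h'_def q_def)
    qed
    ultimately show ?thesis by simp
  qed
  have "F x * exp (- h x) \<le> F 0 * exp (- h 0)"
  proof (rule DERIV_nonpos_imp_nonincreasing[OF x])
    fix y assume y: "0 \<le> y" "y \<le> x"
    have "((\<lambda>x. F x * exp (- h x)) has_real_derivative (F' y - h' y * F y) * exp (- h y)) (at y)"
      by (auto intro!: derivative_eq_intros F h simp: algebra_simps)
    moreover have "F' y \<le> h' y * F y"
      using F'_le[of y] mult_right_mono[OF sqrt_le[OF y(1)], of "F y"] by (simp add: F_def)
    ultimately show "\<exists>d. ((\<lambda>x. F x * exp (- h x)) has_real_derivative d) (at y) \<and> d \<le> 0"
      by (intro exI[of _ "(F' y - h' y * F y) * exp (- h y)"]) (auto simp: mult_le_0_iff)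
  qed
  then have "F x \<le> F 0 * exp (h x)" by (simp add: h_def exp_minus field_simps)
  also have "\<dots> \<le> F 0 * (exp (4 * c) * exp (x\<^sup>2) * (1 + x\<^sup>2) powr (m\<^sup>2 / 2))"
  proof (rule mult_left_mono)
    have "arctan x \<le> 2" using arctan_ubound[of x] pi_half_less_two by simp
    then have "2 * c * arctan x \<le> 4 * c" using c mult_left_mono[of "arctan x" 2 "2 * c"] by simp
    then have "exp (h x) \<le> exp (4 * c + x\<^sup>2 + m\<^sup>2 / 2 * ln (1 + x\<^sup>2))" by (simp add: h_def)
    also have "\<dots> = exp (4 * c) * exp (x\<^sup>2) * (1 + x\<^sup>2) powr (m\<^sup>2 / 2)"
      using pos[of x] by (simp add: exp_add powr_def)
    finally show "exp (h x) \<le> exp (4 * c) * exp (x\<^sup>2) * (1 + x\<^sup>2) powr (m\<^sup>2 / 2)" .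
  qed (simp add: F_def)
  finally show ?thesis by (simp add: F_def c_def mult_ac)
qed

section \<open>Estimates for the decaying solution at fixed spectral parameter\<close>

text \<open>The interface between the special functions and the Green operator. \<open>D\<close>
  expresses qualitative decay and yields integrability; the error in the norm of the resolvent is
  governed by \<open>B / W\<close>.\<close>

locale airy_line =
  fixes m l :: real and P :: "real \<Rightarrow> complex^2" and W :: real and a :: complex and B D :: real
  assumes sol: "solves_dirac m l P"
    and wronskian: "P x $ 1 * cnj (P (- x) $ 2) - P x $ 2 * cnj (P (- x) $ 1) = - \<i> * of_real W"
    and W_pos: "W > 0"
    and norm_a: "norm a = 1"
    and decay: "x \<ge> 0 \<Longrightarrow> norm (P x) \<le> D * exp (- (x\<^sup>2 / 2))"
    and product_bound: "0 \<le> y \<Longrightarrow> y \<le> x \<Longrightarrow>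
      norm (P x) * norm (reflect P y - a *s P y) \<le> B * exp (- ((x\<^sup>2 - y\<^sup>2) / 2))"

definition airy_sol :: "real \<Rightarrow> real \<Rightarrow> real \<Rightarrow> complex^2" where
  "airy_sol m l x = vector [sol1 m (Complex x l), sol2 m (Complex x l)]"

lemma airy_sol_nth [simp]:
  "airy_sol m l x $ 1 = sol1 m (Complex x l)" "airy_sol m l x $ 2 = sol2 m (Complex x l)"
  by (simp_all add: airy_sol_def)

lemma norm_airy_sol: "(norm (airy_sol m l x))\<^sup>2 = sol_norm2 m (Complex x l)"
  by (simp add: norm_complex_2 sol_norm2_eq)

lemma solves_dirac_airy_sol:
  assumes "m > 0"
  shows "solves_dirac m l (airy_sol m l)"
proof -
  have *: "((\<lambda>x. f (Complex x l)) has_vector_derivative f') (at x)"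
    if "(f has_field_derivative f') (at (Complex x l))" for f f' x
  proof -
    have "((\<lambda>x. Complex x l) has_vector_derivative 1) (at x)"
      unfolding Complex_eq by (auto intro!: derivative_eq_intros)
    from field_vector_diff_chain_at[OF this that] show ?thesis by (simp add: o_def)
  qed
  show ?thesis
    unfolding solves_dirac_def
    using *[OF has_field_derivative_sol1[OF assms]] *[OF has_field_derivative_sol2[OF assms]]
    by (simp add: Complex_eq algebra_simps)
qed

lemma airy_sol_wronskian:
  assumes "m > 0"
  shows "airy_sol m l x $ 1 * cnj (airy_sol m l (- x) $ 2) - airy_sol m l x $ 2 * cnj (airy_sol m l (- x) $ 1)
    = - \<i> * of_real (2 / m * sqrt pi * Gamma (m\<^sup>2 / 2))"
proof -
  have e: "cnj (Complex (- x) l) = - Complex x l" by (simp add: complex_eq_iff)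
  have e': "cnj (- Complex x l) = Complex (- x) l" by (simp add: complex_eq_iff)
  have 1: "cnj (sol2 m (Complex (- x) l)) = sol1 m (- Complex x l)"
    using sol_cnj[of m "Complex (- x) l"] unfolding e by simp
  have 2: "cnj (sol1 m (Complex (- x) l)) = sol2 m (- Complex x l)"
    using sol_cnj[of m "- Complex x l"] unfolding e' by simp
  show ?thesis
    using sol_wronskian[OF assms, of "Complex x l"] by (simp add: 1 2)
qed

lemma has_bochner_integral_gauss_weight:
  "has_bochner_integral lborel (\<lambda>x. indicator {0..} x * (exp (- x\<^sup>2) * (1 + x\<^sup>2))) (3 / 4 * sqrt pi)"
proof -
  have "has_bochner_integral lborel (\<lambda>x. indicator {0..} x *\<^sub>R exp (- x\<^sup>2) + indicator {0..} x *\<^sub>R (exp (- x\<^sup>2) * x ^ (2 * 1))) (sqrt pi / 2 + sqrt pi / 2 * (fact (2 * 1) / (2 ^ (2 * 1) * fact 1)))"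
    by (intro has_bochner_integral_add gaussian_moment_0 gaussian_moment_even_pos)
  then show ?thesis by (simp add: distrib_left)
qed

text \<open>Along the line, replacing \<open>norm z powr (- m\<^sup>2)\<close> by
  \<open>\<bar>l\<bar> powr (- m\<^sup>2)\<close> costs a relative error of order
  \<open>x\<^sup>2 / l\<^sup>2\<close>, which is integrable against
  \<open>exp (- x\<^sup>2)\<close>. What remains is twice a half-line Gaussian integral, hence
  \<open>sqrt pi\<close>.\<close>

lemma airy_sol_asymp:
  assumes m: "m > 0"
  obtains C where "C \<ge> 0"
    and "\<And>l. \<bar>l\<bar> \<ge> 1 \<Longrightarrow> integrable lborel (\<lambda>x. indicator {0..} x * (norm (airy_sol m l x))\<^sup>2)"
    and "\<And>l. \<bar>l\<bar> \<ge> 1 \<Longrightarrow>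
      \<bar>2 * (\<integral>x. indicator {0..} x * (norm (airy_sol m l x))\<^sup>2 \<partial>lborel)
        - (Gamma (m\<^sup>2 / 2))\<^sup>2 / 2 powr (m\<^sup>2 / 2) * sqrt pi * \<bar>l\<bar> powr (- (m\<^sup>2)) * exp (l\<^sup>2)\<bar>
       \<le> C * \<bar>l\<bar> powr (- (m\<^sup>2) - 2) * exp (l\<^sup>2)"
    and "\<And>l x. \<bar>l\<bar> \<ge> 1 \<Longrightarrow> x \<ge> 0 \<Longrightarrow>
      (norm (airy_sol m l x))\<^sup>2 \<le> C * norm (Complex x l) powr (- (m\<^sup>2)) * exp (l\<^sup>2 - x\<^sup>2)"
proof -
  define s where "s = m\<^sup>2 / 2"
  define K where "K = (Gamma s)\<^sup>2 / 2 powr s"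
  have K: "K \<ge> 0" by (simp add: K_def)
  have s: "s > 0" using m by (simp add: s_def)
  obtain C0 where C0: "C0 \<ge> 0" "\<And>z. Re z \<ge> 0 \<Longrightarrow> norm z \<ge> 1 \<Longrightarrow>
    \<bar>sol_norm2 m z - K * norm z powr (- (m\<^sup>2)) * exp ((Im z)\<^sup>2 - (Re z)\<^sup>2)\<bar>
      \<le> C0 * norm z powr (- (m\<^sup>2) - 2) * exp ((Im z)\<^sup>2 - (Re z)\<^sup>2)"
    using sol_norm2_asymp[OF m] unfolding K_def s_def by blast
  have nz: "\<bar>l\<bar> \<le> norm (Complex x l)" for x l using abs_Im_le_cmod[of "Complex x l"] by simp
  have pt: "\<bar>(norm (airy_sol m l x))\<^sup>2 - K * norm (Complex x l) powr (- (m\<^sup>2)) * exp (l\<^sup>2 - x\<^sup>2)\<bar>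
      \<le> C0 * norm (Complex x l) powr (- (m\<^sup>2) - 2) * exp (l\<^sup>2 - x\<^sup>2)" if "\<bar>l\<bar> \<ge> 1" "x \<ge> 0" for l x
    using C0(2)[of "Complex x l"] nz[of l x] that unfolding norm_airy_sol by simp
  have up: "(norm (airy_sol m l x))\<^sup>2 \<le> (K + C0) * norm (Complex x l) powr (- (m\<^sup>2)) * exp (l\<^sup>2 - x\<^sup>2)"
    if "\<bar>l\<bar> \<ge> 1" "x \<ge> 0" for l x
  proof -
    have "C0 * norm (Complex x l) powr (- (m\<^sup>2) - 2) * exp (l\<^sup>2 - x\<^sup>2) \<le> C0 * norm (Complex x l) powr (- (m\<^sup>2)) * exp (l\<^sup>2 - x\<^sup>2)"
      using C0(1) that nz[of l x] by (intro mult_right_mono mult_left_mono powr_mono) auto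
    then show ?thesis using pt[OF that] by (simp add: algebra_simps)
  qed
  define C where "C = K + C0 + 2 * (K * s + C0) * (3 / 4 * sqrt pi)"
  have pt2: "\<bar>(norm (airy_sol m l x))\<^sup>2 - K * \<bar>l\<bar> powr (- (m\<^sup>2)) * exp (l\<^sup>2) * exp (- x\<^sup>2)\<bar>
      \<le> (K * s + C0) * \<bar>l\<bar> powr (- (m\<^sup>2) - 2) * exp (l\<^sup>2) * (exp (- x\<^sup>2) * (1 + x\<^sup>2))"
    if l: "\<bar>l\<bar> \<ge> 1" and x: "x \<ge> 0" for l x
  proof -
    define r where "r = norm (Complex x l)"
    have r: "r \<ge> \<bar>l\<bar>" "r > 0" using nz[of l x] l by (auto simp: r_def)
    have r2: "r\<^sup>2 = l\<^sup>2 + x\<^sup>2" by (simp add: r_def complex_norm)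
    have "C0 * r powr (- (m\<^sup>2) - 2) * exp (l\<^sup>2 - x\<^sup>2) \<le> C0 * \<bar>l\<bar> powr (- (m\<^sup>2) - 2) * exp (l\<^sup>2 - x\<^sup>2)"
      using C0(1) r l order_trans[OF _ zero_le_power2, of "-2" m]
      by (intro mult_right_mono mult_left_mono powr_mono2') auto
    also have "\<dots> \<le> C0 * \<bar>l\<bar> powr (- (m\<^sup>2) - 2) * exp (l\<^sup>2 - x\<^sup>2) * (1 + x\<^sup>2)"
      using C0(1) mult_left_mono[of 1 "1 + x\<^sup>2" "C0 * \<bar>l\<bar> powr (- (m\<^sup>2) - 2) * exp (l\<^sup>2 - x\<^sup>2)"] by simp
    finally have 1: "\<bar>(norm (airy_sol m l x))\<^sup>2 - K * r powr (- (m\<^sup>2)) * exp (l\<^sup>2 - x\<^sup>2)\<bar>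
       \<le> C0 * \<bar>l\<bar> powr (- (m\<^sup>2) - 2) * exp (l\<^sup>2 - x\<^sup>2) * (1 + x\<^sup>2)"
      using pt[OF that] by (simp add: r_def)
    \<comment> \<open>This is \<open>(1 + x\<^sup>2 / l\<^sup>2) powr (- s) \<ge> 1 - s * (x\<^sup>2
      / l\<^sup>2)\<close>, a consequence of \<open>ln (1 + y) \<le> y\<close> and
      \<open>exp y \<ge> 1 + y\<close>.\<close>
    have lower: "\<bar>l\<bar> powr (- (m\<^sup>2)) * (1 - s * (x\<^sup>2 / l\<^sup>2)) \<le> r powr (- (m\<^sup>2))"
    proof -
      have l0: "\<bar>l\<bar> > 0" using l by simp
      have "r powr (- (m\<^sup>2)) = \<bar>l\<bar> powr (- (m\<^sup>2)) * (r / \<bar>l\<bar>) powr (- (m\<^sup>2))"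
        using r l0 by (simp add: powr_divide)
      also have "(r / \<bar>l\<bar>) powr (- (m\<^sup>2)) = ((r / \<bar>l\<bar>)\<^sup>2) powr (- s)"
        using r l0 by (simp add: s_def powr_powr flip: powr_numeral)
      also have "(r / \<bar>l\<bar>)\<^sup>2 = 1 + x\<^sup>2 / l\<^sup>2"
        using l0 by (simp add: power_divide r2 field_simps)
      also have "\<dots> powr (- s) = exp (- (s * ln (1 + x\<^sup>2 / l\<^sup>2)))"
        by (simp add: powr_def add_pos_nonneg less_imp_neq[symmetric])
      finally have e: "r powr (- (m\<^sup>2)) = \<bar>l\<bar> powr (- (m\<^sup>2)) * exp (- (s * ln (1 + x\<^sup>2 / l\<^sup>2)))" .
      have "ln (1 + x\<^sup>2 / l\<^sup>2) \<le> x\<^sup>2 / l\<^sup>2" by (rule ln_add_one_self_le_self) simp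
      then have "1 - s * (x\<^sup>2 / l\<^sup>2) \<le> 1 + - (s * ln (1 + x\<^sup>2 / l\<^sup>2))"
        using mult_left_mono[of "ln (1 + x\<^sup>2 / l\<^sup>2)" "x\<^sup>2 / l\<^sup>2" s] s by simp
      also have "\<dots> \<le> exp (- (s * ln (1 + x\<^sup>2 / l\<^sup>2)))" by (rule exp_ge_add_one_self)
      finally show ?thesis unfolding e by (rule mult_left_mono) simp
    qed
    have upper: "r powr (- (m\<^sup>2)) \<le> \<bar>l\<bar> powr (- (m\<^sup>2))" using r l by (intro powr_mono2') auto
    have sc: "\<bar>l\<bar> powr (- (m\<^sup>2)) * (x\<^sup>2 / l\<^sup>2) = \<bar>l\<bar> powr (- (m\<^sup>2) - 2) * x\<^sup>2"
      using l by (simp add: powr_diff)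
    have "\<bar>r powr (- (m\<^sup>2)) - \<bar>l\<bar> powr (- (m\<^sup>2))\<bar> \<le> s * (\<bar>l\<bar> powr (- (m\<^sup>2) - 2) * x\<^sup>2)"
      using lower upper unfolding sc[symmetric] by (simp add: algebra_simps)
    also have "\<dots> \<le> s * (\<bar>l\<bar> powr (- (m\<^sup>2) - 2) * (1 + x\<^sup>2))" using s by (intro mult_left_mono) auto
    finally have "K * exp (l\<^sup>2 - x\<^sup>2) * \<bar>r powr (- (m\<^sup>2)) - \<bar>l\<bar> powr (- (m\<^sup>2))\<bar> \<le> K * exp (l\<^sup>2 - x\<^sup>2) * (s * (\<bar>l\<bar> powr (- (m\<^sup>2) - 2) * (1 + x\<^sup>2)))"
      using K by (intro mult_left_mono) auto
    moreover have "K * exp (l\<^sup>2 - x\<^sup>2) * \<bar>r powr (- (m\<^sup>2)) - \<bar>l\<bar> powr (- (m\<^sup>2))\<bar>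
      = \<bar>K * r powr (- (m\<^sup>2)) * exp (l\<^sup>2 - x\<^sup>2) - K * \<bar>l\<bar> powr (- (m\<^sup>2)) * exp (l\<^sup>2 - x\<^sup>2)\<bar>"
    proof -
      have "K * r powr (- (m\<^sup>2)) * exp (l\<^sup>2 - x\<^sup>2) - K * \<bar>l\<bar> powr (- (m\<^sup>2)) * exp (l\<^sup>2 - x\<^sup>2)
        = (K * exp (l\<^sup>2 - x\<^sup>2)) * (r powr (- (m\<^sup>2)) - \<bar>l\<bar> powr (- (m\<^sup>2)))"
        by (simp add: algebra_simps)
      then show ?thesis using K by (simp add: abs_mult)
    qed
    ultimately have 2: "\<bar>K * r powr (- (m\<^sup>2)) * exp (l\<^sup>2 - x\<^sup>2) - K * \<bar>l\<bar> powr (- (m\<^sup>2)) * exp (l\<^sup>2 - x\<^sup>2)\<bar>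
      \<le> K * exp (l\<^sup>2 - x\<^sup>2) * (s * (\<bar>l\<bar> powr (- (m\<^sup>2) - 2) * (1 + x\<^sup>2)))" by simp
    have ee: "exp (l\<^sup>2 - x\<^sup>2) = exp (l\<^sup>2) * exp (- x\<^sup>2)" by (simp flip: exp_add)
    have "\<bar>(norm (airy_sol m l x))\<^sup>2 - K * \<bar>l\<bar> powr (- (m\<^sup>2)) * exp (l\<^sup>2 - x\<^sup>2)\<bar>
      \<le> C0 * \<bar>l\<bar> powr (- (m\<^sup>2) - 2) * exp (l\<^sup>2 - x\<^sup>2) * (1 + x\<^sup>2) + K * exp (l\<^sup>2 - x\<^sup>2) * (s * (\<bar>l\<bar> powr (- (m\<^sup>2) - 2) * (1 + x\<^sup>2)))"
      using 1 2 by linarith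
    then show ?thesis
      unfolding ee by (simp add: algebra_simps)
  qed
  have [measurable]: "airy_sol m l \<in> borel_measurable borel" for l
    by (intro borel_measurable_continuous_onI solves_dirac_continuous[OF solves_dirac_airy_sol[OF m]])
  have int: "integrable lborel (\<lambda>x. indicator {0..} x * (norm (airy_sol m l x))\<^sup>2)"
    and est: "\<bar>2 * (\<integral>x. indicator {0..} x * (norm (airy_sol m l x))\<^sup>2 \<partial>lborel) - K * sqrt pi * \<bar>l\<bar> powr (- (m\<^sup>2)) * exp (l\<^sup>2)\<bar>
       \<le> C * \<bar>l\<bar> powr (- (m\<^sup>2) - 2) * exp (l\<^sup>2)" if l: "\<bar>l\<bar> \<ge> 1" for l
  proof -
    define k where "k = K * \<bar>l\<bar> powr (- (m\<^sup>2)) * exp (l\<^sup>2)"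
    define q where "q = (K * s + C0) * \<bar>l\<bar> powr (- (m\<^sup>2) - 2) * exp (l\<^sup>2)"
    let ?n = "\<lambda>x. indicator {0..} x * (norm (airy_sol m l x))\<^sup>2"
    let ?g = "\<lambda>x. k * (indicator {0..} x *\<^sub>R exp (- x\<^sup>2))"
    let ?e = "\<lambda>x. q * (indicator {0..} x * (exp (- x\<^sup>2) * (1 + x\<^sup>2)))"
    have le: "\<bar>?n x - ?g x\<bar> \<le> ?e x" for x
      using pt2[OF l, of x] by (auto simp: k_def q_def indicator_def mult.assoc)
    have hg: "has_bochner_integral lborel ?g (k * (sqrt pi / 2))"
      by (intro has_bochner_integral_mult_right gaussian_moment_0)
    have he: "has_bochner_integral lborel ?e (q * (3 / 4 * sqrt pi))"
      by (intro has_bochner_integral_mult_right has_bochner_integral_gauss_weight)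
    have d: "integrable lborel (\<lambda>x. ?n x - ?g x)"
      by (rule Bochner_Integration.integrable_bound[OF integrable.intros[OF he]])
        (use le in \<open>auto intro: order_trans[OF _ abs_ge_self]\<close>)
    then show i: "integrable lborel ?n"
      using Bochner_Integration.integrable_add[OF d integrable.intros[OF hg]] by simp
    have "\<bar>(\<integral>x. ?n x \<partial>lborel) - k * (sqrt pi / 2)\<bar> = \<bar>\<integral>x. ?n x - ?g x \<partial>lborel\<bar>"
      using Bochner_Integration.integral_diff[OF i integrable.intros[OF hg]] has_bochner_integral_integral_eq[OF hg]
      by (simp only:)
    also have "\<dots> \<le> (\<integral>x. ?e x \<partial>lborel)"
      using Bochner_Integration.integral_norm_bound_integral[OF d integrable.intros[OF he]] le by simp
    also have "\<dots> = q * (3 / 4 * sqrt pi)" using he by (rule has_bochner_integral_integral_eq)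
    finally have "\<bar>2 * (\<integral>x. ?n x \<partial>lborel) - k * sqrt pi\<bar> \<le> 2 * (q * (3 / 4 * sqrt pi))" by (simp add: abs_if field_simps split: if_splits)
    also have "\<dots> \<le> C * \<bar>l\<bar> powr (- (m\<^sup>2) - 2) * exp (l\<^sup>2)"
    proof -
      have "2 * (K * s + C0) * (3 / 4 * sqrt pi) \<le> C" using K C0 by (simp add: C_def)
      then have "2 * (K * s + C0) * (3 / 4 * sqrt pi) * (\<bar>l\<bar> powr (- (m\<^sup>2) - 2) * exp (l\<^sup>2)) \<le> C * (\<bar>l\<bar> powr (- (m\<^sup>2) - 2) * exp (l\<^sup>2))"
        by (rule mult_right_mono) simp
      then show ?thesis by (simp only: q_def mult_ac)
    qed
    finally show "\<bar>2 * (\<integral>x. ?n x \<partial>lborel) - K * sqrt pi * \<bar>l\<bar> powr (- (m\<^sup>2)) * exp (l\<^sup>2)\<bar>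
       \<le> C * \<bar>l\<bar> powr (- (m\<^sup>2) - 2) * exp (l\<^sup>2)" by (simp add: k_def mult_ac)
  qed
  have C: "K + C0 \<le> C" "C \<ge> 0" using K C0 s by (auto simp: C_def)
  show ?thesis
  proof (rule that[OF C(2) int])
    show "\<bar>2 * (\<integral>x. indicator {0..} x * (norm (airy_sol m l x))\<^sup>2 \<partial>lborel)
        - (Gamma (m\<^sup>2 / 2))\<^sup>2 / 2 powr (m\<^sup>2 / 2) * sqrt pi * \<bar>l\<bar> powr (- (m\<^sup>2)) * exp (l\<^sup>2)\<bar>
       \<le> C * \<bar>l\<bar> powr (- (m\<^sup>2) - 2) * exp (l\<^sup>2)" if "\<bar>l\<bar> \<ge> 1" for l
      using est[OF that] by (simp add: K_def s_def)
    show "(norm (airy_sol m l x))\<^sup>2 \<le> C * norm (Complex x l) powr (- (m\<^sup>2)) * exp (l\<^sup>2 - x\<^sup>2)"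
      if "\<bar>l\<bar> \<ge> 1" "x \<ge> 0" for l x
      by (rule order_trans[OF up[OF that]]) (use C(1) in \<open>auto intro!: mult_right_mono\<close>)
  qed
qed

text \<open>The constant \<open>a\<close> is chosen so that the two components of \<open>Q - a P\<close> agree at \<open>0\<close>; the Wronskian
  identity then gives the size of \<open>Q - a P\<close> there.\<close>

lemma airy_sol_line:
  assumes m: "m > 0"
  obtains C L where "L \<ge> 1" "C \<ge> 0" and "\<And>l. \<bar>l\<bar> \<ge> L \<Longrightarrow>
     \<exists>a D. airy_line m l (airy_sol m l) (2 / m * sqrt pi * Gamma (m\<^sup>2 / 2)) a (C * \<bar>l\<bar> powr (m\<^sup>2 / 2)) D"
proof -
  define W where "W = 2 / m * sqrt pi * Gamma (m\<^sup>2 / 2)"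
  have W: "W > 0" using m Gamma_real_pos[of "m\<^sup>2 / 2"] by (simp add: W_def)
  obtain c L where c: "c > 0" "L \<ge> 1" "\<And>l. \<bar>l\<bar> \<ge> L \<Longrightarrow>
    c * \<bar>l\<bar> powr (- (m\<^sup>2 / 2)) * exp (l\<^sup>2 / 2) \<le> norm (sol_w m (Complex 0 l))"
    using norm_sol_w_imaginary_ge[OF m] by blast
  obtain C where C: "C \<ge> 0" "\<And>l x. \<bar>l\<bar> \<ge> 1 \<Longrightarrow> x \<ge> 0 \<Longrightarrow>
      (norm (airy_sol m l x))\<^sup>2 \<le> C * norm (Complex x l) powr (- (m\<^sup>2)) * exp (l\<^sup>2 - x\<^sup>2)"
    using airy_sol_asymp[OF m] by metis
  define E where "E = exp (4 * (1 + m\<^sup>2))"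
  define K where "K = sqrt (C * (W / c)\<^sup>2 * E)"
  show ?thesis
  proof
    show "L \<ge> 1" by (rule c(2))
    show "K \<ge> 0" using C by (simp add: K_def E_def)
    fix l :: real assume lL: "\<bar>l\<bar> \<ge> L"
    then have l: "\<bar>l\<bar> \<ge> 1" using c(2) by simp
    let ?P = "airy_sol m l"
    define w where "w = sol_w m (Complex 0 l)"
    have w_ge: "c * \<bar>l\<bar> powr (- (m\<^sup>2 / 2)) * exp (l\<^sup>2 / 2) \<le> norm w" using c(3)[OF lL] by (simp add: w_def)
    have w_pos: "norm w > 0" using w_ge c(1) l by (intro order.strict_trans2[OF _ w_ge]) auto
    have diff: "?P 0 $ 1 - ?P 0 $ 2 = \<i> * of_real (sqrt 2) * w"
    proof -
      have "?P 0 $ 1 - ?P 0 $ 2 = 2 * \<i> * w / of_real (sqrt 2)"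
        by (simp add: sol1_def sol2_def w_def diff_divide_distrib[symmetric])
      also have "2 = complex_of_real (sqrt 2) * of_real (sqrt 2)" by (simp flip: of_real_mult)
      finally show ?thesis by simp
    qed
    define d where "d = ?P 0 $ 1 - ?P 0 $ 2"
    have d0: "d \<noteq> 0" and nd: "norm d = sqrt 2 * norm w" using w_pos unfolding d_def diff norm_mult by auto
    define a where "a = cnj d / d"
    have a: "norm a = 1" using d0 by (simp add: a_def norm_divide)
    let ?R = "\<lambda>x. reflect ?P x - a *s ?P x"
    note wr = airy_sol_wronskian[OF m, of l, folded W_def]
    have R12: "?R 0 $ 1 = ?R 0 $ 2"
    proof -
      have "?R 0 $ 1 - ?R 0 $ 2 = cnj d - a * d"
        by (simp add: d_def right_diff_distrib)
      also have "\<dots> = 0" using d0 by (simp add: a_def)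
      finally show ?thesis by simp
    qed
    \<comment> \<open>Subtracting a multiple of \<open>P\<close> from \<open>Q\<close> leaves the
      determinant with \<open>P\<close> unchanged. Since both components of the difference agree at
      \<open>0\<close>, that determinant is \<open>d\<close> times their common value.\<close>
    have "d * ?R 0 $ 1 = ?P 0 $ 1 * ?R 0 $ 2 - ?P 0 $ 2 * ?R 0 $ 1"
      by (simp only: R12 d_def left_diff_distrib)
    also have "\<dots> = ?P 0 $ 1 * cnj (?P (- 0) $ 2) - ?P 0 $ 2 * cnj (?P (- 0) $ 1)"
      by (simp del: airy_sol_nth add: algebra_simps)
    also have "\<dots> = - \<i> * of_real W" by (rule wr)
    finally have "norm d * norm (?R 0 $ 1) = W" using W by (simp flip: norm_mult del: airy_sol_nth) (simp add: norm_mult)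
    then have "norm (?R 0 $ 1) = W / (sqrt 2 * norm w)" using w_pos by (simp add: nd field_simps del: airy_sol_nth)
    then have R0: "(norm (?R 0))\<^sup>2 = (W / norm w)\<^sup>2"
      unfolding norm_complex_2[of "?R 0"] R12[symmetric] by (simp add: power_divide power_mult_distrib)
    have R0_le: "(norm (?R 0))\<^sup>2 \<le> (W / c)\<^sup>2 * \<bar>l\<bar> powr (m\<^sup>2) * exp (- (l\<^sup>2))"
    proof -
      have "W / norm w \<le> W / (c * \<bar>l\<bar> powr (- (m\<^sup>2 / 2)) * exp (l\<^sup>2 / 2))"
        using w_ge w_pos W c(1) l by (intro divide_left_mono) auto
      also have "\<dots> = W / c * \<bar>l\<bar> powr (m\<^sup>2 / 2) * exp (- (l\<^sup>2 / 2))"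
        using l by (simp add: powr_minus exp_minus field_simps)
      finally have "(W / norm w)\<^sup>2 \<le> (W / c * \<bar>l\<bar> powr (m\<^sup>2 / 2) * exp (- (l\<^sup>2 / 2)))\<^sup>2"
        using W w_pos by (intro power_mono) auto
      also have "\<dots> = (W / c)\<^sup>2 * (\<bar>l\<bar> powr (m\<^sup>2 / 2) * \<bar>l\<bar> powr (m\<^sup>2 / 2)) * (exp (- (l\<^sup>2 / 2)) * exp (- (l\<^sup>2 / 2)))"
        by (simp add: power2_eq_square)
      also have "\<dots> = (W / c)\<^sup>2 * \<bar>l\<bar> powr (m\<^sup>2) * exp (- (l\<^sup>2))"
        by (simp flip: powr_add exp_add)
      finally show ?thesis unfolding R0 .
    qed
    have nz: "norm (Complex x l) \<ge> \<bar>l\<bar>" for x using abs_Im_le_cmod[of "Complex x l"] by simp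
    have "airy_line m l ?P W a (K * \<bar>l\<bar> powr (m\<^sup>2 / 2)) (sqrt (C * exp (l\<^sup>2)))"
    proof
      show "solves_dirac m l ?P" by (rule solves_dirac_airy_sol[OF m])
      then have solR: "solves_dirac m l ?R" by (intro solves_dirac_diff solves_dirac_reflect)
      show "?P x $ 1 * cnj (?P (- x) $ 2) - ?P x $ 2 * cnj (?P (- x) $ 1) = - \<i> * of_real W" for x by (rule wr)
      show "W > 0" "norm a = 1" by fact+
      show "norm (?P x) \<le> sqrt (C * exp (l\<^sup>2)) * exp (- (x\<^sup>2 / 2))" if x: "x \<ge> 0" for x
      proof -
        have "norm (Complex x l) powr (- (m\<^sup>2)) \<le> 1"
          using nz[of x] l powr_mono[of "- (m\<^sup>2)" 0 "norm (Complex x l)"] by (auto simp: complex_eq_iff split: if_splits)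
        then have "C * norm (Complex x l) powr (- (m\<^sup>2)) * exp (l\<^sup>2 - x\<^sup>2) \<le> C * 1 * exp (l\<^sup>2 - x\<^sup>2)"
          using C(1) by (intro mult_right_mono mult_left_mono) auto
        also have "\<dots> = (sqrt (C * exp (l\<^sup>2)) * exp (- (x\<^sup>2 / 2)))\<^sup>2"
          using C(1) by (simp add: power_mult_distrib exp_diff exp_minus exp_double[symmetric] field_simps)
        finally have "(norm (?P x))\<^sup>2 \<le> (sqrt (C * exp (l\<^sup>2)) * exp (- (x\<^sup>2 / 2)))\<^sup>2" using C(2)[OF l x] by simp
        then show ?thesis by (rule power2_le_imp_le) (use C(1) in simp)
      qed
      show "norm (?P x) * norm (?R y) \<le> K * \<bar>l\<bar> powr (m\<^sup>2 / 2) * exp (- ((x\<^sup>2 - y\<^sup>2) / 2))"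
        if y: "0 \<le> y" "y \<le> x" for x y
      proof -
        \<comment> \<open>With \<open>\<bar>l\<bar> \<ge> 1\<close> and \<open>y \<le> x\<close> one
          has \<open>1 + y\<^sup>2 \<le> r\<^sup>2\<close>, so the power in the growth at
          \<open>y\<close> cancels against the power in the decay at \<open>x\<close>. The factors
          \<open>exp (l\<^sup>2)\<close> of \<open>P\<close> and \<open>exp (- l\<^sup>2)\<close> of
          the value at \<open>0\<close> cancel as well, and only a power of
          \<open>\<bar>l\<bar>\<close> survives.\<close>
        define r where "r = norm (Complex x l)"
        have r: "r > 0" using nz[of x] l unfolding r_def by linarith
        have "1 + y\<^sup>2 \<le> r\<^sup>2"
        proof -
          have "1 \<le> \<bar>l\<bar>\<^sup>2" using l by (simp only: one_le_power)
          moreover have "y\<^sup>2 \<le> x\<^sup>2" using y by (intro power_mono) auto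
          ultimately show ?thesis by (simp add: r_def complex_norm)
        qed
        then have "(1 + y\<^sup>2) powr (m\<^sup>2 / 2) \<le> (r\<^sup>2) powr (m\<^sup>2 / 2)" by (intro powr_mono2) auto
        also have "\<dots> = r powr (m\<^sup>2)" using r by (simp add: powr_powr flip: powr_numeral)
        finally have yr: "(1 + y\<^sup>2) powr (m\<^sup>2 / 2) \<le> r powr (m\<^sup>2)" .
        have "(norm (?R y))\<^sup>2 \<le> (norm (?R 0))\<^sup>2 * E * exp (y\<^sup>2) * (1 + y\<^sup>2) powr (m\<^sup>2 / 2)"
          unfolding E_def by (rule solves_dirac_growth[OF solR y(1)])
        also have "\<dots> \<le> ((W / c)\<^sup>2 * \<bar>l\<bar> powr (m\<^sup>2) * exp (- (l\<^sup>2))) * E * exp (y\<^sup>2) * r powr (m\<^sup>2)"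
          using R0_le yr by (intro mult_mono) (auto simp: E_def)
        finally have Ry: "(norm (?R y))\<^sup>2 \<le> ((W / c)\<^sup>2 * \<bar>l\<bar> powr (m\<^sup>2) * exp (- (l\<^sup>2))) * E * exp (y\<^sup>2) * r powr (m\<^sup>2)" .
        have "(norm (?P x) * norm (?R y))\<^sup>2 = (norm (?P x))\<^sup>2 * (norm (?R y))\<^sup>2" by (rule power_mult_distrib)
        also have "\<dots> \<le> (C * r powr (- (m\<^sup>2)) * exp (l\<^sup>2 - x\<^sup>2)) * (((W / c)\<^sup>2 * \<bar>l\<bar> powr (m\<^sup>2) * exp (- (l\<^sup>2))) * E * exp (y\<^sup>2) * r powr (m\<^sup>2))"
          using C(2)[OF l, of x] y Ry C(1) by (intro mult_mono) (auto simp: r_def)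
        also have "\<dots> = (C * (W / c)\<^sup>2 * E) * \<bar>l\<bar> powr (m\<^sup>2) * (r powr (- (m\<^sup>2)) * r powr (m\<^sup>2)) * (exp (l\<^sup>2 - x\<^sup>2) * exp (- (l\<^sup>2)) * exp (y\<^sup>2))"
          by (simp only: mult_ac)
        also have "r powr (- (m\<^sup>2)) * r powr (m\<^sup>2) = 1" using r by (simp flip: powr_add)
        also have "exp (l\<^sup>2 - x\<^sup>2) * exp (- (l\<^sup>2)) * exp (y\<^sup>2) = exp (- ((x\<^sup>2 - y\<^sup>2) / 2)) * exp (- ((x\<^sup>2 - y\<^sup>2) / 2))"
          by (simp flip: exp_add)
        also have "\<bar>l\<bar> powr (m\<^sup>2) = \<bar>l\<bar> powr (m\<^sup>2 / 2) * \<bar>l\<bar> powr (m\<^sup>2 / 2)" by (simp flip: powr_add)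
        also have "C * (W / c)\<^sup>2 * E = K\<^sup>2" using C(1) by (simp add: K_def E_def)
        finally have "(norm (?P x) * norm (?R y))\<^sup>2 \<le> (K * \<bar>l\<bar> powr (m\<^sup>2 / 2) * exp (- ((x\<^sup>2 - y\<^sup>2) / 2)))\<^sup>2"
          by (simp add: power2_eq_square mult_ac)
        then show ?thesis by (rule power2_le_imp_le) (use C(1) in \<open>simp add: K_def E_def\<close>)
      qed
    qed
    then show "\<exists>a D. airy_line m l ?P (2 / m * sqrt pi * Gamma (m\<^sup>2 / 2)) a (K * \<bar>l\<bar> powr (m\<^sup>2 / 2)) D"
      unfolding W_def by blast
  qed
qed

section \<open>Weak derivatives\<close>

definition smooth :: "(real \<Rightarrow> real) \<Rightarrow> bool" where
  "smooth f \<longleftrightarrow> (\<forall>n x. (deriv ^^ n) f differentiable at x)"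

text \<open>A class that contains the bump functions and is closed under differentiation, so that all its members
  are smooth.\<close>

inductive smooth_gen :: "(real \<Rightarrow> real) \<Rightarrow> bool" where
  bump: "smooth_gen (\<lambda>x. if x > 0 then poly p (1 / x) * exp (- (1 / x)) else 0)"
| const: "smooth_gen (\<lambda>x. c)"
| affine: "smooth_gen f \<Longrightarrow> smooth_gen (\<lambda>x. f (a * x + b))"
| add: "smooth_gen f \<Longrightarrow> smooth_gen g \<Longrightarrow> smooth_gen (\<lambda>x. f x + g x)"
| mult: "smooth_gen f \<Longrightarrow> smooth_gen g \<Longrightarrow> smooth_gen (\<lambda>x. f x * g x)"

lemma poly_exp_tendsto_0: "((\<lambda>y. poly p y * exp (- y)) \<longlongrightarrow> 0) (at_top :: real filter)"
proof -
  have "((\<lambda>y. \<Sum>i\<le>degree p. coeff p i * (y ^ i / exp y)) \<longlongrightarrow> (\<Sum>i\<le>degree p. coeff p i * 0)) (at_top :: real filter)"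
    by (intro tendsto_intros tendsto_power_div_exp_0)
  then show ?thesis
    by (simp add: poly_altdef sum_distrib_right sum_divide_distrib exp_minus field_simps)
qed

text \<open>Differentiation replaces \<open>p\<close> by \<open>X\<^sup>2 (p - p')\<close>, so the
  shape is preserved. At \<open>0\<close> the right difference quotient is
  \<open>y * p(y) * exp (- y)\<close> with \<open>y = 1 / h\<close>, again a polynomial times a
  decaying exponential.\<close>

lemma bump_has_derivative:
  "((\<lambda>x. if x > 0 then poly p (1 / x) * exp (- (1 / x)) else 0) has_real_derivative
    (if x > 0 then poly ([:0, 0, 1:] * (p - pderiv p)) (1 / x) * exp (- (1 / x)) else 0)) (at (x::real))"
  (is "(?f has_real_derivative ?f' x) (at x)")
proof -
  consider "x > 0" | "x < 0" | "x = 0" by linarith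
  then show ?thesis
  proof cases
    case 1
    have "((\<lambda>x. poly p (1 / x) * exp (- (1 / x))) has_real_derivative
        poly p (1 / x) * (exp (- (1 / x)) * (1 / x\<^sup>2)) + poly (pderiv p) (1 / x) * (- (1 / x\<^sup>2)) * exp (- (1 / x))) (at x)"
      using 1 by (auto intro!: derivative_eq_intros poly_DERIV[THEN DERIV_chain2] simp: power2_eq_square field_simps)
    moreover have "poly p (1 / x) * (exp (- (1 / x)) * (1 / x\<^sup>2)) + poly (pderiv p) (1 / x) * (- (1 / x\<^sup>2)) * exp (- (1 / x)) = ?f' x"
      using 1 by (simp add: field_simps power2_eq_square)
    ultimately have "((\<lambda>x. poly p (1 / x) * exp (- (1 / x))) has_real_derivative ?f' x) (at x)" by simp
    then show ?thesis
      by (rule has_field_derivative_transform_within_open[of _ _ _ "{0<..}"]) (use 1 in auto)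
  next
    case 2
    have "((\<lambda>x. 0) has_real_derivative ?f' x) (at x)" using 2 by simp
    then show ?thesis
      by (rule has_field_derivative_transform_within_open[of _ _ _ "{..<0}"]) (use 2 in auto)
  next
    case 3
    have "((\<lambda>y. poly (pCons 0 p) y * exp (- y)) \<longlongrightarrow> 0) (at_top :: real filter)"
      by (rule poly_exp_tendsto_0)
    from filterlim_compose[OF this filterlim_inverse_at_top_right]
    have "((\<lambda>h. (?f (0 + h) - ?f 0) / h) \<longlongrightarrow> 0) (at_right 0)"
      by (rule Lim_transform_eventually)
        (auto intro!: eventually_at_right_less[THEN eventually_mono] simp: inverse_eq_divide)
    moreover have "((\<lambda>h. (?f (0 + h) - ?f 0) / h) \<longlongrightarrow> 0) (at_left 0)"
      by (rule Lim_transform_eventually[OF tendsto_const])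
        (auto simp: eventually_at_filter)
    ultimately show ?thesis
      using 3 by (simp add: DERIV_def filterlim_split_at)
  qed
qed

lemma smooth_gen_derivative:
  assumes "smooth_gen f"
  shows "\<exists>f'. smooth_gen f' \<and> (\<forall>x. (f has_real_derivative f' x) (at x))"
  using assms
proof induction
  case (bump p)
  then show ?case using bump_has_derivative smooth_gen.bump by blast
next
  case (const c)
  then show ?case by (intro exI[of _ "\<lambda>x. 0"]) (auto intro: smooth_gen.const)
next
  case (affine f a b)
  then obtain f' where f': "smooth_gen f'" "\<And>x. (f has_real_derivative f' x) (at x)" by blast
  have "((\<lambda>x. f (a * x + b)) has_real_derivative f' (a * x + b) * a) (at x)" for x
    by (rule DERIV_chain2[OF f'(2)]) (auto intro!: derivative_eq_intros)
  then show ?case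
    using smooth_gen.mult[OF smooth_gen.affine[OF f'(1)] smooth_gen.const] by blast
next
  case (add f g)
  then obtain f' g' where "smooth_gen f'" "\<And>x. (f has_real_derivative f' x) (at x)"
    "smooth_gen g'" "\<And>x. (g has_real_derivative g' x) (at x)" by blast
  then show ?case
    by (intro exI[of _ "\<lambda>x. f' x + g' x"]) (auto intro!: smooth_gen.add DERIV_add)
next
  case (mult f g)
  then obtain f' g' where d: "smooth_gen f'" "\<And>x. (f has_real_derivative f' x) (at x)"
    "smooth_gen g'" "\<And>x. (g has_real_derivative g' x) (at x)" by blast
  have "smooth_gen (\<lambda>x. f x * g' x + f' x * g x)"
    using mult.hyps d by (intro smooth_gen.add smooth_gen.mult)
  then show ?case
    using d by (intro exI[of _ "\<lambda>x. f x * g' x + f' x * g x"]) (auto intro!: DERIV_mult')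
qed

lemma smooth_if_smooth_gen:
  assumes "smooth_gen f"
  shows "smooth f"
proof -
  have "(deriv ^^ n) f differentiable at x" for n x
    using assms
  proof (induction n arbitrary: f)
    case 0
    then show ?case
      using smooth_gen_derivative by (auto simp: real_differentiable_def)
  next
    case (Suc n)
    obtain f' where f': "smooth_gen f'" "\<And>x. (f has_real_derivative f' x) (at x)"
      using smooth_gen_derivative[OF Suc.prems] by blast
    have "deriv f = f'" using f'(2) by (auto intro: DERIV_imp_deriv)
    then show ?case using Suc.IH[OF f'(1)] by (simp add: funpow_swap1)
  qed
  then show ?thesis by (simp add: smooth_def)
qed

lemma smooth_antiderivative:
  assumes "smooth f'" "\<And>x. (f has_real_derivative f' x) (at x)"
  shows "smooth f"
  unfolding smooth_def
proof (intro allI)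
  fix n x
  have "deriv f = f'" using assms(2) by (auto intro: DERIV_imp_deriv)
  then show "(deriv ^^ n) f differentiable at x"
    using assms by (cases n) (auto simp: smooth_def funpow_swap1 real_differentiable_def)
qed

definition bump :: "real \<Rightarrow> real" where
  "bump x = (if x > 0 then exp (- (1 / x)) else 0)"

text \<open>Test functions that approximate indicators of intervals for large \<open>n\<close>;
  being bounded by \<open>1\<close> they are suited to dominated convergence.\<close>

definition bump_interval :: "real \<Rightarrow> real \<Rightarrow> nat \<Rightarrow> real \<Rightarrow> real" where
  "bump_interval a b n x = bump (real n * (x - a)) * bump (real n * (b - x))"

lemma bump_bounds: "0 \<le> bump x" "bump x \<le> 1"
  by (auto simp: bump_def)

lemma bump_interval_bounds: "0 \<le> bump_interval a b n x" "bump_interval a b n x \<le> 1"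
  using bump_bounds mult_le_one[of "bump (real n * (x - a))" "bump (real n * (b - x))"]
  by (auto simp: bump_interval_def)

lemma bump_interval_eq_0: "x \<notin> {a<..<b} \<Longrightarrow> bump_interval a b n x = 0"
  by (auto simp: bump_interval_def bump_def zero_less_mult_iff)

lemma bump_interval_pos: "x \<in> {a<..<b} \<Longrightarrow> n > 0 \<Longrightarrow> bump_interval a b n x > 0"
  by (auto simp: bump_interval_def bump_def zero_less_mult_iff)

lemma smooth_gen_bump_interval: "smooth_gen (bump_interval a b n)"
proof -
  have "bump = (\<lambda>x. if x > 0 then poly [:1:] (1 / x) * exp (- (1 / x)) else 0)"
    by (auto simp: bump_def)
  then have "smooth_gen bump" using smooth_gen.bump by metis
  then have "smooth_gen (\<lambda>x. bump (real n * x + (- real n * a)) * bump ((- real n) * x + real n * b))"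
    by (intro smooth_gen.mult smooth_gen.affine)
  then show ?thesis by (simp add: bump_interval_def[abs_def] algebra_simps)
qed

lemma test_function_iff: "test_function \<phi> \<longleftrightarrow> smooth \<phi> \<and> (\<exists>N. \<forall>x. \<bar>x\<bar> > N \<longrightarrow> \<phi> x = 0)"
proof -
  have "compact (closure {x. \<phi> x \<noteq> 0}) \<longleftrightarrow> bounded {x. \<phi> x \<noteq> 0}"
    by (auto simp: compact_eq_bounded_closed intro: bounded_subset[OF _ closure_subset] bounded_closure)
  also have "\<dots> \<longleftrightarrow> (\<exists>N. \<forall>x. \<bar>x\<bar> > N \<longrightarrow> \<phi> x = 0)"
    unfolding bounded_iff by (auto simp: not_less[symmetric])
  finally show ?thesis by (simp add: test_function_def smooth_def)
qed

lemma test_function_bump_interval: "test_function (bump_interval a b n)"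
  unfolding test_function_iff
proof (intro conjI exI[of _ "\<bar>a\<bar> + \<bar>b\<bar>"] allI impI)
  show "smooth (bump_interval a b n)" by (intro smooth_if_smooth_gen smooth_gen_bump_interval)
  show "bump_interval a b n x = 0" if "\<bar>x\<bar> > \<bar>a\<bar> + \<bar>b\<bar>" for x
    by (rule bump_interval_eq_0) (use that in auto)
qed

lemma bump_interval_tendsto:
  "(\<lambda>n. bump_interval a b n x) \<longlonglongrightarrow> indicator {a<..<b} x"
proof (cases "x \<in> {a<..<b}")
  case True
  have lim: "(\<lambda>n. exp (- (1 / (real n * c)))) \<longlonglongrightarrow> 1" if "c > 0" for c
    using that by real_asymp
  have "(\<lambda>n. exp (- (1 / (real n * (x - a)))) * exp (- (1 / (real n * (b - x))))) \<longlonglongrightarrow> 1 * 1"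
    using True by (intro tendsto_mult lim) auto
  then have "(\<lambda>n. bump_interval a b n x) \<longlonglongrightarrow> 1 * 1"
    by (rule Lim_transform_eventually)
      (use True in \<open>auto intro!: eventually_gt_at_top[of 0, THEN eventually_mono] simp: bump_interval_def bump_def\<close>)
  then show ?thesis using True by simp
qed (simp add: bump_interval_eq_0)

lemma test_function_derivative:
  assumes "test_function \<phi>"
  shows "(\<phi> has_real_derivative deriv \<phi> x) (at x)" "continuous_on UNIV (deriv \<phi>)"
proof -
  have d: "\<phi> differentiable at x" "deriv \<phi> differentiable at x" for x
    using assms by (auto simp: test_function_iff smooth_def dest: spec[of _ 0] spec[of _ 1])
  show "(\<phi> has_real_derivative deriv \<phi> x) (at x)"
    using d(1)[of x] by (simp add: real_differentiable_def DERIV_deriv_iff_real_differentiable)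
  show "continuous_on UNIV (deriv \<phi>)"
    using d(2) by (auto intro!: continuous_at_imp_continuous_on differentiable_imp_continuous_within)
qed

lemma test_function_continuous: "test_function \<phi> \<Longrightarrow> continuous_on UNIV \<phi>"
  using test_function_derivative(1) by (auto intro!: continuous_at_imp_continuous_on DERIV_isCont)

lemma test_function_support:
  assumes "test_function \<phi>"
  obtains N where "N > 0" "\<And>x. \<bar>x\<bar> > N \<Longrightarrow> \<phi> x = 0" "\<And>x. \<bar>x\<bar> > N \<Longrightarrow> deriv \<phi> x = 0"
proof -
  obtain N0 where N0: "\<And>x. \<bar>x\<bar> > N0 \<Longrightarrow> \<phi> x = 0" using assms by (auto simp: test_function_iff)
  show ?thesis
  proof (rule that[of "max 1 N0"])
    show "max 1 N0 > 0" by simp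
    show "\<phi> x = 0" if "\<bar>x\<bar> > max 1 N0" for x using that N0 by simp
    show "deriv \<phi> x = 0" if x: "\<bar>x\<bar> > max 1 N0" for x
    proof -
      have "((\<lambda>x. 0) has_real_derivative 0) (at x)" by simp
      then have "(\<phi> has_real_derivative 0) (at x)"
      proof (rule has_field_derivative_transform_within_open[of _ _ _ "{x. \<bar>x\<bar> > N0}"])
        show "open {x. \<bar>x\<bar> > N0}" by (intro open_Collect_less continuous_intros)
      qed (use x N0 in auto)
      then show ?thesis by (rule DERIV_imp_deriv)
    qed
  qed
qed

section \<open>Locally integrable functions and the fundamental lemma\<close>

definition locally_integrable :: "(real \<Rightarrow> 'b::{banach, second_countable_topology}) \<Rightarrow> bool" where
  "locally_integrable g \<longleftrightarrow> g \<in> borel_measurable lborel \<and>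
     (\<forall>N. integrable lborel (\<lambda>x. indicator {-N..N} x *\<^sub>R g x))"

lemma locally_integrable_mult_compact:
  fixes g :: "real \<Rightarrow> complex"
  assumes g: "locally_integrable g" and \<psi>: "continuous_on UNIV \<psi>" and supp: "\<And>x. \<bar>x\<bar> > N \<Longrightarrow> \<psi> x = 0"
  shows "integrable lborel (\<lambda>x. \<psi> x * g x)"
proof -
  have [measurable]: "g \<in> borel_measurable borel" using g by (simp add: locally_integrable_def)
  have [measurable]: "\<psi> \<in> borel_measurable borel" using \<psi> by (rule borel_measurable_continuous_onI)
  have "bounded (\<psi> ` {-N..N})"
    by (intro compact_imp_bounded compact_continuous_image continuous_on_subset[OF \<psi>]) auto
  then obtain B where B: "\<And>x. x \<in> {-N..N} \<Longrightarrow> norm (\<psi> x) \<le> B" by (force simp: bounded_iff)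
  show ?thesis
  proof (rule Bochner_Integration.integrable_bound)
    show "integrable lborel (\<lambda>x. B *\<^sub>R (indicator {-N..N} x *\<^sub>R g x))"
      using g by (intro integrable_scaleR_right) (simp add: locally_integrable_def)
    have "norm (\<psi> x * g x) \<le> norm (B *\<^sub>R (indicator {-N..N} x *\<^sub>R g x))" for x
    proof (cases "x \<in> {-N..N}")
      case True
      have "norm (\<psi> x) * norm (g x) \<le> \<bar>B\<bar> * norm (g x)"
        using B[OF True] by (intro mult_right_mono) auto
      then show ?thesis using True by (simp add: norm_mult)
    qed (use supp in auto)
    then show "AE x in lborel. norm (\<psi> x * g x) \<le> norm (B *\<^sub>R (indicator {-N..N} x *\<^sub>R g x))" by simp
  qed measurable
qed

text \<open>The positive and the negative part are densities of two measures that agree on all rays.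
  The measures therefore coincide, and densities are unique almost everywhere.\<close>

lemma AE_zero_if_integral_rays_zero:
  fixes f :: "real \<Rightarrow> real"
  assumes f: "integrable lborel f" and zero: "\<And>a. (\<integral>x. indicator {a<..} x * f x \<partial>lborel) = 0"
  shows "AE x in lborel. f x = 0"
proof -
  let ?p = "\<lambda>x. max (f x) 0" and ?n = "\<lambda>x. max (- f x) 0"
  have [measurable]: "f \<in> borel_measurable borel" using f by auto
  have ip: "integrable lborel (\<lambda>x. indicator {a<..} x * ?p x)" for a
    by (rule Bochner_Integration.integrable_bound[OF f]) (auto simp: indicator_def)
  have i_n: "integrable lborel (\<lambda>x. indicator {a<..} x * ?n x)" for a
    by (rule Bochner_Integration.integrable_bound[OF f]) (auto simp: indicator_def)
  have eq: "(\<integral>x. indicator {a<..} x * ?p x \<partial>lborel) = (\<integral>x. indicator {a<..} x * ?n x \<partial>lborel)" for a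
  proof -
    have "(\<integral>x. indicator {a<..} x * ?p x \<partial>lborel) - (\<integral>x. indicator {a<..} x * ?n x \<partial>lborel)
       = (\<integral>x. indicator {a<..} x * ?p x - indicator {a<..} x * ?n x \<partial>lborel)"
      using ip i_n by simp
    also have "\<dots> = (\<integral>x. indicator {a<..} x * f x \<partial>lborel)"
      by (rule Bochner_Integration.integral_cong) (auto simp: indicator_def)
    finally show ?thesis using zero by simp
  qed
  have ed: "emeasure (density lborel (\<lambda>x. ennreal (g x))) {a<..} = ennreal (\<integral>x. indicator {a<..} x * g x \<partial>lborel)"
    if "integrable lborel (\<lambda>x. indicator {a<..} x * g x)" "\<And>x. g x \<ge> 0" "g \<in> borel_measurable borel" for g :: "real \<Rightarrow> real" and a
  proof -
    have "emeasure (density lborel (\<lambda>x. ennreal (g x))) {a<..} = (\<integral>\<^sup>+x. ennreal (g x) * indicator {a<..} x \<partial>lborel)"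
      using that by (subst emeasure_density) auto
    also have "\<dots> = (\<integral>\<^sup>+x. ennreal (indicator {a<..} x * g x) \<partial>lborel)"
      by (intro nn_integral_cong) (auto simp: indicator_def)
    also have "\<dots> = ennreal (\<integral>x. indicator {a<..} x * g x \<partial>lborel)"
      using that by (intro nn_integral_eq_integral) auto
    finally show ?thesis .
  qed
  have "density lborel (\<lambda>x. ennreal (?p x)) = density lborel (\<lambda>x. ennreal (?n x))"
    by (rule measure_eqI_lessThan) (auto simp: ed ip i_n eq)
  then have "AE x in lborel. ennreal (?p x) = ennreal (?n x)"
    by (intro sigma_finite_measure.density_unique[OF sigma_finite_lborel]) auto
  then show ?thesis
    by eventually_elim (auto simp: max_def split: if_splits)
qed

text \<open>Approximating indicators by test functions shows that \<open>g\<close> has integral zero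
  over every bounded open interval; cut off to \<open>{- N<..<N}\<close> it is integrable and has
  integral zero over every ray.\<close>

lemma fundamental_lemma_real:
  fixes g :: "real \<Rightarrow> real"
  assumes g: "locally_integrable g"
    and zero: "\<And>\<phi>. test_function \<phi> \<Longrightarrow> (\<integral>x. \<phi> x * g x \<partial>lborel) = 0"
  shows "AE x in lborel. g x = 0"
proof -
  have [measurable]: "g \<in> borel_measurable borel" using g by (simp add: locally_integrable_def)
  have int: "integrable lborel (\<lambda>x. indicator {-N..N} x * g x)" for N
    using g by (simp add: locally_integrable_def)
  have Ioo: "(\<integral>x. indicator {a<..<b} x * g x \<partial>lborel) = 0" for a b :: real
  proof -
    define N where "N = \<bar>a\<bar> + \<bar>b\<bar>"
    have [measurable]: "bump_interval a b n \<in> borel_measurable borel" for n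
      by (intro borel_measurable_continuous_onI test_function_continuous test_function_bump_interval)
    have "(\<lambda>n. \<integral>x. bump_interval a b n x * g x \<partial>lborel) \<longlonglongrightarrow> (\<integral>x. indicator {a<..<b} x * g x \<partial>lborel)"
    proof (rule integral_dominated_convergence)
      show "integrable lborel (\<lambda>x. norm (indicator {-N..N} x * g x))" by (intro integrable_norm int)
      show "AE x in lborel. (\<lambda>n. bump_interval a b n x * g x) \<longlonglongrightarrow> indicator {a<..<b} x * g x"
        by (intro AE_I2 tendsto_mult bump_interval_tendsto tendsto_const)
      show "AE x in lborel. norm (bump_interval a b n x * g x) \<le> norm (indicator {-N..N} x * g x)" for n
      proof (intro AE_I2)
        fix x
        show "norm (bump_interval a b n x * g x) \<le> norm (indicator {-N..N} x * g x)"
        proof (cases "x \<in> {a<..<b}")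
          case True
          then have "x \<in> {-N..N}" by (auto simp: N_def)
          then show ?thesis
            using bump_interval_bounds[of a b n x] by (simp add: abs_mult mult_left_le_one_le)
        qed (simp add: bump_interval_eq_0)
      qed
    qed measurable
    moreover have "(\<integral>x. bump_interval a b n x * g x \<partial>lborel) = 0" for n
      by (intro zero test_function_bump_interval)
    ultimately show ?thesis by (simp add: LIMSEQ_const_iff)
  qed
  have "AE x in lborel. indicator {- real N<..<real N} x * g x = 0" for N
  proof (rule AE_zero_if_integral_rays_zero)
    show "integrable lborel (\<lambda>x. indicator {- real N<..<real N} x * g x)"
      by (rule Bochner_Integration.integrable_bound[OF int[of "real N"]]) (auto simp: indicator_def)
    fix a
    have "(\<integral>x. indicator {a<..} x * (indicator {- real N<..<real N} x * g x) \<partial>lborel)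
      = (\<integral>x. indicator {max a (- real N)<..<real N} x * g x \<partial>lborel)"
      by (rule Bochner_Integration.integral_cong) (auto simp: indicator_def)
    then show "(\<integral>x. indicator {a<..} x * (indicator {- real N<..<real N} x * g x) \<partial>lborel) = 0"
      by (simp add: Ioo)
  qed
  then have "AE x in lborel. \<forall>N. indicator {- real N<..<real N} x * g x = 0"
    by (subst AE_all_countable) auto
  then show ?thesis
  proof eventually_elim
    case (elim x)
    obtain N where "\<bar>x\<bar> < real N" using reals_Archimedean2 by blast
    then show ?case using elim[rule_format, of N] by (simp add: abs_less_iff)
  qed
qed

lemma locally_integrable_Re_Im:
  assumes "locally_integrable g"
  shows "locally_integrable (\<lambda>x. Re (g x))" "locally_integrable (\<lambda>x. Im (g x))"
proof -
  have i: "integrable lborel (\<lambda>x. indicator {-N..N} x *\<^sub>R g x)" for N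
    using assms by (simp add: locally_integrable_def)
  have [measurable]: "g \<in> borel_measurable borel" using assms by (simp add: locally_integrable_def)
  show "locally_integrable (\<lambda>x. Re (g x))" "locally_integrable (\<lambda>x. Im (g x))"
    unfolding locally_integrable_def
    using integrable_Re[OF i] integrable_Im[OF i] by auto
qed

lemma fundamental_lemma:
  fixes g :: "real \<Rightarrow> complex"
  assumes g: "locally_integrable g"
    and zero: "\<And>\<phi>. test_function \<phi> \<Longrightarrow> (\<integral>x. of_real (\<phi> x) * g x \<partial>lborel) = 0"
  shows "AE x in lborel. g x = 0"
proof -
  have int: "integrable lborel (\<lambda>x. of_real (\<phi> x) * g x)" if \<phi>: "test_function \<phi>" for \<phi>
  proof -
    obtain N where "\<And>x. \<bar>x\<bar> > N \<Longrightarrow> \<phi> x = 0" using test_function_support[OF \<phi>] by metis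
    then show ?thesis
      by (intro locally_integrable_mult_compact[OF g, of _ N] continuous_intros test_function_continuous[OF \<phi>]) auto
  qed
  have "AE x in lborel. Re (g x) = 0"
  proof (rule fundamental_lemma_real[OF locally_integrable_Re_Im(1)[OF g]])
    show "(\<integral>x. \<phi> x * Re (g x) \<partial>lborel) = 0" if "test_function \<phi>" for \<phi>
      using zero[OF that] integral_Re[OF int[OF that]] by simp
  qed
  moreover have "AE x in lborel. Im (g x) = 0"
  proof (rule fundamental_lemma_real[OF locally_integrable_Re_Im(2)[OF g]])
    show "(\<integral>x. \<phi> x * Im (g x) \<partial>lborel) = 0" if "test_function \<phi>" for \<phi>
      using zero[OF that] integral_Im[OF int[OF that]] by simp
  qed
  ultimately show ?thesis by eventually_elim (simp add: complex_eq_iff)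
qed

section \<open>Primitives and weak derivatives of scalar functions\<close>

text \<open>The integral from \<open>0\<close> to \<open>x\<close> with sign: the difference of
  indicators is \<open>1\<close> on \<open>{0<..x}\<close> for positive \<open>x\<close> and
  \<open>- 1\<close> on \<open>{x<..0}\<close> for negative \<open>x\<close>. A single formula for
  both signs gives a jointly measurable integrand for Fubini.\<close>

definition primitive :: "(real \<Rightarrow> 'b::{banach, second_countable_topology}) \<Rightarrow> real \<Rightarrow> 'b" where
  "primitive \<alpha> x = (\<integral>t. (indicator {..x} t - indicator {..0} t) *\<^sub>R \<alpha> t \<partial>lborel)"

lemma locally_integrable_Icc:
  assumes "locally_integrable \<alpha>"
  shows "integrable lborel (\<lambda>t. indicator {a..b} t *\<^sub>R \<alpha> t)"
proof (rule Bochner_Integration.integrable_bound)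
  have [measurable]: "\<alpha> \<in> borel_measurable borel" using assms by (simp add: locally_integrable_def)
  show "integrable lborel (\<lambda>t. indicator {-(\<bar>a\<bar> + \<bar>b\<bar>)..\<bar>a\<bar> + \<bar>b\<bar>} t *\<^sub>R \<alpha> t)"
    using assms unfolding locally_integrable_def by blast
  show "(\<lambda>t. indicator {a..b} t *\<^sub>R \<alpha> t) \<in> borel_measurable lborel" by measurable
qed (auto simp: indicator_def)

lemma locally_integrable_continuous:
  assumes "continuous_on UNIV \<alpha>"
  shows "locally_integrable \<alpha>"
  unfolding locally_integrable_def
proof (intro conjI allI)
  show "\<alpha> \<in> borel_measurable lborel" using borel_measurable_continuous_onI[OF assms] by simp
  show "integrable lborel (\<lambda>x. indicator {- N..N} x *\<^sub>R \<alpha> x)" for N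
    by (rule borel_integrable_compact) (auto intro: continuous_on_subset[OF assms])
qed

lemma primitive_eq:
  assumes \<alpha>: "locally_integrable \<alpha>" and N: "N \<ge> 0" "- N \<le> x"
  shows "primitive \<alpha> x = (\<integral>t. indicator {-N..x} t *\<^sub>R \<alpha> t \<partial>lborel) - (\<integral>t. indicator {-N..0} t *\<^sub>R \<alpha> t \<partial>lborel)"
proof -
  have "primitive \<alpha> x = (\<integral>t. indicator {-N..x} t *\<^sub>R \<alpha> t - indicator {-N..0} t *\<^sub>R \<alpha> t \<partial>lborel)"
    unfolding primitive_def using N by (intro Bochner_Integration.integral_cong) (auto simp: indicator_def)
  then show ?thesis by (simp add: locally_integrable_Icc[OF \<alpha>])
qed

lemma primitive_has_vector_derivative:
  fixes \<alpha> :: "real \<Rightarrow> 'b::euclidean_space"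
  assumes \<alpha>: "continuous_on UNIV \<alpha>"
  shows "(primitive \<alpha> has_vector_derivative \<alpha> x) (at x)"
proof -
  define N where "N = \<bar>x\<bar> + 1"
  define k where "k = (\<integral>t. indicator {-N..0} t *\<^sub>R \<alpha> t \<partial>lborel)"
  have c: "continuous_on {-N..N} \<alpha>" by (rule continuous_on_subset[OF \<alpha>]) simp
  have "((\<lambda>y. integral {-N..y} \<alpha>) has_vector_derivative \<alpha> x) (at x within {-N..N})"
    by (rule integral_has_vector_derivative[OF c]) (auto simp: N_def)
  then have "((\<lambda>y. integral {-N..y} \<alpha> - k) has_vector_derivative \<alpha> x) (at x within {-N<..<N})"
    by (auto intro!: derivative_eq_intros elim: has_vector_derivative_within_subset)
  then have "((\<lambda>y. integral {-N..y} \<alpha> - k) has_vector_derivative \<alpha> x) (at x)"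
    by (subst (asm) at_within_open) (auto simp: N_def)
  then show ?thesis
  proof (rule has_vector_derivative_transform_within_open[of _ _ _ "{-N<..<N}"])
    fix y assume y: "y \<in> {-N<..<N}"
    have "set_integrable lborel {-N..y} \<alpha>"
      by (intro borel_integrable_atLeastAtMost' continuous_on_subset[OF \<alpha>]) auto
    then have "(\<integral>t. indicator {-N..y} t *\<^sub>R \<alpha> t \<partial>lborel) = integral {-N..y} \<alpha>"
      using set_borel_integral_eq_integral(2) by (force simp: set_lebesgue_integral_def)
    then show "integral {-N..y} \<alpha> - k = primitive \<alpha> y"
      using y primitive_eq[OF locally_integrable_continuous[OF \<alpha>], of N y] by (simp add: k_def)
  qed (auto simp: N_def)
qed

lemma integral_derivative_ray:
  fixes \<Psi> \<Psi>' :: "real \<Rightarrow> complex"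
  assumes d: "\<And>x. (\<Psi> has_vector_derivative \<Psi>' x) (at x)" and c: "continuous_on UNIV \<Psi>'"
    and supp: "\<And>x. \<bar>x\<bar> > N \<Longrightarrow> \<Psi> x = 0" "\<And>x. \<bar>x\<bar> > N \<Longrightarrow> \<Psi>' x = 0"
  shows "(\<integral>x. indicator {t..} x *\<^sub>R \<Psi>' x \<partial>lborel) = - \<Psi> t"
proof -
  define M where "M = \<bar>t\<bar> + \<bar>N\<bar> + 1"
  have "(\<integral>x. indicator {t..} x *\<^sub>R \<Psi>' x \<partial>lborel) = (\<integral>x. indicator {t..M} x *\<^sub>R \<Psi>' x \<partial>lborel)"
  proof (rule Bochner_Integration.integral_cong)
    fix x
    show "indicator {t..} x *\<^sub>R \<Psi>' x = indicator {t..M} x *\<^sub>R \<Psi>' x"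
      using supp(2)[of x] by (cases "x \<le> M") (auto simp: M_def indicator_def)
  qed simp
  also have "\<dots> = \<Psi> M - \<Psi> t"
    by (rule integral_FTC_atLeastAtMost)
      (auto simp: M_def intro!: has_vector_derivative_at_within[OF d] continuous_on_subset[OF c])
  also have "\<Psi> M = 0" using supp(1)[of M] by (simp add: M_def)
  finally show ?thesis by simp
qed

lemma integrable_compact_support:
  fixes f :: "real \<Rightarrow> 'b::euclidean_space"
  assumes "continuous_on UNIV f" "\<And>x. \<bar>x\<bar> > N \<Longrightarrow> f x = 0"
  shows "integrable lborel f"
proof -
  have "integrable lborel (\<lambda>x. indicator {- N..N} x *\<^sub>R f x)"
    using locally_integrable_continuous[OF assms(1)] by (simp add: locally_integrable_def)
  moreover have "(\<lambda>x. indicator {- N..N} x *\<^sub>R f x) = f"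
    using assms(2) by (auto simp: indicator_def fun_eq_iff abs_le_iff not_le)
  ultimately show ?thesis by simp
qed

lemma primitive_weak_derivative:
  fixes \<Psi> \<Psi>' \<alpha> :: "real \<Rightarrow> complex"
  assumes \<alpha>: "locally_integrable \<alpha>"
    and d: "\<And>x. (\<Psi> has_vector_derivative \<Psi>' x) (at x)" and c: "continuous_on UNIV \<Psi>'"
    and supp: "\<And>x. \<bar>x\<bar> > N \<Longrightarrow> \<Psi> x = 0" "\<And>x. \<bar>x\<bar> > N \<Longrightarrow> \<Psi>' x = 0"
  shows "integrable lborel (\<lambda>x. \<Psi>' x * primitive \<alpha> x)"
    and "(\<integral>x. \<Psi>' x * primitive \<alpha> x \<partial>lborel) = - (\<integral>x. \<Psi> x * \<alpha> x \<partial>lborel)"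
proof -
  have [measurable]: "\<alpha> \<in> borel_measurable borel" using \<alpha> by (simp add: locally_integrable_def)
  have [measurable]: "\<Psi>' \<in> borel_measurable borel" using c by (rule borel_measurable_continuous_onI)
  define F where "F x t = \<Psi>' x * ((indicator {..x} t - indicator {..0} t) *\<^sub>R \<alpha> t)" for x t :: real
  define A where "A t = indicator {-N..N} t *\<^sub>R \<alpha> t" for t
  have intA: "integrable lborel A" using \<alpha> by (simp add: A_def[abs_def] locally_integrable_def)
  have [measurable]: "A \<in> borel_measurable borel" using intA by auto
  have int\<Psi>': "integrable lborel \<Psi>'" by (rule integrable_compact_support[OF c supp(2)])
  have meas: "(\<lambda>(x, t). F x t) \<in> borel_measurable (lborel \<Otimes>\<^sub>M lborel)"
  proof -
    have [measurable]: "Measurable.pred (lborel \<Otimes>\<^sub>M lborel) (\<lambda>p::real\<times>real. snd p \<le> fst p)" by measurable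
    have "(\<lambda>(x, t). F x t) = (\<lambda>p. \<Psi>' (fst p) * ((indicator {p. snd p \<le> fst p} p - indicator {..0} (snd p)) *\<^sub>R \<alpha> (snd p)))"
      by (auto simp: F_def fun_eq_iff indicator_def)
    also have "\<dots> \<in> borel_measurable (lborel \<Otimes>\<^sub>M lborel)" by measurable
    finally show ?thesis .
  qed
  have dom_int: "integrable (lborel \<Otimes>\<^sub>M lborel) (\<lambda>(x, t). \<Psi>' x * A t)"
    by (rule lborel_pair.Fubini_integrable)
      (use int\<Psi>' intA in \<open>auto simp: norm_mult intro!: integrable_mult_left integrable_norm\<close>)
  \<comment> \<open>The signed indicator lives between \<open>0\<close> and \<open>x\<close>, hence
    inside \<open>{- N..N}\<close> wherever \<open>\<Psi>' x\<close> can be nonzero; this yields a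
    majorant in product form.\<close>
  have F_le: "norm (F x t) \<le> norm (\<Psi>' x * A t)" for x t
  proof (cases "\<bar>x\<bar> \<le> N")
    case True
    then show ?thesis by (auto simp: F_def A_def indicator_def norm_mult)
  qed (simp add: F_def supp)
  have intF: "integrable (lborel \<Otimes>\<^sub>M lborel) (\<lambda>(x, t). F x t)"
    by (rule Bochner_Integration.integrable_bound[OF dom_int meas]) (use F_le in auto)
  have inner: "(\<integral>t. F x t \<partial>lborel) = \<Psi>' x * primitive \<alpha> x" for x
    unfolding F_def primitive_def by (rule integral_mult_right_zero)
  show "integrable lborel (\<lambda>x. \<Psi>' x * primitive \<alpha> x)"
    using lborel_pair.integrable_fst'[OF intF] by (simp add: inner)
  have outer: "(\<integral>x. F x t \<partial>lborel) = - (\<Psi> t * \<alpha> t)" for t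
  proof -
    \<comment> \<open>The base point \<open>0\<close> of the primitive contributes a multiple of the
      total integral of \<open>\<Psi>'\<close>, which vanishes by compact support.\<close>
    have z: "(\<integral>x. \<Psi>' x \<partial>lborel) = 0"
    proof -
      have "(\<integral>x. \<Psi>' x \<partial>lborel) = (\<integral>x. indicator {- \<bar>N\<bar> - 1..} x *\<^sub>R \<Psi>' x \<partial>lborel)"
        using supp(2) by (intro Bochner_Integration.integral_cong) (auto simp: indicator_def not_le)
      also have "\<dots> = - \<Psi> (- \<bar>N\<bar> - 1)" by (rule integral_derivative_ray[OF d c supp])
      also have "\<dots> = 0" using supp(1)[of "- \<bar>N\<bar> - 1"] by simp
      finally show ?thesis .
    qed
    have i1: "integrable lborel (\<lambda>x. indicator {t..} x *\<^sub>R \<Psi>' x)"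
      by (rule Bochner_Integration.integrable_bound[OF int\<Psi>']) (auto simp: indicator_def)
    have "(\<integral>x. F x t \<partial>lborel) = (\<integral>x. (indicator {t..} x *\<^sub>R \<Psi>' x) * \<alpha> t - \<Psi>' x * (indicator {..0} t *\<^sub>R \<alpha> t) \<partial>lborel)"
      by (rule Bochner_Integration.integral_cong) (auto simp: F_def indicator_def)
    also have "\<dots> = (\<integral>x. indicator {t..} x *\<^sub>R \<Psi>' x \<partial>lborel) * \<alpha> t - (\<integral>x. \<Psi>' x \<partial>lborel) * (indicator {..0} t *\<^sub>R \<alpha> t)"
      by (subst Bochner_Integration.integral_diff[OF integrable_mult_left[OF i1] integrable_mult_left[OF int\<Psi>']])
        (simp only: integral_mult_left_zero)
    also have "\<dots> = - (\<Psi> t * \<alpha> t)"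
    proof -
      have "(\<integral>x. indicator {t..} x *\<^sub>R \<Psi>' x \<partial>lborel) = - \<Psi> t"
        by (rule integral_derivative_ray[OF d c supp])
      then show ?thesis unfolding z by simp
    qed
    finally show ?thesis .
  qed
  have "(\<integral>x. \<Psi>' x * primitive \<alpha> x \<partial>lborel) = (\<integral>x. (\<integral>t. F x t \<partial>lborel) \<partial>lborel)" by (simp add: inner)
  also have "\<dots> = (\<integral>t. (\<integral>x. F x t \<partial>lborel) \<partial>lborel)"
    by (rule lborel_pair.Fubini_integral[OF intF, symmetric])
  also have "\<dots> = - (\<integral>x. \<Psi> x * \<alpha> x \<partial>lborel)" by (simp add: outer)
  finally show "(\<integral>x. \<Psi>' x * primitive \<alpha> x \<partial>lborel) = - (\<integral>x. \<Psi> x * \<alpha> x \<partial>lborel)" .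
qed

lemma smooth_diff_cmult:
  assumes "smooth f" "smooth g"
  shows "smooth (\<lambda>x. f x - k * g x)"
proof -
  have d: "((deriv ^^ n) f has_real_derivative (deriv ^^ Suc n) f x) (at x)"
    "((deriv ^^ n) g has_real_derivative (deriv ^^ Suc n) g x) (at x)" for n x
    using assms by (auto simp: smooth_def DERIV_deriv_iff_real_differentiable)
  have eq: "(deriv ^^ n) (\<lambda>x. f x - k * g x) = (\<lambda>x. (deriv ^^ n) f x - k * (deriv ^^ n) g x)" for n
  proof (induction n)
    case (Suc n)
    show ?case
      by (auto simp: Suc intro!: DERIV_imp_deriv derivative_eq_intros d[simplified])
  qed simp
  show ?thesis
    unfolding smooth_def eq real_differentiable_def
    by (intro allI exI) (rule DERIV_diff[OF d(1) DERIV_cmult[OF d(2)]])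
qed

text \<open>The integral from \<open>- \<infinity>\<close> vanishes to the left of the support, and
  to its right because the mean is zero.\<close>

lemma test_function_antiderivative:
  assumes \<eta>: "test_function \<eta>" and zero: "(\<integral>x. \<eta> x \<partial>lborel) = 0"
  obtains \<phi> where "test_function \<phi>" "deriv \<phi> = \<eta>"
proof -
  obtain N where N: "N > 0" "\<And>x. \<bar>x\<bar> > N \<Longrightarrow> \<eta> x = 0" using test_function_support[OF \<eta>] by metis
  note c = test_function_continuous[OF \<eta>]
  note int = integrable_compact_support[OF c N(2)]
  define k where "k = (\<integral>t. indicator {..0} t *\<^sub>R \<eta> t \<partial>lborel)"
  define \<phi> where "\<phi> x = primitive \<eta> x + k" for x
  have d: "(\<phi> has_real_derivative \<eta> x) (at x)" for x
    unfolding \<phi>_def[abs_def] using primitive_has_vector_derivative[OF c, of x]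
    by (auto intro!: derivative_eq_intros simp: has_real_derivative_iff_has_vector_derivative)
  have i: "integrable lborel (\<lambda>t. indicator {..y} t *\<^sub>R \<eta> t)" for y
    by (rule Bochner_Integration.integrable_bound[OF int]) (use int in \<open>auto simp: indicator_def\<close>)
  have \<phi>_eq: "\<phi> x = (\<integral>t. indicator {..x} t *\<^sub>R \<eta> t \<partial>lborel)" for x
    using i by (simp add: \<phi>_def primitive_def k_def left_diff_distrib)
  have "\<phi> x = 0" if x: "\<bar>x\<bar> > N" for x
  proof (cases "x > 0")
    case True
    have "\<phi> x = (\<integral>x. \<eta> x \<partial>lborel)"
      unfolding \<phi>_eq using N x True by (intro Bochner_Integration.integral_cong) (auto simp: indicator_def not_le)
    then show ?thesis by (simp add: zero)
  next
    case False
    have "(\<lambda>t. indicator {..x} t *\<^sub>R \<eta> t) = (\<lambda>t. 0)"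
      using N x False by (auto simp: indicator_def fun_eq_iff)
    then show ?thesis unfolding \<phi>_eq by simp
  qed
  moreover have "smooth \<phi>"
    by (rule smooth_antiderivative[OF _ d]) (use \<eta> in \<open>simp add: test_function_iff\<close>)
  ultimately have "test_function \<phi>" by (auto simp: test_function_iff)
  moreover have "deriv \<phi> = \<eta>" using d by (auto intro: DERIV_imp_deriv)
  ultimately show ?thesis by (rule that)
qed

lemma test_function_diff_cmult:
  assumes "test_function f" "test_function g"
  shows "test_function (\<lambda>x. f x - k * g x)"
proof -
  obtain M N where "\<And>x. \<bar>x\<bar> > M \<Longrightarrow> f x = 0" "\<And>x. \<bar>x\<bar> > N \<Longrightarrow> g x = 0"
    using assms by (auto simp: test_function_iff)
  then show ?thesis
    using assms by (auto simp: test_function_iff intro!: smooth_diff_cmult exI[of _ "max M N"])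
qed

lemma test_function_normalized:
  obtains \<rho> where "test_function \<rho>" "(\<integral>x. \<rho> x \<partial>lborel) = 1"
proof -
  let ?b = "bump_interval 0 1 1"
  have t: "test_function ?b" by (rule test_function_bump_interval)
  obtain N where "\<And>x. \<bar>x\<bar> > N \<Longrightarrow> ?b x = 0" using test_function_support[OF t] by metis
  then have int: "integrable lborel ?b"
    by (intro integrable_compact_support[OF test_function_continuous[OF t]])
  define I where "I = (\<integral>x. ?b x \<partial>lborel)"
  have "I \<noteq> 0"
  proof
    assume "I = 0"
    then have "AE x in lborel. ?b x = 0"
      using integral_nonneg_eq_0_iff_AE[OF int] bump_interval_bounds by (auto simp: I_def)
    then have "AE x in lborel. x \<notin> {0<..<1::real}"
      by eventually_elim (use bump_interval_pos[of _ 0 1 1] in fastforce)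
    then have "{0<..<1::real} \<in> null_sets lborel"
      by (subst AE_iff_null_sets) auto
    then show False by (simp add: null_sets_def)
  qed
  moreover have "test_function (\<lambda>x. 0 - (- (1 / I)) * ?b x)"
    by (rule test_function_diff_cmult[OF _ t]) (auto simp: test_function_iff intro!: smooth_if_smooth_gen smooth_gen.const)
  ultimately show ?thesis
    by (intro that[of "\<lambda>x. 0 - (- (1 / I)) * ?b x"]) (auto simp: I_def)
qed

text \<open>Subtracting a multiple of a normalized \<open>\<rho>\<close> gives a test function mean
  zero and hence makes it the derivative of a test function. Testing with it shows that
  \<open>g\<close> minus its average against \<open>\<rho>\<close> is annihilated by all test
  functions.\<close>

lemma du_Bois_Reymond:
  fixes g :: "real \<Rightarrow> complex"
  assumes g: "locally_integrable g"
    and zero: "\<And>\<phi>. test_function \<phi> \<Longrightarrow> (\<integral>x. of_real (deriv \<phi> x) * g x \<partial>lborel) = 0"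
  shows "\<exists>c. AE x in lborel. g x = c"
proof -
  obtain \<rho> where \<rho>: "test_function \<rho>" "(\<integral>x. \<rho> x \<partial>lborel) = 1" by (rule test_function_normalized)
  define c where "c = (\<integral>x. of_real (\<rho> x) * g x \<partial>lborel)"
  have int: "integrable lborel (\<lambda>x. of_real (\<phi> x) * h x)" "integrable lborel \<phi>"
    if \<phi>: "test_function \<phi>" and h: "locally_integrable h" for \<phi> and h :: "real \<Rightarrow> complex"
  proof -
    obtain N where N: "\<And>x. \<bar>x\<bar> > N \<Longrightarrow> \<phi> x = 0" using test_function_support[OF \<phi>] by metis
    show "integrable lborel (\<lambda>x. of_real (\<phi> x) * h x)"
      by (intro locally_integrable_mult_compact[OF h, of _ N] continuous_intros test_function_continuous[OF \<phi>]) (simp add: N)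
    show "integrable lborel \<phi>"
      by (rule integrable_compact_support[OF test_function_continuous[OF \<phi>] N])
  qed
  have lc: "locally_integrable (\<lambda>x. c)" by (rule locally_integrable_continuous) auto
  have gc: "locally_integrable (\<lambda>x. g x - c)"
    using g lc by (auto simp: locally_integrable_def scaleR_diff_right intro: Bochner_Integration.integrable_diff)
  have "AE x in lborel. g x - c = 0"
  proof (rule fundamental_lemma[OF gc])
    fix \<psi> assume \<psi>: "test_function \<psi>"
    define k where "k = (\<integral>x. \<psi> x \<partial>lborel)"
    define \<eta> where "\<eta> x = \<psi> x - k * \<rho> x" for x
    have \<eta>: "test_function \<eta>" unfolding \<eta>_def[abs_def] by (rule test_function_diff_cmult[OF \<psi> \<rho>(1)])
    have "(\<integral>x. \<eta> x \<partial>lborel) = 0"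
      using int(2)[OF \<psi> g] int(2)[OF \<rho>(1) g] \<rho>(2) by (simp add: \<eta>_def k_def)
    then obtain \<phi> where \<phi>: "test_function \<phi>" "deriv \<phi> = \<eta>"
      using test_function_antiderivative[OF \<eta>] by blast
    have "0 = (\<integral>x. of_real (\<eta> x) * g x \<partial>lborel)" using zero[OF \<phi>(1)] by (simp add: \<phi>(2))
    also have "\<dots> = (\<integral>x. of_real (\<psi> x) * g x - of_real k * (of_real (\<rho> x) * g x) \<partial>lborel)"
      by (simp add: \<eta>_def left_diff_distrib mult.assoc)
    also have "\<dots> = (\<integral>x. of_real (\<psi> x) * g x \<partial>lborel) - of_real k * c"
      using int(1)[OF \<psi> g] int(1)[OF \<rho>(1) g] by (simp add: c_def)
    also have "of_real k * c = (\<integral>x. of_real (\<psi> x) * c \<partial>lborel)"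
      using int(2)[OF \<psi> g] by (simp add: k_def)
    also have "(\<integral>x. of_real (\<psi> x) * g x \<partial>lborel) - (\<integral>x. of_real (\<psi> x) * c \<partial>lborel) = (\<integral>x. of_real (\<psi> x) * (g x - c) \<partial>lborel)"
      using int(1)[OF \<psi> g] int(1)[OF \<psi> lc] by (simp add: right_diff_distrib)
    finally show "(\<integral>x. of_real (\<psi> x) * (g x - c) \<partial>lborel) = 0" by simp
  qed
  then show ?thesis by auto
qed

lemma continuous_on_primitive:
  fixes \<alpha> :: "real \<Rightarrow> 'b::euclidean_space"
  assumes \<alpha>: "locally_integrable \<alpha>"
  shows "continuous_on UNIV (primitive \<alpha>)"
proof (rule continuous_at_imp_continuous_on, intro ballI)
  fix x :: real
  define N where "N = \<bar>x\<bar> + 1"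
  define k where "k = (\<integral>t. indicator {-N..0} t *\<^sub>R \<alpha> t \<partial>lborel)"
  have si: "set_integrable lborel {a..b} \<alpha>" for a b
    using locally_integrable_Icc[OF \<alpha>] by (simp add: set_integrable_def)
  have "continuous_on {-N..N} (\<lambda>y. integral {-N..y} \<alpha>)"
    by (rule indefinite_integral_continuous_1) (rule set_borel_integral_eq_integral(1)[OF si])
  then have c: "continuous_on {-N<..<N} (\<lambda>y. integral {-N..y} \<alpha> - k)"
    by (intro continuous_on_diff continuous_on_const) (auto elim: continuous_on_subset)
  have "primitive \<alpha> y = integral {-N..y} \<alpha> - k" if "y \<in> {-N<..<N}" for y
    using primitive_eq[OF \<alpha>, of N y] that set_borel_integral_eq_integral(2)[OF si, of "-N" y]
    by (simp add: k_def set_lebesgue_integral_def)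
  then have "continuous_on {-N<..<N} (primitive \<alpha>)" by (intro continuous_on_eq[OF c]) simp
  then show "isCont (primitive \<alpha>) x"
    by (rule continuous_on_interior) (auto simp: N_def)
qed

text \<open>A relation between functions rather than classes, so that it also applies to primitives
  and other factors that need not be square-integrable.\<close>

definition weak_deriv :: "(real \<Rightarrow> complex) \<Rightarrow> (real \<Rightarrow> complex) \<Rightarrow> bool" where
  "weak_deriv g h \<longleftrightarrow> (\<forall>\<phi>. test_function \<phi> \<longrightarrow>
     (\<integral>x. of_real (deriv \<phi> x) * g x \<partial>lborel) = - (\<integral>x. of_real (\<phi> x) * h x \<partial>lborel))"

lemma integrable_test_function_mult:
  fixes g :: "real \<Rightarrow> complex"
  assumes \<phi>: "test_function \<phi>" and g: "locally_integrable g"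
  shows "integrable lborel (\<lambda>x. of_real (\<phi> x) * g x)" "integrable lborel (\<lambda>x. of_real (deriv \<phi> x) * g x)"
proof -
  obtain N where N: "\<And>x. \<bar>x\<bar> > N \<Longrightarrow> \<phi> x = 0" "\<And>x. \<bar>x\<bar> > N \<Longrightarrow> deriv \<phi> x = 0"
    using test_function_support[OF \<phi>] by metis
  show "integrable lborel (\<lambda>x. of_real (\<phi> x) * g x)"
    by (intro locally_integrable_mult_compact[OF g, of _ N] continuous_intros test_function_continuous[OF \<phi>]) (simp add: N)
  show "integrable lborel (\<lambda>x. of_real (deriv \<phi> x) * g x)"
    by (intro locally_integrable_mult_compact[OF g, of _ N] continuous_intros test_function_derivative(2)[OF \<phi>]) (simp add: N)
qed

lemma locally_integrable_add:
  "locally_integrable f \<Longrightarrow> locally_integrable g \<Longrightarrow> locally_integrable (\<lambda>x. f x + g x)"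
  by (auto simp: locally_integrable_def scaleR_add_right intro: Bochner_Integration.integrable_add)

lemma locally_integrable_diff:
  "locally_integrable f \<Longrightarrow> locally_integrable g \<Longrightarrow> locally_integrable (\<lambda>x. f x - g x)"
  by (auto simp: locally_integrable_def scaleR_diff_right intro: Bochner_Integration.integrable_diff)

lemma weak_deriv_unique:
  assumes "weak_deriv g h" "weak_deriv g h'" and h: "locally_integrable h" "locally_integrable h'"
  shows "AE x in lborel. h x = h' x"
proof -
  have "AE x in lborel. h x - h' x = 0"
  proof (rule fundamental_lemma[OF locally_integrable_diff[OF h]])
    fix \<phi> assume \<phi>: "test_function \<phi>"
    have "(\<integral>x. of_real (\<phi> x) * h x \<partial>lborel) = (\<integral>x. of_real (\<phi> x) * h' x \<partial>lborel)"
      using assms(1)[unfolded weak_deriv_def, rule_format, OF \<phi>] assms(2)[unfolded weak_deriv_def, rule_format, OF \<phi>]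
      by simp
    then show "(\<integral>x. of_real (\<phi> x) * (h x - h' x) \<partial>lborel) = 0"
      using integrable_test_function_mult(1)[OF \<phi> h(1)] integrable_test_function_mult(1)[OF \<phi> h(2)]
      by (simp add: right_diff_distrib)
  qed
  then show ?thesis by simp
qed

lemma weak_deriv_cong_AE:
  assumes "weak_deriv g h" "AE x in lborel. g x = g' x" "AE x in lborel. h x = h' x"
    and [measurable]: "g \<in> borel_measurable borel" "g' \<in> borel_measurable borel" "h \<in> borel_measurable borel" "h' \<in> borel_measurable borel"
  shows "weak_deriv g' h'"
  unfolding weak_deriv_def
proof (intro allI impI)
  fix \<phi> assume \<phi>: "test_function \<phi>"
  have [measurable]: "\<phi> \<in> borel_measurable borel" "deriv \<phi> \<in> borel_measurable borel"
    using test_function_continuous[OF \<phi>] test_function_derivative(2)[OF \<phi>] by (auto intro: borel_measurable_continuous_onI)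
  have "(\<integral>x. of_real (deriv \<phi> x) * g' x \<partial>lborel) = (\<integral>x. of_real (deriv \<phi> x) * g x \<partial>lborel)"
    using assms(2) by (intro integral_cong_AE) auto
  also have "\<dots> = - (\<integral>x. of_real (\<phi> x) * h x \<partial>lborel)" using assms(1) \<phi> by (simp add: weak_deriv_def)
  also have "(\<integral>x. of_real (\<phi> x) * h x \<partial>lborel) = (\<integral>x. of_real (\<phi> x) * h' x \<partial>lborel)"
    using assms(3) by (intro integral_cong_AE) auto
  finally show "(\<integral>x. of_real (deriv \<phi> x) * g' x \<partial>lborel) = - (\<integral>x. of_real (\<phi> x) * h' x \<partial>lborel)" .
qed

lemma weak_deriv_diff:
  assumes "weak_deriv g h" "weak_deriv g' h'" "locally_integrable g" "locally_integrable g'"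
    "locally_integrable h" "locally_integrable h'"
  shows "weak_deriv (\<lambda>x. g x - g' x) (\<lambda>x. h x - h' x)"
  unfolding weak_deriv_def
proof (intro allI impI)
  fix \<phi> assume \<phi>: "test_function \<phi>"
  note i = integrable_test_function_mult[OF \<phi> assms(3)] integrable_test_function_mult[OF \<phi> assms(4)]
    integrable_test_function_mult[OF \<phi> assms(5)] integrable_test_function_mult[OF \<phi> assms(6)]
  have w: "(\<integral>x. of_real (deriv \<phi> x) * g x \<partial>lborel) = - (\<integral>x. of_real (\<phi> x) * h x \<partial>lborel)"
    "(\<integral>x. of_real (deriv \<phi> x) * g' x \<partial>lborel) = - (\<integral>x. of_real (\<phi> x) * h' x \<partial>lborel)"
    using assms(1,2) \<phi> by (auto simp: weak_deriv_def)
  show "(\<integral>x. of_real (deriv \<phi> x) * (g x - g' x) \<partial>lborel) = - (\<integral>x. of_real (\<phi> x) * (h x - h' x) \<partial>lborel)"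
    unfolding right_diff_distrib Bochner_Integration.integral_diff[OF i(2) i(4)] Bochner_Integration.integral_diff[OF i(5) i(7)] w by simp
qed

lemma locally_integrable_continuous_mult:
  fixes g :: "real \<Rightarrow> complex"
  assumes g: "locally_integrable g" and p: "continuous_on UNIV p"
  shows "locally_integrable (\<lambda>x. p x * g x)"
  unfolding locally_integrable_def
proof (intro conjI allI)
  have [measurable]: "g \<in> borel_measurable borel" "p \<in> borel_measurable borel"
    using g borel_measurable_continuous_onI[OF p] by (auto simp: locally_integrable_def)
  show "(\<lambda>x. p x * g x) \<in> borel_measurable lborel" by measurable
  fix N
  have "bounded (p ` {-N..N})"
    by (intro compact_imp_bounded compact_continuous_image continuous_on_subset[OF p]) auto
  then obtain C where C: "\<And>x. x \<in> {-N..N} \<Longrightarrow> norm (p x) \<le> C" by (force simp: bounded_iff)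
  show "integrable lborel (\<lambda>x. indicator {- N..N} x *\<^sub>R (p x * g x))"
  proof (rule Bochner_Integration.integrable_bound)
    show "integrable lborel (\<lambda>x. C *\<^sub>R (indicator {-N..N} x *\<^sub>R g x))"
      using g by (intro integrable_scaleR_right) (simp add: locally_integrable_def)
    have "norm (p x * g x) \<le> \<bar>C\<bar> * norm (g x)" if "x \<in> {-N..N}" for x
      unfolding norm_mult using C[OF that] by (intro mult_right_mono) auto
    then show "AE x in lborel. norm (indicator {- N..N} x *\<^sub>R (p x * g x)) \<le> norm (C *\<^sub>R (indicator {-N..N} x *\<^sub>R g x))"
      by (intro AE_I2) (auto simp: indicator_def)
  qed measurable
qed

text \<open>The product rule in the form required by variation of constants: \<open>p\<close> is a
  component of a solution and the bracket is its coefficient. The test function is absorbed into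
  \<open>p\<close>, which leaves only the weak derivative of a primitive.\<close>

lemma weak_deriv_mult_primitive:
  fixes p p' \<alpha> :: "real \<Rightarrow> complex"
  assumes \<alpha>: "locally_integrable \<alpha>"
    and p: "\<And>x. (p has_vector_derivative p' x) (at x)" and p': "continuous_on UNIV p'"
  shows "weak_deriv (\<lambda>x. p x * (primitive \<alpha> x + c)) (\<lambda>x. p' x * (primitive \<alpha> x + c) + p x * \<alpha> x)"
  unfolding weak_deriv_def
proof (intro allI impI)
  fix \<phi> assume \<phi>: "test_function \<phi>"
  obtain N where N: "\<And>x. \<bar>x\<bar> > N \<Longrightarrow> \<phi> x = 0" "\<And>x. \<bar>x\<bar> > N \<Longrightarrow> deriv \<phi> x = 0"
    using test_function_support[OF \<phi>] by metis
  have pc: "continuous_on UNIV p"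
    using p by (auto intro!: continuous_at_imp_continuous_on has_vector_derivative_continuous)
  define \<Psi> where "\<Psi> x = of_real (\<phi> x) * p x" for x
  define \<Psi>' where "\<Psi>' x = of_real (\<phi> x) * p' x + of_real (deriv \<phi> x) * p x" for x
  have d: "(\<Psi> has_vector_derivative \<Psi>' x) (at x)" for x
    unfolding \<Psi>_def[abs_def] \<Psi>'_def
    by (intro has_vector_derivative_mult has_vector_derivative_of_real p)
      (use test_function_derivative(1)[OF \<phi>] in \<open>simp add: has_real_derivative_iff_has_vector_derivative\<close>)
  have c\<Psi>': "continuous_on UNIV \<Psi>'"
    unfolding \<Psi>'_def[abs_def] by (intro continuous_intros pc p' test_function_continuous[OF \<phi>] test_function_derivative(2)[OF \<phi>])
  have supp: "\<bar>x\<bar> > N \<Longrightarrow> \<Psi> x = 0" "\<bar>x\<bar> > N \<Longrightarrow> \<Psi>' x = 0" for x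
    using N by (simp_all add: \<Psi>_def \<Psi>'_def)
  note pw = primitive_weak_derivative[OF \<alpha> d c\<Psi>' supp]
  have i\<Psi>': "integrable lborel \<Psi>'" by (rule integrable_compact_support[OF c\<Psi>' supp(2)])
  have z: "(\<integral>x. \<Psi>' x \<partial>lborel) = 0"
  proof -
    have "(\<integral>x. \<Psi>' x \<partial>lborel) = (\<integral>x. indicator {- \<bar>N\<bar> - 1..} x *\<^sub>R \<Psi>' x \<partial>lborel)"
      using supp(2) by (intro Bochner_Integration.integral_cong) (auto simp: indicator_def not_le)
    also have "\<dots> = - \<Psi> (- \<bar>N\<bar> - 1)" by (rule integral_derivative_ray[OF d c\<Psi>' supp])
    also have "\<dots> = 0" using supp(1)[of "- \<bar>N\<bar> - 1"] by simp
    finally show ?thesis .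
  qed
  have lq: "locally_integrable (\<lambda>x. primitive \<alpha> x + c)"
    by (intro locally_integrable_continuous continuous_intros continuous_on_primitive \<alpha>)
  have ia: "integrable lborel (\<lambda>x. \<Psi>' x * (primitive \<alpha> x + c))"
    using pw(1) i\<Psi>' by (simp add: distrib_left)
  have ib: "integrable lborel (\<lambda>x. of_real (\<phi> x) * (p' x * (primitive \<alpha> x + c)))"
    by (intro integrable_test_function_mult(1)[OF \<phi>] locally_integrable_continuous_mult lq p')
  have ic: "integrable lborel (\<lambda>x. of_real (\<phi> x) * (p x * \<alpha> x))"
    by (intro integrable_test_function_mult(1)[OF \<phi>] locally_integrable_continuous_mult \<alpha> pc)
  have "(\<integral>x. of_real (deriv \<phi> x) * (p x * (primitive \<alpha> x + c)) \<partial>lborel)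
      = (\<integral>x. \<Psi>' x * (primitive \<alpha> x + c) - of_real (\<phi> x) * (p' x * (primitive \<alpha> x + c)) \<partial>lborel)"
    by (rule Bochner_Integration.integral_cong) (auto simp: \<Psi>'_def algebra_simps)
  also have "\<dots> = (\<integral>x. \<Psi>' x * (primitive \<alpha> x + c) \<partial>lborel) - (\<integral>x. of_real (\<phi> x) * (p' x * (primitive \<alpha> x + c)) \<partial>lborel)"
    by (rule Bochner_Integration.integral_diff[OF ia ib])
  also have "(\<integral>x. \<Psi>' x * (primitive \<alpha> x + c) \<partial>lborel) = - (\<integral>x. \<Psi> x * \<alpha> x \<partial>lborel)"
    using pw i\<Psi>' z by (simp add: distrib_left)
  also have "(\<integral>x. \<Psi> x * \<alpha> x \<partial>lborel) = (\<integral>x. of_real (\<phi> x) * (p x * \<alpha> x) \<partial>lborel)"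
    by (simp add: \<Psi>_def mult.assoc)
  also have "- (\<integral>x. of_real (\<phi> x) * (p x * \<alpha> x) \<partial>lborel) - (\<integral>x. of_real (\<phi> x) * (p' x * (primitive \<alpha> x + c)) \<partial>lborel)
      = - ((\<integral>x. of_real (\<phi> x) * (p' x * (primitive \<alpha> x + c)) \<partial>lborel) + (\<integral>x. of_real (\<phi> x) * (p x * \<alpha> x) \<partial>lborel))"
    by simp
  also have "(\<integral>x. of_real (\<phi> x) * (p' x * (primitive \<alpha> x + c)) \<partial>lborel) + (\<integral>x. of_real (\<phi> x) * (p x * \<alpha> x) \<partial>lborel)
      = (\<integral>x. of_real (\<phi> x) * (p' x * (primitive \<alpha> x + c) + p x * \<alpha> x) \<partial>lborel)"
    using Bochner_Integration.integral_add[OF ib ic] by (simp add: distrib_left)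
  finally show "(\<integral>x. of_real (deriv \<phi> x) * (p x * (primitive \<alpha> x + c)) \<partial>lborel)
      = - (\<integral>x. of_real (\<phi> x) * (p' x * (primitive \<alpha> x + c) + p x * \<alpha> x) \<partial>lborel)" .
qed

text \<open>\<open>g - primitive h\<close> has weak derivative zero and is therefore constant. This
  supplies continuous representatives of weak solutions.\<close>

lemma weak_deriv_imp_primitive:
  assumes "weak_deriv g h" and g: "locally_integrable g" and h: "locally_integrable h"
  shows "\<exists>c. AE x in lborel. g x = primitive h x + c"
proof -
  have lp: "locally_integrable (primitive h)"
    by (intro locally_integrable_continuous continuous_on_primitive h)
  have w: "weak_deriv (primitive h) h"
    using weak_deriv_mult_primitive[OF h, of "\<lambda>x. 1" "\<lambda>x. 0" 0] by simp
  have "\<exists>c. AE x in lborel. g x - primitive h x = c"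
  proof (rule du_Bois_Reymond[OF locally_integrable_diff[OF g lp]])
    fix \<phi> assume \<phi>: "test_function \<phi>"
    show "(\<integral>x. of_real (deriv \<phi> x) * (g x - primitive h x) \<partial>lborel) = 0"
      using assms(1) w \<phi> integrable_test_function_mult(2)[OF \<phi> g] integrable_test_function_mult(2)[OF \<phi> lp]
      by (simp add: weak_deriv_def right_diff_distrib)
  qed
  then show ?thesis by (auto simp: algebra_simps)
qed

section \<open>Passage between functions and classes\<close>

lemma square_integrable_rep_L2: "square_integrable (rep_L2 u)"
  using Quotient_rep_reflp[OF Quotient_L2, of u] by (simp add: L2_eq_def)

lemma rep_abs_L2: "square_integrable f \<Longrightarrow> AE x in lborel. rep_L2 (abs_L2 f) x = f x"
  using Quotient_rep_abs[OF Quotient_L2, of f] by (simp add: L2_eq_def)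

lemma L2_eq_iff: "u = v \<longleftrightarrow> (AE x in lborel. rep_L2 u x = rep_L2 v x)"
  using Quotient_rel_rep[OF Quotient_L2, of u v] by (simp add: L2_eq_def square_integrable_rep_L2)

lemma abs_rep_L2: "abs_L2 (rep_L2 u) = u"
  by (rule Quotient_abs_rep[OF Quotient_L2])

lemma norm_abs_L2: "square_integrable f \<Longrightarrow> norm (abs_L2 f) = sqrt (\<integral>x. (norm (f x))\<^sup>2 \<partial>lborel)"
  by (simp add: norm_L2.abs_eq L2_eq_def)

lemma abs_L2_add: "square_integrable f \<Longrightarrow> square_integrable g \<Longrightarrow> abs_L2 (\<lambda>x. f x + g x) = abs_L2 f + abs_L2 g"
  by (simp add: plus_L2.abs_eq L2_eq_def)

lemma abs_L2_diff: "square_integrable f \<Longrightarrow> square_integrable g \<Longrightarrow> abs_L2 (\<lambda>x. f x - g x) = abs_L2 f - abs_L2 g"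
  by (simp add: minus_L2.abs_eq L2_eq_def)

lemma abs_L2_scaleR: "square_integrable f \<Longrightarrow> abs_L2 (\<lambda>x. c *\<^sub>R f x) = c *\<^sub>R abs_L2 f"
  by (simp add: scaleR_L2.abs_eq L2_eq_def)

lemma rep_L2_add: "AE x in lborel. rep_L2 (u + v) x = rep_L2 u x + rep_L2 v x"
  using rep_abs_L2[OF square_integrable_add[OF square_integrable_rep_L2 square_integrable_rep_L2], of u v]
  by (simp add: abs_L2_add square_integrable_rep_L2 abs_rep_L2)

lemma rep_L2_diff: "AE x in lborel. rep_L2 (u - v) x = rep_L2 u x - rep_L2 v x"
  using rep_abs_L2[OF square_integrable_diff[OF square_integrable_rep_L2 square_integrable_rep_L2], of u v]
  by (simp add: abs_L2_diff square_integrable_rep_L2 abs_rep_L2)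

lemma rep_L2_scaleR: "AE x in lborel. rep_L2 (c *\<^sub>R u) x = c *\<^sub>R rep_L2 u x"
  using rep_abs_L2[OF square_integrable_scaleR[OF square_integrable_rep_L2], of c u]
  by (simp add: abs_L2_scaleR square_integrable_rep_L2 abs_rep_L2)

lemma borel_measurable_vec_nth_complex [measurable (raw)]:
  "f \<in> borel_measurable M \<Longrightarrow> (\<lambda>x. (f x :: complex^2) $ i) \<in> borel_measurable M"
  by (rule borel_measurable_continuous_on[OF _ ]) (auto intro: continuous_intros)

lemma square_integrable_locally_integrable:
  assumes "square_integrable f"
  shows "locally_integrable f"
  unfolding locally_integrable_def
proof (intro conjI allI)
  have [measurable]: "f \<in> borel_measurable borel" using assms by (simp add: square_integrable_def)
  show "f \<in> borel_measurable lborel" by simp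
  fix N
  show "integrable lborel (\<lambda>x. indicator {- N..N} x *\<^sub>R f x)"
  proof (rule Bochner_Integration.integrable_bound)
    show "integrable lborel (\<lambda>x. indicator {- N..N} x + (norm (f x))\<^sup>2)"
      using assms by (intro Bochner_Integration.integrable_add integrable_real_indicator)
        (auto simp: square_integrable_def emeasure_lborel_Icc_eq)
    have "norm (f x) \<le> 1 + (norm (f x))\<^sup>2" for x
      using sum_squares_bound[of "norm (f x)" 1] norm_ge_zero[of "f x"] by (simp del: norm_ge_zero)
    then show "AE x in lborel. norm (indicator {- N..N} x *\<^sub>R f x) \<le> norm (indicator {- N..N} x + (norm (f x))\<^sup>2)"
      by (intro AE_I2) (auto simp: indicator_def)
  qed measurable
qed

lemma locally_integrable_nth:
  assumes "locally_integrable (f :: real \<Rightarrow> complex^2)"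
  shows "locally_integrable (\<lambda>x. f x $ i)"
proof -
  have [measurable]: "f \<in> borel_measurable borel" using assms by (simp add: locally_integrable_def)
  have "integrable lborel (\<lambda>x. (indicator {- N..N} x *\<^sub>R f x) $ i)" for N
    using assms by (intro integrable_bounded_linear[OF bounded_linear_vec_nth]) (simp add: locally_integrable_def)
  then show ?thesis by (simp add: locally_integrable_def)
qed

lemmas rep_L2_locally_integrable = locally_integrable_nth[OF square_integrable_locally_integrable[OF square_integrable_rep_L2]]

lemma integrable_scaleR_square_integrable:
  fixes \<phi> :: "real \<Rightarrow> real"
  assumes f: "square_integrable f" and \<phi>: "continuous_on UNIV \<phi>" and supp: "\<And>x. \<bar>x\<bar> > N \<Longrightarrow> \<phi> x = 0"
  shows "integrable lborel (\<lambda>x. \<phi> x *\<^sub>R f x)"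
proof (rule Bochner_Integration.integrable_bound)
  have [measurable]: "f \<in> borel_measurable borel" "\<phi> \<in> borel_measurable borel"
    using f borel_measurable_continuous_onI[OF \<phi>] by (auto simp: square_integrable_def)
  have "integrable lborel (\<lambda>x. (\<phi> x)\<^sup>2)"
    by (rule integrable_compact_support[where N=N]) (auto intro!: continuous_intros \<phi> simp: supp)
  then show "integrable lborel (\<lambda>x. (\<phi> x)\<^sup>2 + (norm (f x))\<^sup>2)"
    using f by (intro Bochner_Integration.integrable_add) (auto simp: square_integrable_def)
  have "\<bar>\<phi> x\<bar> * norm (f x) \<le> (\<phi> x)\<^sup>2 + (norm (f x))\<^sup>2" for x
    using sum_squares_bound[of "\<bar>\<phi> x\<bar>" "norm (f x)"] mult_nonneg_nonneg[of "\<bar>\<phi> x\<bar>" "norm (f x)"]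
    unfolding power2_abs mult.assoc using abs_ge_zero[of "\<phi> x"] norm_ge_zero[of "f x"] by linarith
  then show "AE x in lborel. norm (\<phi> x *\<^sub>R f x) \<le> norm ((\<phi> x)\<^sup>2 + (norm (f x))\<^sup>2)"
    by (intro AE_I2) (auto intro: order_trans[OF _ abs_ge_self])
  show "(\<lambda>x. \<phi> x *\<^sub>R f x) \<in> borel_measurable lborel" by measurable
qed

text \<open>Taking a component is bounded linear and commutes with the Bochner integral; compact
  support of the test function provides the integrability.\<close>

lemma has_weak_derivative_iff:
  "has_weak_derivative u v \<longleftrightarrow> (\<forall>i. weak_deriv (\<lambda>x. rep_L2 u x $ i) (\<lambda>x. rep_L2 v x $ i))"
proof -
  have "(\<integral>x. deriv \<phi> x *\<^sub>R rep_L2 u x \<partial>lborel) = - (\<integral>x. \<phi> x *\<^sub>R rep_L2 v x \<partial>lborel) \<longleftrightarrow>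
    (\<forall>i. (\<integral>x. of_real (deriv \<phi> x) * rep_L2 u x $ i \<partial>lborel) = - (\<integral>x. of_real (\<phi> x) * rep_L2 v x $ i \<partial>lborel))"
    if \<phi>: "test_function \<phi>" for \<phi>
  proof -
    obtain N where N: "\<And>x. \<bar>x\<bar> > N \<Longrightarrow> \<phi> x = 0" "\<And>x. \<bar>x\<bar> > N \<Longrightarrow> deriv \<phi> x = 0"
      using test_function_support[OF \<phi>] by metis
    have i1: "integrable lborel (\<lambda>x. deriv \<phi> x *\<^sub>R rep_L2 u x)"
      by (rule integrable_scaleR_square_integrable[OF square_integrable_rep_L2 test_function_derivative(2)[OF \<phi>] N(2)])
    have i2: "integrable lborel (\<lambda>x. \<phi> x *\<^sub>R rep_L2 v x)"
      by (rule integrable_scaleR_square_integrable[OF square_integrable_rep_L2 test_function_continuous[OF \<phi>] N(1)])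
    have "(\<integral>x. deriv \<phi> x *\<^sub>R rep_L2 u x \<partial>lborel) $ i = (\<integral>x. of_real (deriv \<phi> x) * rep_L2 u x $ i \<partial>lborel)" for i
    proof -
      have "(\<lambda>x. (deriv \<phi> x *\<^sub>R rep_L2 u x) $ i) = (\<lambda>x. of_real (deriv \<phi> x) * rep_L2 u x $ i)"
        by (simp add: fun_eq_iff complex_eq_iff)
      then show ?thesis using integral_bounded_linear[OF bounded_linear_vec_nth i1, of i] by simp
    qed
    moreover have "(\<integral>x. \<phi> x *\<^sub>R rep_L2 v x \<partial>lborel) $ i = (\<integral>x. of_real (\<phi> x) * rep_L2 v x $ i \<partial>lborel)" for i
    proof -
      have "(\<lambda>x. (\<phi> x *\<^sub>R rep_L2 v x) $ i) = (\<lambda>x. of_real (\<phi> x) * rep_L2 v x $ i)"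
        by (simp add: fun_eq_iff complex_eq_iff)
      then show ?thesis using integral_bounded_linear[OF bounded_linear_vec_nth i2, of i] by simp
    qed
    ultimately show ?thesis by (simp add: vec_eq_iff)
  qed
  then show ?thesis
    unfolding has_weak_derivative_def weak_deriv_def by blast
qed

lemma has_weak_derivative_unique:
  assumes "has_weak_derivative u v" "has_weak_derivative u v'"
  shows "v = v'"
proof -
  have "AE x in lborel. rep_L2 v x $ i = rep_L2 v' x $ i" for i
    using assms by (intro weak_deriv_unique[of "\<lambda>x. rep_L2 u x $ i"] rep_L2_locally_integrable)
      (auto simp: has_weak_derivative_iff)
  from this[of 1] this[of 2] have "AE x in lborel. rep_L2 v x = rep_L2 v' x"
    by eventually_elim (simp add: vec_eq_iff forall_2)
  then show ?thesis by (simp add: L2_eq_iff)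
qed

lemma weak_derivative_eq: "has_weak_derivative u v \<Longrightarrow> weak_derivative u = v"
  unfolding weak_derivative_def by (rule the_equality) (auto dest: has_weak_derivative_unique)

lemma has_weak_derivative_abs_L2:
  assumes f: "square_integrable f" and g: "square_integrable g"
    and w: "\<And>i. weak_deriv (\<lambda>x. f x $ i) (\<lambda>x. g x $ i)"
  shows "has_weak_derivative (abs_L2 f) (abs_L2 g)"
  unfolding has_weak_derivative_iff
proof
  fix i
  have [measurable]: "f \<in> borel_measurable borel" "g \<in> borel_measurable borel"
    "rep_L2 (abs_L2 f) \<in> borel_measurable borel" "rep_L2 (abs_L2 g) \<in> borel_measurable borel"
    using f g square_integrable_rep_L2[of "abs_L2 f"] square_integrable_rep_L2[of "abs_L2 g"]
    by (simp_all add: square_integrable_def)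
  show "weak_deriv (\<lambda>x. rep_L2 (abs_L2 f) x $ i) (\<lambda>x. rep_L2 (abs_L2 g) x $ i)"
  proof (rule weak_deriv_cong_AE[OF w])
    show "AE x in lborel. f x $ i = rep_L2 (abs_L2 f) x $ i" using rep_abs_L2[OF f] by eventually_elim simp
    show "AE x in lborel. g x $ i = rep_L2 (abs_L2 g) x $ i" using rep_abs_L2[OF g] by eventually_elim simp
  qed measurable
qed

lemma has_weak_derivative_diff:
  assumes "has_weak_derivative u v" "has_weak_derivative u' v'"
  shows "has_weak_derivative (u - u') (v - v')"
proof -
  have e: "u - u' = abs_L2 (\<lambda>x. rep_L2 u x - rep_L2 u' x)" for u u'
    by (simp add: abs_L2_diff square_integrable_rep_L2 abs_rep_L2)
  show ?thesis
    unfolding e[of u] e[of v] using assms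
    by (intro has_weak_derivative_abs_L2 square_integrable_diff square_integrable_rep_L2)
      (simp add: has_weak_derivative_iff weak_deriv_diff rep_L2_locally_integrable)
qed

section \<open>The Green operator\<close>

text \<open>The factor \<open>1 + max |x| |t|\<close> serves to bound \<open>x u\<close> together with \<open>u\<close>.\<close>

definition schur_kernel :: "real \<Rightarrow> real \<Rightarrow> real" where
  "schur_kernel x t = (1 + max \<bar>x\<bar> \<bar>t\<bar>) * exp (- (\<bar>x\<^sup>2 - t\<^sup>2\<bar> / 2))"

lemma schur_kernel_sym: "schur_kernel x t = schur_kernel t x"
  by (simp add: schur_kernel_def max.commute abs_minus_commute)

lemma schur_kernel_nonneg: "schur_kernel x t \<ge> 0"
  by (simp add: schur_kernel_def)

lemma schur_kernel_measurable [measurable]: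
  "(\<lambda>p. schur_kernel (fst p) (snd p)) \<in> borel_measurable (borel \<Otimes>\<^sub>M borel)"
  unfolding schur_kernel_def[abs_def] by measurable

text \<open>With \<open>d = \<bar>\<bar>t\<bar> - \<bar>x\<bar>\<bar>\<close> one has
  \<open>\<bar>x\<^sup>2 - t\<^sup>2\<bar> = d * (\<bar>x\<bar> + \<bar>t\<bar>)\<close>, which
  dominates both \<open>d\<^sup>2\<close> and \<open>d * \<bar>x\<bar>\<close>. The weight is at
  most \<open>(1 + d) + \<bar>x\<bar>\<close>, and each summand is paired with one of the two
  exponentials.\<close>

lemma schur_kernel_le:
  defines "E \<equiv> \<lambda>s::real. exp (- (\<bar>s\<bar> / 4))"
  shows "schur_kernel x t \<le> 4 * E (\<bar>t\<bar> - \<bar>x\<bar>) + \<bar>x\<bar> * E (\<bar>x\<bar> * (\<bar>t\<bar> - \<bar>x\<bar>))"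
proof -
  define d where "d = \<bar>\<bar>t\<bar> - \<bar>x\<bar>\<bar>"
  define N where "N = max \<bar>x\<bar> \<bar>t\<bar>"
  have d: "d \<ge> 0" and N: "N \<le> \<bar>x\<bar> + d" "\<bar>x\<bar> \<le> N" by (auto simp: d_def N_def)
  have eq: "\<bar>x\<^sup>2 - t\<^sup>2\<bar> = d * (\<bar>x\<bar> + \<bar>t\<bar>)"
  proof -
    have "x\<^sup>2 - t\<^sup>2 = (\<bar>x\<bar> - \<bar>t\<bar>) * (\<bar>x\<bar> + \<bar>t\<bar>)" by (simp add: algebra_simps flip: power2_eq_square)
    then show ?thesis by (simp add: abs_mult d_def abs_minus_commute)
  qed
  have "d * d \<le> d * (\<bar>x\<bar> + \<bar>t\<bar>)" "d * N \<le> d * (\<bar>x\<bar> + \<bar>t\<bar>)"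
    by (intro mult_left_mono[OF _ d]; simp add: d_def N_def)+
  then have le1: "d\<^sup>2 / 2 \<le> \<bar>x\<^sup>2 - t\<^sup>2\<bar> / 2" and le2: "d * N / 2 \<le> \<bar>x\<^sup>2 - t\<^sup>2\<bar> / 2"
    unfolding eq power2_eq_square[of d] by auto
  have "(1 + d) * exp (- (d\<^sup>2 / 2)) \<le> 4 * exp (- (d / 4))"
  proof -
    have "(1 + d) * exp (- (d\<^sup>2 / 2)) \<le> exp d * exp (- (d\<^sup>2 / 2))"
      by (intro mult_right_mono) (simp_all add: exp_ge_add_one_self)
    also have "\<dots> = exp (- (d / 4)) * exp (5 / 4 * d - d\<^sup>2 / 2)" by (simp flip: exp_add)
    \<comment> \<open>The exponent is largest at \<open>d = 5 / 4\<close>, where it equals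
      \<open>25 / 32\<close>.\<close>
    also have "exp (5 / 4 * d - d\<^sup>2 / 2) \<le> exp 1"
    proof -
      have "0 \<le> (d - 5/4)\<^sup>2" by simp
      then show ?thesis by (simp add: power2_eq_square algebra_simps)
    qed
    also have "exp (1::real) \<le> 4" using exp_le by simp
    finally show ?thesis by (simp add: mult_left_mono)
  qed
  moreover have "(1 + d) * exp (- (\<bar>x\<^sup>2 - t\<^sup>2\<bar> / 2)) \<le> (1 + d) * exp (- (d\<^sup>2 / 2))"
    using le1 d by (intro mult_left_mono) auto
  moreover have "\<bar>x\<bar> * exp (- (\<bar>x\<^sup>2 - t\<^sup>2\<bar> / 2)) \<le> \<bar>x\<bar> * exp (- (\<bar>x\<bar> * d / 4))"
  proof (intro mult_left_mono)
    have "\<bar>x\<bar> * d \<le> d * N" using mult_left_mono[OF N(2) d] by (simp only: mult.commute)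
    moreover have "0 \<le> d * N" using d N by simp
    ultimately have "\<bar>x\<bar> * d / 4 \<le> \<bar>x\<^sup>2 - t\<^sup>2\<bar> / 2" using le2 by linarith
    then show "exp (- (\<bar>x\<^sup>2 - t\<^sup>2\<bar> / 2)) \<le> exp (- (\<bar>x\<bar> * d / 4))" by simp
  qed simp
  moreover have "schur_kernel x t \<le> (1 + d) * exp (- (\<bar>x\<^sup>2 - t\<^sup>2\<bar> / 2)) + \<bar>x\<bar> * exp (- (\<bar>x\<^sup>2 - t\<^sup>2\<bar> / 2))"
    unfolding schur_kernel_def N_def[symmetric] distrib_right[symmetric] using N by (intro mult_right_mono) auto
  ultimately show ?thesis
    by (simp add: E_def d_def abs_mult)
qed

lemma nn_integral_exp_abs_finite: "(\<integral>\<^sup>+s. ennreal (exp (- (\<bar>s\<bar> / 4))) \<partial>lborel) < \<infinity>"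
proof -
  have "integrable lborel (\<lambda>s::real. indicator {0<..} s * (s powr (1 - 1) * exp (- (1 / 4 * s))))"
    by (rule Gamma_kernel_integrable(1)) auto
  then have "integrable lborel (\<lambda>s::real. indicator {0..} s *\<^sub>R exp (- (\<bar>s\<bar> / 4)))"
    by (rule integrable_cong_AE_imp)
      (use AE_lborel_singleton[of 0] in \<open>auto elim!: eventually_mono simp: indicator_def\<close>)
  from has_bochner_integral_even_function[OF has_bochner_integral_integrable[OF this]]
  have "integrable lborel (\<lambda>s::real. exp (- (\<bar>s\<bar> / 4)))" by (auto intro: integrable.intros)
  then show ?thesis by (simp add: integrable_iff_bounded)
qed

text \<open>Uniformity in \<open>x\<close> holds because the substitution
  \<open>s = \<bar>x\<bar> * d\<close> consumes the prefactor \<open>\<bar>x\<bar>\<close> of the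
  second term. Each sign of \<open>t\<close> contributes \<open>4 + 1\<close> copies of the same
  integral; the added \<open>1\<close> makes the constant positive.\<close>

lemma schur_kernel_bound:
  obtains K where "K > 0" "\<And>x. (\<integral>\<^sup>+t. ennreal (schur_kernel x t) \<partial>lborel) \<le> ennreal K"
proof -
  define E where "E s = ennreal (exp (- (\<bar>s\<bar> / 4)))" for s :: real
  define I where "I = (\<integral>\<^sup>+s. E s \<partial>lborel)"
  have [measurable]: "E \<in> borel_measurable borel" unfolding E_def[abs_def] by measurable
  have I: "I < \<infinity>" using nn_integral_exp_abs_finite by (simp add: I_def E_def)
  define G where "G x d = 4 * E d + ennreal \<bar>x\<bar> * E (0 + \<bar>x\<bar> * d)" for x d
  have [measurable]: "G x \<in> borel_measurable borel" for x unfolding G_def[abs_def] by measurable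
  have G: "(\<integral>\<^sup>+d. G x d \<partial>lborel) \<le> 5 * I" for x
  proof -
    have "(\<integral>\<^sup>+d. G x d \<partial>lborel) = 4 * I + ennreal \<bar>x\<bar> * (\<integral>\<^sup>+d. E (0 + \<bar>x\<bar> * d) \<partial>lborel)"
      unfolding G_def I_def by (subst nn_integral_add) (auto simp: nn_integral_cmult)
    also have "ennreal \<bar>x\<bar> * (\<integral>\<^sup>+d. E (0 + \<bar>x\<bar> * d) \<partial>lborel) \<le> I"
      using nn_integral_real_affine[of E "\<bar>x\<bar>" 0] by (cases "x = 0") (auto simp: I_def)
    finally show ?thesis by (simp add: distrib_right[of 4 1 I, symmetric, simplified] add_left_mono)
  qed
  have "(\<integral>\<^sup>+t. ennreal (schur_kernel x t) \<partial>lborel) \<le> 10 * I" for x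
  proof -
    have "(\<integral>\<^sup>+t. ennreal (schur_kernel x t) \<partial>lborel) \<le> (\<integral>\<^sup>+t. G x (- \<bar>x\<bar> + 1 * t) + G x (- \<bar>x\<bar> + (-1) * t) \<partial>lborel)"
    proof (rule nn_integral_mono)
      fix t
      have "ennreal (schur_kernel x t) \<le> G x (\<bar>t\<bar> - \<bar>x\<bar>)"
        using schur_kernel_le[of x t]
        by (simp add: G_def E_def ennreal_leI flip: ennreal_mult ennreal_plus ennreal_numeral)
      also have "\<dots> \<le> G x (- \<bar>x\<bar> + 1 * t) + G x (- \<bar>x\<bar> + (-1) * t)"
        by (cases "t \<ge> 0") (auto simp: algebra_simps intro: add_increasing add_increasing2)
      finally show "ennreal (schur_kernel x t) \<le> G x (- \<bar>x\<bar> + 1 * t) + G x (- \<bar>x\<bar> + (-1) * t)" .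
    qed
    also have "\<dots> = (\<integral>\<^sup>+t. G x (- \<bar>x\<bar> + 1 * t) \<partial>lborel) + (\<integral>\<^sup>+t. G x (- \<bar>x\<bar> + (-1) * t) \<partial>lborel)"
      by (rule nn_integral_add) auto
    also have "(\<integral>\<^sup>+t. G x (- \<bar>x\<bar> + 1 * t) \<partial>lborel) = (\<integral>\<^sup>+d. G x d \<partial>lborel)"
      using nn_integral_real_affine[of "G x" 1 "- \<bar>x\<bar>"] by simp
    also have "(\<integral>\<^sup>+t. G x (- \<bar>x\<bar> + (-1) * t) \<partial>lborel) = (\<integral>\<^sup>+d. G x d \<partial>lborel)"
      using nn_integral_real_affine[of "G x" "-1" "- \<bar>x\<bar>"] by simp
    also have "(\<integral>\<^sup>+d. G x d \<partial>lborel) + (\<integral>\<^sup>+d. G x d \<partial>lborel) \<le> 5 * I + 5 * I"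
      by (intro add_mono G)
    also have "\<dots> = 10 * I" by (simp flip: distrib_right)
    finally show ?thesis .
  qed
  moreover have "10 * I \<le> ennreal (10 * enn2real I + 1)"
  proof -
    have "10 * I = ennreal (10 * enn2real I)"
      using I by (simp add: ennreal_mult flip: ennreal_numeral)
    then show ?thesis by (simp add: ennreal_leI)
  qed
  ultimately show ?thesis
    by (intro that[of "10 * enn2real I + 1"]) (auto intro: order_trans simp: add_nonneg_pos)
qed

text \<open>Cauchy-Schwarz with the kernel split into two square roots, and Tonelli. By symmetry the
  row bound also bounds the columns.\<close>

lemma schur_test:
  fixes F :: "real \<Rightarrow> real"
  assumes K: "\<And>x. (\<integral>\<^sup>+t. ennreal (schur_kernel x t) \<partial>lborel) \<le> ennreal K"
    and [measurable]: "F \<in> borel_measurable borel" and F: "\<And>t. F t \<ge> 0"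
  shows "(\<integral>\<^sup>+x. (\<integral>\<^sup>+t. ennreal (schur_kernel x t * F t) \<partial>lborel)\<^sup>2 \<partial>lborel) \<le> (ennreal K)\<^sup>2 * (\<integral>\<^sup>+t. ennreal ((F t)\<^sup>2) \<partial>lborel)"
proof -
  note [simp] = schur_kernel_nonneg F
  have [measurable]: "schur_kernel x \<in> borel_measurable borel" for x
    unfolding schur_kernel_def[abs_def] by measurable
  have cs: "(\<integral>\<^sup>+t. ennreal (schur_kernel x t * F t) \<partial>lborel)\<^sup>2 \<le> ennreal K * (\<integral>\<^sup>+t. ennreal (schur_kernel x t * (F t)\<^sup>2) \<partial>lborel)" for x
  proof -
    have "(\<integral>\<^sup>+t. ennreal (schur_kernel x t * F t) \<partial>lborel) =
      (\<integral>\<^sup>+t. ennreal (sqrt (schur_kernel x t)) * ennreal (sqrt (schur_kernel x t) * F t) \<partial>lborel)"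
      by (intro nn_integral_cong) (simp flip: ennreal_mult mult.assoc)
    also have "\<dots>\<^sup>2 \<le> (\<integral>\<^sup>+t. (ennreal (sqrt (schur_kernel x t)))\<^sup>2 \<partial>lborel) * (\<integral>\<^sup>+t. (ennreal (sqrt (schur_kernel x t) * F t))\<^sup>2 \<partial>lborel)"
      by (rule Cauchy_Schwarz_nn_integral) auto
    also have "(\<integral>\<^sup>+t. (ennreal (sqrt (schur_kernel x t)))\<^sup>2 \<partial>lborel) = (\<integral>\<^sup>+t. ennreal (schur_kernel x t) \<partial>lborel)"
      by (intro nn_integral_cong) (simp add: ennreal_power)
    also have "(\<integral>\<^sup>+t. (ennreal (sqrt (schur_kernel x t) * F t))\<^sup>2 \<partial>lborel) = (\<integral>\<^sup>+t. ennreal (schur_kernel x t * (F t)\<^sup>2) \<partial>lborel)"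
      by (intro nn_integral_cong) (simp add: ennreal_power power_mult_distrib)
    finally show ?thesis by (rule order_trans) (intro mult_right_mono K, simp)
  qed
  have "(\<integral>\<^sup>+x. (\<integral>\<^sup>+t. ennreal (schur_kernel x t * F t) \<partial>lborel)\<^sup>2 \<partial>lborel)
      \<le> (\<integral>\<^sup>+x. ennreal K * (\<integral>\<^sup>+t. ennreal (schur_kernel x t * (F t)\<^sup>2) \<partial>lborel) \<partial>lborel)"
    by (intro nn_integral_mono cs)
  also have "\<dots> = ennreal K * (\<integral>\<^sup>+x. (\<integral>\<^sup>+t. ennreal (schur_kernel x t * (F t)\<^sup>2) \<partial>lborel) \<partial>lborel)"
    by (rule nn_integral_cmult) (auto intro!: lborel.borel_measurable_nn_integral simp: split_beta')
  also have "\<dots> \<le> ennreal K * ((\<integral>\<^sup>+t. ennreal ((F t)\<^sup>2) \<partial>lborel) * ennreal K)"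
  proof (rule mult_left_mono)
    have "(\<integral>\<^sup>+x. (\<integral>\<^sup>+t. ennreal (schur_kernel x t * (F t)\<^sup>2) \<partial>lborel) \<partial>lborel)
        = (\<integral>\<^sup>+t. (\<integral>\<^sup>+x. ennreal (schur_kernel x t * (F t)\<^sup>2) \<partial>lborel) \<partial>lborel)"
      by (rule lborel_pair.Fubini'[symmetric]) (simp add: split_beta')
    also have "\<dots> = (\<integral>\<^sup>+t. ennreal ((F t)\<^sup>2) * (\<integral>\<^sup>+x. ennreal (schur_kernel t x) \<partial>lborel) \<partial>lborel)"
      by (intro nn_integral_cong, subst nn_integral_cmult[symmetric])
        (auto simp: schur_kernel_sym[of _ t for t] mult.commute simp flip: ennreal_mult)
    also have "\<dots> \<le> (\<integral>\<^sup>+t. ennreal ((F t)\<^sup>2) * ennreal K \<partial>lborel)"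
      by (intro nn_integral_mono mult_left_mono K) auto
    also have "\<dots> = (\<integral>\<^sup>+t. ennreal ((F t)\<^sup>2) \<partial>lborel) * ennreal K"
      by (rule nn_integral_multc) auto
    finally show "(\<integral>\<^sup>+x. (\<integral>\<^sup>+t. ennreal (schur_kernel x t * (F t)\<^sup>2) \<partial>lborel) \<partial>lborel) \<le> \<dots>" .
  qed simp
  finally show ?thesis by (simp add: power2_eq_square mult_ac)
qed

lemma integrable_mult_square:
  fixes F G :: "real \<Rightarrow> real"
  assumes [measurable]: "F \<in> borel_measurable borel" "G \<in> borel_measurable borel"
    and "integrable lborel (\<lambda>x. (F x)\<^sup>2)" "integrable lborel (\<lambda>x. (G x)\<^sup>2)"
  shows "integrable lborel (\<lambda>x. F x * G x)"
proof (rule Bochner_Integration.integrable_bound[OF Bochner_Integration.integrable_add[OF assms(3,4)]])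
  have "\<bar>F x * G x\<bar> \<le> (F x)\<^sup>2 + (G x)\<^sup>2" for x
    using sum_squares_bound[of "\<bar>F x\<bar>" "\<bar>G x\<bar>"] abs_ge_zero[of "F x * G x"] unfolding abs_mult mult.assoc power2_abs by linarith
  then show "AE x in lborel. norm (F x * G x) \<le> norm ((F x)\<^sup>2 + (G x)\<^sup>2)"
    by (intro AE_I2) simp
qed measurable

section \<open>The Green kernel and its rank-one part\<close>

definition det2 :: "complex^2 \<Rightarrow> complex^2 \<Rightarrow> complex" where
  "det2 p q = p $ 1 * q $ 2 - p $ 2 * q $ 1"

text \<open>This is the determinant of \<open>p\<close> and \<open>\<sigma>\<^sub>1 f\<close>, the
  form in which the source \<open>\<i> \<sigma>\<^sub>1 f\<close> of the first-order system enters
  Cramer's rule. It is bilinear, without conjugation.\<close>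

definition pair2 :: "complex^2 \<Rightarrow> complex^2 \<Rightarrow> complex" where
  "pair2 f p = f $ 1 * p $ 1 - f $ 2 * p $ 2"

text \<open>The Cauchy-Schwarz inequality, via Lagrange's identity for the absolute values of the
  components.\<close>

lemma norm_pair2_le: "norm (pair2 f p) \<le> norm f * norm p"
proof -
  have "norm (pair2 f p) \<le> norm (f $ 1) * norm (p $ 1) + norm (f $ 2) * norm (p $ 2)"
    unfolding pair2_def using norm_triangle_ineq4 by (metis norm_mult)
  also have "\<dots> \<le> norm f * norm p"
  proof (rule power2_le_imp_le)
    have "(norm f * norm p)\<^sup>2 - (norm (f $ 1) * norm (p $ 1) + norm (f $ 2) * norm (p $ 2))\<^sup>2
      = (norm (f $ 1) * norm (p $ 2) - norm (f $ 2) * norm (p $ 1))\<^sup>2"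
      unfolding power_mult_distrib norm_complex_2 by (simp add: power2_eq_square algebra_simps)
    then show "(norm (f $ 1) * norm (p $ 1) + norm (f $ 2) * norm (p $ 2))\<^sup>2 \<le> (norm f * norm p)\<^sup>2"
      using zero_le_power2[of "norm (f $ 1) * norm (p $ 2) - norm (f $ 2) * norm (p $ 1)"] by linarith
  qed simp
  finally show ?thesis .
qed

lemma norm_vector_smult: "norm (c *s (v :: complex^2)) = norm c * norm v"
proof -
  have "(norm (c *s v))\<^sup>2 = (norm c * norm v)\<^sup>2"
    unfolding power_mult_distrib norm_complex_2 by (simp add: norm_mult power_mult_distrib distrib_left)
  then show ?thesis by (simp add: power2_eq_iff_nonneg)
qed

lemma borel_measurable_pair2 [measurable (raw)]:
  "f \<in> borel_measurable M \<Longrightarrow> g \<in> borel_measurable M \<Longrightarrow> (\<lambda>x. pair2 (f x) (g x)) \<in> borel_measurable M"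
  unfolding pair2_def by (intro borel_measurable_diff borel_measurable_times borel_measurable_vec_nth_complex)

lemma borel_measurable_vector_smult [measurable (raw)]:
  fixes v :: "'a \<Rightarrow> complex^2"
  assumes "c \<in> borel_measurable M" "v \<in> borel_measurable M"
  shows "(\<lambda>x. c x *s v x) \<in> borel_measurable M"
proof (rule borel_measurable_continuous_Pair[OF assms])
  show "continuous_on UNIV (\<lambda>x. fst x *s (snd x :: complex^2))"
    unfolding vector_scalar_mult_def by (intro continuous_intros)
qed

lemma square_integrable_bound:
  assumes "square_integrable f" "g \<in> borel_measurable borel" "\<And>x. norm (g x) \<le> C * norm (f x)"
  shows "square_integrable g"
  unfolding square_integrable_def
proof
  show "g \<in> borel_measurable lborel" using assms(2) by simp
  show "integrable lborel (\<lambda>x. (norm (g x))\<^sup>2)"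
  proof (rule Bochner_Integration.integrable_bound)
    show "integrable lborel (\<lambda>x. C\<^sup>2 * (norm (f x))\<^sup>2)" using assms(1) by (simp add: square_integrable_def)
    show "AE x in lborel. norm ((norm (g x))\<^sup>2) \<le> norm (C\<^sup>2 * (norm (f x))\<^sup>2)"
    proof (intro AE_I2)
      show "norm ((norm (g x))\<^sup>2) \<le> norm (C\<^sup>2 * (norm (f x))\<^sup>2)" for x
        using power_mono[OF assms(3)[of x] norm_ge_zero, of 2] by (simp add: power_mult_distrib)
    qed
  qed (use assms(2) in measurable)
qed

lemma gauss_weight_full: "integrable lborel (\<lambda>x::real. exp (- x\<^sup>2) * (1 + x\<^sup>2))"
proof -
  have "has_bochner_integral lborel (\<lambda>x::real. indicator {0..} x *\<^sub>R (exp (- x\<^sup>2) * (1 + x\<^sup>2))) (3 / 4 * sqrt pi)"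
    using has_bochner_integral_gauss_weight by simp
  from has_bochner_integral_even_function[OF this] show ?thesis by (auto intro: integrable.intros)
qed

lemma bounded_linear_smult: "bounded_linear (\<lambda>c. c *s (v :: complex^2))"
  by (rule bounded_linear_intro[where K="norm v"])
    (auto simp: vec_eq_iff algebra_simps norm_vector_smult)

context airy_line
begin

abbreviation "Q \<equiv> reflect P"

definition defect :: "real \<Rightarrow> complex^2" where "defect x = Q x - a *s P x"

lemma D_nonneg: "D \<ge> 0"
  using order_trans[OF norm_ge_zero decay[of 0]] by simp

lemma a_nz: "a \<noteq> 0"
  using norm_a by auto

lemma P_cont: "continuous_on UNIV P" and Q_cont: "continuous_on UNIV Q"
  using sol solves_dirac_reflect solves_dirac_continuous by blast+

lemma PQ_measurable [measurable]: "P \<in> borel_measurable borel" "Q \<in> borel_measurable borel"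
  using P_cont Q_cont by (auto intro: borel_measurable_continuous_onI)

lemma det_PQ: "det2 (P x) (Q x) = - \<i> * of_real W"
  using wronskian[of x] by (simp add: det2_def)

text \<open>Reflection with conjugation maps the defect to \<open>- cnj a\<close> times itself
  because \<open>a\<close> is unimodular. The bound on the right half-line thus serves the left one
  too.\<close>

lemma norm_defect_uminus: "norm (defect (- x)) = norm (defect x)"
proof -
  have aa: "cnj a * a = 1"
    using norm_a complex_norm_square[of a] by (simp add: mult.commute)
  have "defect (- x) $ i = cnj (- (cnj a * defect x $ i))" for i
  proof -
    have "- (cnj a * defect x $ i) = (cnj a * a) * P x $ i - cnj a * Q x $ i"
      by (simp add: defect_def algebra_simps)
    also have "cnj \<dots> = defect (- x) $ i" by (simp only: aa) (simp add: defect_def)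
    finally show ?thesis by simp
  qed
  then have "norm (defect (- x) $ i) = norm (defect x $ i)" for i
    using norm_a by (simp add: norm_mult)
  then show ?thesis by (simp add: norm_vec_def)
qed

lemma product_bound_defect:
  assumes "\<bar>y\<bar> \<le> \<bar>x\<bar>"
  shows "norm (P \<bar>x\<bar>) * norm (defect y) \<le> B * exp (- (\<bar>x\<^sup>2 - y\<^sup>2\<bar> / 2))"
proof -
  have "norm (defect y) = norm (defect \<bar>y\<bar>)" using norm_defect_uminus[of y] by (simp add: abs_if)
  moreover have "y\<^sup>2 \<le> x\<^sup>2" using assms by (simp add: abs_le_square_iff)
  ultimately show ?thesis
    using product_bound[of "\<bar>y\<bar>" "\<bar>x\<bar>"] assms by (simp add: defect_def)
qed

lemma B_nonneg: "B \<ge> 0"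
  using order_trans[OF mult_nonneg_nonneg[OF norm_ge_zero norm_ge_zero] product_bound_defect[of 0 0]] by simp

text \<open>The factor \<open>1 / a\<close> makes \<open>a glued(x) glued(t)\<close> the Green kernel exactly when \<open>x\<close> and \<open>t\<close> have
  opposite signs.\<close>

definition glued :: "real \<Rightarrow> complex^2" where
  "glued x = (if x \<ge> 0 then P x else (1 / a) *s Q x)"

lemma norm_glued: "norm (glued x) = norm (P \<bar>x\<bar>)"
  using norm_a by (auto simp: glued_def norm_vector_smult norm_divide)

lemma norm_glued_le: "norm (glued x) \<le> D * exp (- (x\<^sup>2 / 2))"
  using decay[of "\<bar>x\<bar>"] by (simp add: norm_glued)

lemma glued_measurable [measurable]: "glued \<in> borel_measurable borel"
  unfolding glued_def[abs_def] by measurable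

lemma weighted_glued_integrable: "integrable lborel (\<lambda>x. ((1 + \<bar>x\<bar>) * norm (glued x))\<^sup>2)"
proof (rule Bochner_Integration.integrable_bound)
  show "integrable lborel (\<lambda>x::real. 2 * D\<^sup>2 * (exp (- x\<^sup>2) * (1 + x\<^sup>2)))"
    by (intro integrable_mult_right gauss_weight_full)
  show "AE x in lborel. norm (((1 + \<bar>x\<bar>) * norm (glued x))\<^sup>2) \<le> norm (2 * D\<^sup>2 * (exp (- x\<^sup>2) * (1 + x\<^sup>2)))"
  proof (intro AE_I2)
    fix x :: real
    have "((1 + \<bar>x\<bar>) * norm (glued x))\<^sup>2 \<le> ((1 + \<bar>x\<bar>) * (D * exp (- (x\<^sup>2 / 2))))\<^sup>2"
      by (intro power_mono mult_left_mono norm_glued_le) auto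
    also have "\<dots> = (1 + \<bar>x\<bar>)\<^sup>2 * (D\<^sup>2 * (exp (- (x\<^sup>2 / 2)))\<^sup>2)" by (simp add: power_mult_distrib)
    also have "(exp (- (x\<^sup>2 / 2)))\<^sup>2 = exp (- x\<^sup>2)" by (simp flip: exp_double)
    also have "(1 + \<bar>x\<bar>)\<^sup>2 * (D\<^sup>2 * exp (- x\<^sup>2)) \<le> (2 * (1 + x\<^sup>2)) * (D\<^sup>2 * exp (- x\<^sup>2))"
      using sum_squares_bound[of 1 "\<bar>x\<bar>"] by (intro mult_right_mono) (auto simp: power2_sum)
    finally show "norm (((1 + \<bar>x\<bar>) * norm (glued x))\<^sup>2) \<le> norm (2 * D\<^sup>2 * (exp (- x\<^sup>2) * (1 + x\<^sup>2)))"
      by (simp add: algebra_simps)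
  qed
qed measurable

lemma square_integrable_glued: "square_integrable glued"
  unfolding square_integrable_def
proof
  show "integrable lborel (\<lambda>x. (norm (glued x))\<^sup>2)"
  proof (rule Bochner_Integration.integrable_bound[OF weighted_glued_integrable])
    have "norm (glued x) \<le> (1 + \<bar>x\<bar>) * norm (glued x)" for x
      using mult_right_mono[of 1 "1 + \<bar>x\<bar>" "norm (glued x)"] by simp
    then show "AE x in lborel. norm ((norm (glued x))\<^sup>2) \<le> norm (((1 + \<bar>x\<bar>) * norm (glued x))\<^sup>2)"
      by (intro AE_I2) (auto intro!: power_mono)
  qed measurable
qed simp

text \<open>\<open>W\<close> times the Green kernel applied to a vector. By variation of constants,
  the coefficient of \<open>P x\<close> collects the source to the left of \<open>x\<close>, that of
  \<open>Q x\<close> the source to the right, so each solution is used towards the end where it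
  decays.\<close>

definition kern :: "real \<Rightarrow> real \<Rightarrow> complex^2 \<Rightarrow> complex^2" where
  "kern x t f = (if t \<le> x then pair2 f (Q t) *s P x else pair2 f (P t) *s Q x)"

lemma norm_pair2_smult_le: "norm (pair2 f p *s (q :: complex^2)) \<le> norm f * (norm p * norm q)"
  using mult_right_mono[OF norm_pair2_le[of f p] norm_ge_zero[of q]]
  by (simp add: norm_vector_smult mult.assoc)

text \<open>On each quadrant the Green kernel differs from the rank-one kernel only by a term containing
  the combination \<^term>\<open>defect\<close>, which is exponentially small near the origin.\<close>

lemma kern_minus_main:
  "norm (kern x t f - (a * pair2 f (glued t)) *s glued x) \<le> B * exp (- (\<bar>x\<^sup>2 - t\<^sup>2\<bar> / 2)) * norm f"
proof -
  have bound: "norm (c *s (pair2 f p *s q)) \<le> B * exp (- (\<bar>x\<^sup>2 - t\<^sup>2\<bar> / 2)) * norm f"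
    if "norm c = 1" "norm p * norm q \<le> B * exp (- (\<bar>x\<^sup>2 - t\<^sup>2\<bar> / 2))" for p q :: "complex^2" and c
  proof -
    have "norm (pair2 f p *s q) \<le> norm f * (norm p * norm q)" by (rule norm_pair2_smult_le)
    also have "\<dots> \<le> norm f * (B * exp (- (\<bar>x\<^sup>2 - t\<^sup>2\<bar> / 2)))" using that by (intro mult_left_mono) auto
    finally show ?thesis unfolding norm_vector_smult[of c] that(1) by (simp only: mult_ac mult_1_right)
  qed
  have b1: "norm (P x) * norm (defect t) \<le> B * exp (- (\<bar>x\<^sup>2 - t\<^sup>2\<bar> / 2))" if "0 \<le> t" "t \<le> x"
    using product_bound_defect[of t x] that by simp
  have b2: "norm (P t) * norm (defect x) \<le> B * exp (- (\<bar>x\<^sup>2 - t\<^sup>2\<bar> / 2))" if "0 \<le> x" "x \<le> t"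
    using product_bound_defect[of x t] that by (simp add: abs_minus_commute)
  have b3: "norm (Q t) * norm (defect x) \<le> B * exp (- (\<bar>x\<^sup>2 - t\<^sup>2\<bar> / 2))" if "t \<le> x" "x < 0"
    using product_bound_defect[of x t] that by (simp add: abs_minus_commute)
  have b4: "norm (Q x) * norm (defect t) \<le> B * exp (- (\<bar>x\<^sup>2 - t\<^sup>2\<bar> / 2))" if "x \<le> t" "t < 0"
    using product_bound_defect[of t x] that by simp
  have zero: "0 \<le> B * exp (- (\<bar>x\<^sup>2 - t\<^sup>2\<bar> / 2)) * norm f" using B_nonneg by simp
  have c1: "norm (- (1 / a)) = 1" using norm_a by (simp add: norm_divide)
  consider "0 \<le> t" "t \<le> x" | "0 \<le> x" "x < t" | "t < 0" "0 \<le> x" | "x < 0" "0 \<le> t" | "t \<le> x" "x < 0" | "x < t" "t < 0"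
    by linarith
  then show ?thesis
  proof cases
    case 1
    then have "kern x t f - (a * pair2 f (glued t)) *s glued x = 1 *s (pair2 f (defect t) *s P x)"
      by (simp add: kern_def glued_def defect_def pair2_def vec_eq_iff algebra_simps)
    then show ?thesis using bound[of 1 "defect t" "P x"] b1 1 by (simp add: mult.commute)
  next
    case 2
    then have "kern x t f - (a * pair2 f (glued t)) *s glued x = 1 *s (pair2 f (P t) *s defect x)"
      by (simp add: kern_def glued_def defect_def pair2_def vec_eq_iff algebra_simps)
    then show ?thesis using bound[of 1 "P t" "defect x"] b2 2 by simp
  next
    case 3
    then have "kern x t f - (a * pair2 f (glued t)) *s glued x = 0"
      using a_nz by (simp add: kern_def glued_def pair2_def vec_eq_iff field_simps)
    then show ?thesis using zero by simp
  next
    case 4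
    then have "kern x t f - (a * pair2 f (glued t)) *s glued x = 0"
      using a_nz by (simp add: kern_def glued_def pair2_def vec_eq_iff field_simps)
    then show ?thesis using zero by simp
  next
    case 5
    then have "kern x t f - (a * pair2 f (glued t)) *s glued x = (- (1 / a)) *s (pair2 f (Q t) *s defect x)"
      using a_nz by (simp add: kern_def glued_def defect_def pair2_def vec_eq_iff field_simps)
    then show ?thesis using bound[OF c1, of "Q t" "defect x"] b3 5 by simp
  next
    case 6
    then have "kern x t f - (a * pair2 f (glued t)) *s glued x = (- (1 / a)) *s (pair2 f (defect t) *s Q x)"
      using a_nz by (simp add: kern_def glued_def defect_def pair2_def vec_eq_iff field_simps)
    then show ?thesis using bound[OF c1, of "defect t" "Q x"] b4 6 by (simp add: mult.commute)
  qed
qed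

context
  fixes f assumes f: "square_integrable f"
begin

lemma f_measurable [measurable]: "f \<in> borel_measurable borel"
  using f by (simp add: square_integrable_def)

lemma f_square: "integrable lborel (\<lambda>x. (norm (f x))\<^sup>2)"
  using f by (simp add: square_integrable_def)

lemma integrable_pair2_glued: "integrable lborel (\<lambda>t. pair2 (f t) (glued t))"
proof (rule Bochner_Integration.integrable_bound)
  show "integrable lborel (\<lambda>t. norm (f t) * norm (glued t))"
    by (rule integrable_mult_square) (use f_square square_integrable_glued in \<open>auto simp: square_integrable_def\<close>)
  show "AE t in lborel. norm (pair2 (f t) (glued t)) \<le> norm (norm (f t) * norm (glued t))"
    by (intro AE_I2) (simp add: norm_pair2_le)
qed measurable

lemma integrable_exp_mult: "integrable lborel (\<lambda>t. exp (- (\<bar>x\<^sup>2 - t\<^sup>2\<bar> / 2)) * norm (f t))"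
proof (rule integrable_mult_square)
  show "integrable lborel (\<lambda>t. (exp (- (\<bar>x\<^sup>2 - t\<^sup>2\<bar> / 2)))\<^sup>2)"
  proof (rule Bochner_Integration.integrable_bound)
    show "integrable lborel (\<lambda>t::real. exp (x\<^sup>2) * (exp (- t\<^sup>2) * (1 + t\<^sup>2)))"
      by (intro integrable_mult_right gauss_weight_full)
    show "AE t in lborel. norm ((exp (- (\<bar>x\<^sup>2 - t\<^sup>2\<bar> / 2)))\<^sup>2) \<le> norm (exp (x\<^sup>2) * (exp (- t\<^sup>2) * (1 + t\<^sup>2)))"
    proof (intro AE_I2)
      fix t :: real
      have "(exp (- (\<bar>x\<^sup>2 - t\<^sup>2\<bar> / 2)))\<^sup>2 = exp (- \<bar>x\<^sup>2 - t\<^sup>2\<bar>)" by (simp flip: exp_double)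
      also have "\<dots> \<le> exp (x\<^sup>2 + - t\<^sup>2)" by simp
      also have "\<dots> = exp (x\<^sup>2) * (exp (- t\<^sup>2) * 1)" by (simp add: exp_add del: add_uminus_conv_diff)
      also have "\<dots> \<le> exp (x\<^sup>2) * (exp (- t\<^sup>2) * (1 + t\<^sup>2))" by (intro mult_left_mono) auto
      finally show "norm ((exp (- (\<bar>x\<^sup>2 - t\<^sup>2\<bar> / 2)))\<^sup>2) \<le> norm (exp (x\<^sup>2) * (exp (- t\<^sup>2) * (1 + t\<^sup>2)))"
        by (simp add: abs_of_nonneg)
    qed
  qed measurable
qed (use f_square in auto)

lemma kern_measurable_pair [measurable]: "(\<lambda>p. kern (fst p) (snd p) (f (snd p))) \<in> borel_measurable (borel \<Otimes>\<^sub>M borel)"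
  unfolding kern_def by measurable

lemma kern_measurable [measurable]: "(\<lambda>t. kern x t (f t)) \<in> borel_measurable borel"
  unfolding kern_def by measurable

lemma integrable_kern_diff: "integrable lborel (\<lambda>t. kern x t (f t) - (a * pair2 (f t) (glued t)) *s glued x)"
proof (rule Bochner_Integration.integrable_bound)
  show "integrable lborel (\<lambda>t. B * (exp (- (\<bar>x\<^sup>2 - t\<^sup>2\<bar> / 2)) * norm (f t)))"
    by (intro integrable_mult_right integrable_exp_mult)
  show "AE t in lborel. norm (kern x t (f t) - (a * pair2 (f t) (glued t)) *s glued x) \<le> norm (B * (exp (- (\<bar>x\<^sup>2 - t\<^sup>2\<bar> / 2)) * norm (f t)))"
    using kern_minus_main[of x _ "f _"] B_nonneg by (intro AE_I2) (simp add: mult.assoc)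
qed measurable

lemma integrable_main: "integrable lborel (\<lambda>t. (a * pair2 (f t) (glued t)) *s glued x)"
  by (rule integrable_bounded_linear[OF bounded_linear_smult]) (intro integrable_mult_right integrable_pair2_glued)

text \<open>Integrability of the kernel is inherited from its two pieces: the difference, dominated
  by a function that is Gaussian in \<open>t\<close>, and the rank-one part.\<close>

lemma integrable_kern: "integrable lborel (\<lambda>t. kern x t (f t))"
  using Bochner_Integration.integrable_add[OF integrable_kern_diff[of x] integrable_main[of x]] by simp

end

declare f_measurable [measurable del] kern_measurable_pair [measurable del] kern_measurable [measurable del]

definition green :: "(real \<Rightarrow> complex^2) \<Rightarrow> real \<Rightarrow> complex^2" where
  "green f x = (1 / W) *\<^sub>R (\<integral>t. kern x t (f t) \<partial>lborel)"

text \<open>A rank-one operator whose norm is the squared norm of \<open>glued\<close> divided by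
  \<open>W\<close>.\<close>

definition green_main :: "(real \<Rightarrow> complex^2) \<Rightarrow> real \<Rightarrow> complex^2" where
  "green_main f x = (of_real (1 / W) * a * (\<integral>t. pair2 (f t) (glued t) \<partial>lborel)) *s glued x"

lemma green_measurable:
  assumes "square_integrable f" shows "green f \<in> borel_measurable borel"
proof -
  note [measurable] = kern_measurable_pair[OF assms]
  have "(\<lambda>x. \<integral>t. kern x t (f t) \<partial>lborel) \<in> borel_measurable lborel"
    by (rule lborel.borel_measurable_lebesgue_integral) (simp add: split_beta')
  then show ?thesis unfolding green_def[abs_def] by simp
qed

lemma green_main_measurable: "green_main f \<in> borel_measurable borel"
  unfolding green_main_def[abs_def] by measurable

lemma green_diff:
  assumes f: "square_integrable f"
  shows "green f x - green_main f x = (1 / W) *\<^sub>R (\<integral>t. kern x t (f t) - (a * pair2 (f t) (glued t)) *s glued x \<partial>lborel)"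
proof -
  have "(\<integral>t. (a * pair2 (f t) (glued t)) *s glued x \<partial>lborel) = (a * (\<integral>t. pair2 (f t) (glued t) \<partial>lborel)) *s glued x"
  proof -
    have "(\<integral>t. (a * pair2 (f t) (glued t)) *s glued x \<partial>lborel) = (\<integral>t. a * pair2 (f t) (glued t) \<partial>lborel) *s glued x"
      by (rule integral_bounded_linear[OF bounded_linear_smult integrable_mult_right[OF integrable_pair2_glued[OF f]]])
    then show ?thesis by simp
  qed
  moreover have "(1 / W) *\<^sub>R (c *s v) = (of_real (1 / W) * c) *s v" for c and v :: "complex^2"
    by (simp add: vec_eq_iff scaleR_conv_of_real[where 'a=complex])
  ultimately show ?thesis
    by (simp add: green_def green_main_def Bochner_Integration.integral_diff[OF integrable_kern[OF f] integrable_main[OF f]] scaleR_diff_right mult.assoc)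
qed

text \<open>Multiplied by the weight, the kernel of the remainder is bounded by \<open>B / W\<close>
  times the Schur kernel. Working with nonnegative integrals lets one estimate give both finiteness
  and the bound.\<close>

lemma green_remainder:
  assumes f: "square_integrable f" and K0: "K > 0"
    and K: "\<And>x. (\<integral>\<^sup>+t. ennreal (schur_kernel x t) \<partial>lborel) \<le> ennreal K"
  shows "integrable lborel (\<lambda>x. ((1 + \<bar>x\<bar>) * norm (green f x - green_main f x))\<^sup>2)"
    and "(\<integral>x. ((1 + \<bar>x\<bar>) * norm (green f x - green_main f x))\<^sup>2 \<partial>lborel) \<le> (K * B / W)\<^sup>2 * (\<integral>x. (norm (f x))\<^sup>2 \<partial>lborel)"
proof -
  note [measurable] = f_measurable[OF f] green_measurable[OF f] green_main_measurable
  let ?r = "\<lambda>x. (1 + \<bar>x\<bar>) * norm (green f x - green_main f x)"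
  have pt: "ennreal (?r x) \<le> ennreal (B / W) * (\<integral>\<^sup>+t. ennreal (schur_kernel x t * norm (f t)) \<partial>lborel)" for x
  proof -
    let ?h = "\<lambda>t. kern x t (f t) - (a * pair2 (f t) (glued t)) *s glued x"
    have "ennreal (?r x) = ennreal ((1 + \<bar>x\<bar>) / W) * ennreal (norm (\<integral>t. ?h t \<partial>lborel))"
      using W_pos by (simp add: green_diff[OF f] field_simps flip: ennreal_mult)
    also have "\<dots> \<le> ennreal ((1 + \<bar>x\<bar>) / W) * (\<integral>\<^sup>+t. ennreal (norm (?h t)) \<partial>lborel)"
      by (intro mult_left_mono integral_norm_bound_ennreal integrable_kern_diff[OF f]) auto
    also have "\<dots> = (\<integral>\<^sup>+t. ennreal ((1 + \<bar>x\<bar>) / W) * ennreal (norm (?h t)) \<partial>lborel)"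
      using integrable_kern_diff[OF f, of x] by (intro nn_integral_cmult[symmetric]) auto
    also have "\<dots> \<le> (\<integral>\<^sup>+t. ennreal (B / W) * ennreal (schur_kernel x t * norm (f t)) \<partial>lborel)"
    proof (intro nn_integral_mono)
      fix t
      have "(1 + \<bar>x\<bar>) * norm (?h t) \<le> (1 + max \<bar>x\<bar> \<bar>t\<bar>) * (B * exp (- (\<bar>x\<^sup>2 - t\<^sup>2\<bar> / 2)) * norm (f t))"
        by (intro mult_mono kern_minus_main) auto
      then have "(1 + \<bar>x\<bar>) * norm (?h t) / W \<le> (1 + max \<bar>x\<bar> \<bar>t\<bar>) * (B * exp (- (\<bar>x\<^sup>2 - t\<^sup>2\<bar> / 2)) * norm (f t)) / W"
        using W_pos by (intro divide_right_mono) auto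
      then have "(1 + \<bar>x\<bar>) / W * norm (?h t) \<le> B / W * (schur_kernel x t * norm (f t))"
        by (simp only: schur_kernel_def times_divide_eq_left times_divide_eq_right mult_ac)
      then show "ennreal ((1 + \<bar>x\<bar>) / W) * ennreal (norm (?h t)) \<le> ennreal (B / W) * ennreal (schur_kernel x t * norm (f t))"
        using W_pos B_nonneg by (simp add: ennreal_leI schur_kernel_nonneg flip: ennreal_mult)
    qed
    also have "\<dots> = ennreal (B / W) * (\<integral>\<^sup>+t. ennreal (schur_kernel x t * norm (f t)) \<partial>lborel)"
      by (rule nn_integral_cmult) (simp add: schur_kernel_def)
    finally show ?thesis .
  qed
  have "(\<integral>\<^sup>+x. ennreal ((?r x)\<^sup>2) \<partial>lborel) \<le> (\<integral>\<^sup>+x. (ennreal (B / W))\<^sup>2 * (\<integral>\<^sup>+t. ennreal (schur_kernel x t * norm (f t)) \<partial>lborel)\<^sup>2 \<partial>lborel)"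
  proof (intro nn_integral_mono)
    fix x
    show "ennreal ((?r x)\<^sup>2) \<le> (ennreal (B / W))\<^sup>2 * (\<integral>\<^sup>+t. ennreal (schur_kernel x t * norm (f t)) \<partial>lborel)\<^sup>2"
      using power_mono[OF pt[of x] zero_le, of 2] by (simp add: ennreal_power power_mult_distrib)
  qed
  also have "\<dots> = (ennreal (B / W))\<^sup>2 * (\<integral>\<^sup>+x. (\<integral>\<^sup>+t. ennreal (schur_kernel x t * norm (f t)) \<partial>lborel)\<^sup>2 \<partial>lborel)"
    by (rule nn_integral_cmult) (auto intro!: borel_measurable_power lborel.borel_measurable_nn_integral simp: split_beta')
  also have "\<dots> \<le> (ennreal (B / W))\<^sup>2 * ((ennreal K)\<^sup>2 * (\<integral>\<^sup>+t. ennreal ((norm (f t))\<^sup>2) \<partial>lborel))"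
    by (intro mult_left_mono schur_test K) auto
  also have "(\<integral>\<^sup>+t. ennreal ((norm (f t))\<^sup>2) \<partial>lborel) = ennreal (\<integral>x. (norm (f x))\<^sup>2 \<partial>lborel)"
    by (rule nn_integral_eq_integral[OF f_square[OF f]]) simp
  also have "(ennreal (B / W))\<^sup>2 * ((ennreal K)\<^sup>2 * ennreal (\<integral>x. (norm (f x))\<^sup>2 \<partial>lborel)) = ennreal ((K * B / W)\<^sup>2 * (\<integral>x. (norm (f x))\<^sup>2 \<partial>lborel))"
    using W_pos B_nonneg K0 by (simp add: ennreal_power power_mult_distrib power_divide mult_ac flip: ennreal_mult)
  finally have le: "(\<integral>\<^sup>+x. ennreal ((?r x)\<^sup>2) \<partial>lborel) \<le> ennreal ((K * B / W)\<^sup>2 * (\<integral>x. (norm (f x))\<^sup>2 \<partial>lborel))" .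
  show i: "integrable lborel (\<lambda>x. (?r x)\<^sup>2)"
    by (rule integrableI_bounded) (use le in \<open>auto intro: order.strict_trans1\<close>)
  show "(\<integral>x. (?r x)\<^sup>2 \<partial>lborel) \<le> (K * B / W)\<^sup>2 * (\<integral>x. (norm (f x))\<^sup>2 \<partial>lborel)"
    using le nn_integral_eq_integral[OF i] by simp
qed

end

section \<open>The resolvent\<close>

lemma square_integrable_cong_AE:
  assumes "square_integrable f" "g \<in> borel_measurable borel" "AE x in lborel. f x = g x"
  shows "square_integrable g"
  unfolding square_integrable_def
proof
  have "integrable lborel (\<lambda>x. (norm (f x))\<^sup>2)" using assms(1) by (simp add: square_integrable_def)
  then show "integrable lborel (\<lambda>x. (norm (g x))\<^sup>2)"
    by (rule integrable_cong_AE_imp) (use assms in \<open>auto elim: eventually_mono\<close>)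
qed (use assms in simp)

lemma borel_measurable_vec_complex_2:
  fixes g :: "real \<Rightarrow> complex^2"
  assumes [measurable]: "(\<lambda>x. g x $ 1) \<in> borel_measurable M" "(\<lambda>x. g x $ 2) \<in> borel_measurable M"
  shows "g \<in> borel_measurable M"
proof -
  have "g = (\<lambda>x. (g x $ 1) *s vector [1, 0] + (g x $ 2) *s vector [0, 1])"
    by (auto simp: fun_eq_iff vec_eq_iff forall_2)
  also have "\<dots> \<in> borel_measurable M" by measurable
  finally show ?thesis .
qed

lemma square_integrable_componentwise:
  fixes g :: "real \<Rightarrow> complex^2"
  assumes [measurable]: "(\<lambda>x. g x $ 1) \<in> borel_measurable borel" "(\<lambda>x. g x $ 2) \<in> borel_measurable borel"
    and h: "integrable lborel h" and le: "\<And>x. (norm (g x $ 1))\<^sup>2 + (norm (g x $ 2))\<^sup>2 \<le> h x"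
  shows "square_integrable g"
proof -
  have [measurable]: "g \<in> borel_measurable borel" by (rule borel_measurable_vec_complex_2) auto
  have "integrable lborel (\<lambda>x. (norm (g x))\<^sup>2)"
    by (rule Bochner_Integration.integrable_bound[OF h])
      (use le in \<open>auto simp: norm_complex_2 intro: order_trans[OF _ abs_ge_self]\<close>)
  then show ?thesis by (simp add: square_integrable_def)
qed

lemma norm_add_square_le: "(norm (a + b :: complex))\<^sup>2 \<le> 2 * (norm a)\<^sup>2 + 2 * (norm b)\<^sup>2"
proof -
  have "(norm (a + b))\<^sup>2 \<le> (norm a + norm b)\<^sup>2" by (intro power_mono norm_triangle_ineq) auto
  also have "\<dots> \<le> 2 * (norm a)\<^sup>2 + 2 * (norm b)\<^sup>2"
    using zero_le_power2[of "norm a - norm b"] by (simp add: power2_sum power2_diff)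
  finally show ?thesis .
qed

text \<open>Multiplication by \<open>\<i>\<close> solves one component of the resolvent equation for
  the derivative; the second component is the case \<open>c = - m\<close>.\<close>

lemma dirac_component_iff:
  fixes x :: real and u v f :: complex
  shows "- (\<i> * v) + (of_real c * u + \<i> * of_real x * u) - of_real l * u = f \<longleftrightarrow> v = Complex x (l - c) * u + \<i> * f"
proof -
  let ?L = "- (\<i> * v) + (of_real c * u + \<i> * of_real x * u) - of_real l * u"
  have "Complex x (l - c) * u + \<i> * f - v = \<i> * (f - ?L)"
    by (simp add: complex_eq_iff algebra_simps)
  moreover have "?L = f \<longleftrightarrow> \<i> * (f - ?L) = 0" by auto
  ultimately show ?thesis by (metis eq_iff_diff_eq_0)
qed

text \<open>Because the weak derivative, \<open>u\<close> and \<open>x u\<close> are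
  square-integrable, the expression defining the operator represents its class, and the equation may
  be read pointwise almost everywhere.\<close>

lemma airy_dirac_eq_iff:
  assumes w: "has_weak_derivative u v" and x: "u \<in> Dom_x"
  shows "airy_dirac m u - l *\<^sub>R u = f \<longleftrightarrow>
    (AE x in lborel. rep_L2 v x $ 1 = Complex x (l + m) * rep_L2 u x $ 2 + \<i> * rep_L2 f x $ 2 \<and>
      rep_L2 v x $ 2 = Complex x (l - m) * rep_L2 u x $ 1 + \<i> * rep_L2 f x $ 1)"
proof -
  define G where "G x = - (\<i> *s (sigma1 *v rep_L2 v x)) + complex_of_real m *s (sigma3 *v rep_L2 u x)
      + (\<i> * complex_of_real x) *s rep_L2 u x" for x
  have G1: "G x $ 1 = - (\<i> * rep_L2 v x $ 2) + (of_real m * rep_L2 u x $ 1 + \<i> * of_real x * rep_L2 u x $ 1)" for x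
    by (simp add: G_def sigma1_def sigma3_def matrix_vector_mult_def sum_2)
  have G2: "G x $ 2 = - (\<i> * rep_L2 v x $ 1) + (of_real (- m) * rep_L2 u x $ 2 + \<i> * of_real x * rep_L2 u x $ 2)" for x
    by (simp add: G_def sigma1_def sigma3_def matrix_vector_mult_def sum_2)
  have [measurable]: "rep_L2 w \<in> borel_measurable borel" for w
    using square_integrable_rep_L2[of w] by (simp add: square_integrable_def)
  have siG: "square_integrable G"
  proof (rule square_integrable_componentwise)
    show "(\<lambda>x. G x $ 1) \<in> borel_measurable borel" "(\<lambda>x. G x $ 2) \<in> borel_measurable borel"
      unfolding G1 G2 by measurable
    let ?h = "\<lambda>x. 2 * (norm (rep_L2 v x))\<^sup>2 + 4 * m\<^sup>2 * (norm (rep_L2 u x))\<^sup>2 + 4 * (norm (x *\<^sub>R rep_L2 u x))\<^sup>2"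
    show "integrable lborel ?h"
      using square_integrable_rep_L2[of v] square_integrable_rep_L2[of u] x
      by (intro Bochner_Integration.integrable_add integrable_mult_right) (simp_all add: square_integrable_def Dom_x_def)
    fix x
    have c: "(norm (- (\<i> * p) + (of_real c * q + \<i> * of_real x * q)))\<^sup>2 \<le> 2 * (norm p)\<^sup>2 + 4 * c\<^sup>2 * (norm q)\<^sup>2 + 4 * (x\<^sup>2 * (norm q)\<^sup>2)"
      for p q :: complex and c
      using norm_add_square_le[of "- (\<i> * p)" "of_real c * q + \<i> * of_real x * q"] norm_add_square_le[of "of_real c * q" "\<i> * of_real x * q"]
      by (simp add: norm_mult power_mult_distrib)
    show "(norm (G x $ 1))\<^sup>2 + (norm (G x $ 2))\<^sup>2 \<le> ?h x"
      unfolding norm_scaleR power_mult_distrib norm_complex_2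
      using c[of "rep_L2 v x $ 2" m "rep_L2 u x $ 1"] c[of "rep_L2 v x $ 1" "- m" "rep_L2 u x $ 2"]
      unfolding G1 G2 by (simp add: algebra_simps)
  qed
  have "airy_dirac m u = abs_L2 G"
    by (simp add: airy_dirac_def weak_derivative_eq[OF w] G_def[abs_def])
  moreover have "abs_L2 G - l *\<^sub>R u = f \<longleftrightarrow> (AE x in lborel. G x - l *\<^sub>R rep_L2 u x = rep_L2 f x)"
  proof -
    have ae: "AE x in lborel. rep_L2 (abs_L2 G - l *\<^sub>R u) x = G x - l *\<^sub>R rep_L2 u x"
      using rep_L2_diff[of "abs_L2 G" "l *\<^sub>R u"] rep_L2_scaleR[of l u] rep_abs_L2[OF siG]
      by eventually_elim simp
    have "(AE x in lborel. rep_L2 (abs_L2 G - l *\<^sub>R u) x = rep_L2 f x) \<longleftrightarrow> (AE x in lborel. G x - l *\<^sub>R rep_L2 u x = rep_L2 f x)"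
      using ae by (intro eventually_cong[OF ae]) simp
    then show ?thesis unfolding L2_eq_iff .
  qed
  moreover have "G x - l *\<^sub>R rep_L2 u x = rep_L2 f x \<longleftrightarrow>
      rep_L2 v x $ 1 = Complex x (l + m) * rep_L2 u x $ 2 + \<i> * rep_L2 f x $ 2 \<and>
      rep_L2 v x $ 2 = Complex x (l - m) * rep_L2 u x $ 1 + \<i> * rep_L2 f x $ 1" for x
    using dirac_component_iff[of "rep_L2 v x $ 2" m "rep_L2 u x $ 1" x l "rep_L2 f x $ 1"]
      dirac_component_iff[of "rep_L2 v x $ 1" "- m" "rep_L2 u x $ 2" x l "rep_L2 f x $ 2"]
    by (auto simp: vec_eq_iff forall_2 G1 G2 scaleR_conv_of_real[where 'a=complex])
  ultimately show ?thesis by simp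
qed

lemma solves_dirac_wronskian_const:
  assumes "solves_dirac m l P" "solves_dirac m l U"
  shows "det2 (P x) (U x) = det2 (P y) (U y)"
proof -
  note d = solves_diracD[OF assms(1)] solves_diracD[OF assms(2)]
  have "((\<lambda>x. det2 (P x) (U x)) has_vector_derivative 0) (at x within UNIV)" for x
    unfolding det2_def
    by (rule has_vector_derivative_eq_rhs[OF has_vector_derivative_diff[OF has_vector_derivative_mult[OF d(1) d(4)] has_vector_derivative_mult[OF d(2) d(3)]]])
      (simp add: algebra_simps)
  then obtain c where "\<And>x. det2 (P x) (U x) = c"
    using has_vector_derivative_zero_constant[of UNIV "\<lambda>x. det2 (P x) (U x)"] by auto
  then show ?thesis by simp
qed

lemma norm_det2_le: "norm (det2 p q) \<le> norm p * norm q"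
proof -
  have "det2 p q = pair2 p (vector [q $ 2, q $ 1])" by (simp add: det2_def pair2_def)
  moreover have "norm (vector [q $ 2, q $ 1] :: complex^2) = norm q"
    by (rule power2_eq_imp_eq) (auto simp: norm_complex_2)
  ultimately show ?thesis using norm_pair2_le[of p "vector [q $ 2, q $ 1]"] by simp
qed

lemma not_integrable_half_line:
  fixes c :: real
  assumes "S \<in> sets borel" "{0..} \<subseteq> S \<or> {..0} \<subseteq> S" "c > 0"
  shows "\<not> integrable lborel (\<lambda>x::real. indicator S x * c)"
proof
  assume "integrable lborel (\<lambda>x. indicator S x * c)"
  then have "integrable lborel (\<lambda>x. indicator S x * c * (1 / c))" by (rule integrable_mult_left)
  then have "integrable lborel (indicator S :: real \<Rightarrow> real)" using assms(3) by simp
  then have "emeasure lborel S < \<infinity>" using assms(1) by (simp add: integrable_indicator_iff)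
  then obtain n :: nat where n: "emeasure lborel S < of_nat n"
    using ennreal_Ex_less_of_nat by (auto simp: top.not_eq_extremum)
  have "of_nat n \<le> emeasure lborel S"
  proof (cases "{0..} \<subseteq> S")
    case True
    have "emeasure lborel {0..real n} \<le> emeasure lborel S" using True assms(1) by (intro emeasure_mono) auto
    then show ?thesis by (simp add: ennreal_of_nat_eq_real_of_nat)
  next
    case False
    then have "emeasure lborel {- real n..0} \<le> emeasure lborel S" using assms by (intro emeasure_mono) auto
    then show ?thesis by (simp add: ennreal_of_nat_eq_real_of_nat)
  qed
  with n show False by simp
qed

lemma bounded_linear_det2: "bounded_linear (\<lambda>v. det2 v q)" "bounded_linear (\<lambda>v. det2 q v)"
  unfolding det2_def
  by (intro bounded_linear_sub bounded_linear_compose[OF bounded_linear_mult_left bounded_linear_vec_nth]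
      bounded_linear_compose[OF bounded_linear_mult_right bounded_linear_vec_nth])+

section \<open>Uniqueness of square-integrable solutions\<close>

context airy_line
begin

text \<open>The determinant of \<open>P\<close> and \<open>U\<close> is constant and at most
  \<open>D * norm (U y)\<close> on the right half-line, where a nonzero constant is not
  square-integrable. The same holds for \<open>Q\<close> on the left half-line, and Cramer's rule
  with \<open>W > 0\<close> forces \<open>U\<close> to vanish.\<close>

lemma decaying_solution_zero:
  assumes U: "solves_dirac m l U" and si: "square_integrable U"
  shows "U x = 0"
proof -
  have iU: "integrable lborel (\<lambda>x. (norm (U x))\<^sup>2)" using si unfolding square_integrable_def by blast
  have z: "c = 0" if le: "\<And>x. x \<in> S \<Longrightarrow> norm c \<le> D * norm (U x)" and S: "S \<in> sets borel" "{0..} \<subseteq> S \<or> {..0} \<subseteq> S" for c :: complex and S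
  proof (rule ccontr)
    assume c: "c \<noteq> 0"
    have "integrable lborel (\<lambda>x. indicator S x * (norm c)\<^sup>2)"
    proof (rule Bochner_Integration.integrable_bound)
      show "integrable lborel (\<lambda>x. D\<^sup>2 * (norm (U x))\<^sup>2)" using iU by simp
      have "(norm c)\<^sup>2 \<le> D\<^sup>2 * (norm (U x))\<^sup>2" if "x \<in> S" for x
        using power_mono[OF le[OF that] norm_ge_zero, of 2] by (simp add: power_mult_distrib)
      then show "AE x in lborel. norm (indicator S x * (norm c)\<^sup>2) \<le> norm (D\<^sup>2 * (norm (U x))\<^sup>2)"
        by (intro AE_I2) (auto simp: indicator_def)
    qed (use S in measurable)
    then show False using not_integrable_half_line[OF S, of "(norm c)\<^sup>2"] c by simp
  qed
  have bP: "norm (P x) \<le> D" if "x \<ge> 0" for x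
    using order_trans[OF decay[OF that], of D] D_nonneg by (simp add: mult_left_le)
  have P0: "det2 (P x) (U x) = 0" for x
  proof (rule z[of "{0..}"])
    fix y :: real assume y: "y \<in> {0..}"
    have "norm (det2 (P x) (U x)) = norm (det2 (P y) (U y))" using solves_dirac_wronskian_const[OF sol U] by metis
    also have "\<dots> \<le> norm (P y) * norm (U y)" by (rule norm_det2_le)
    also have "\<dots> \<le> D * norm (U y)" using bP[of y] y by (intro mult_right_mono) auto
    finally show "norm (det2 (P x) (U x)) \<le> D * norm (U y)" .
  qed auto
  have Q0: "det2 (Q x) (U x) = 0" for x
  proof (rule z[of "{..0}"])
    fix y :: real assume y: "y \<in> {..0}"
    have "norm (det2 (Q x) (U x)) = norm (det2 (Q y) (U y))" using solves_dirac_wronskian_const[OF solves_dirac_reflect[OF sol] U] by metis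
    also have "\<dots> \<le> norm (Q y) * norm (U y)" by (rule norm_det2_le)
    also have "\<dots> \<le> D * norm (U y)" using bP[of "- y"] y by (intro mult_right_mono) auto
    finally show "norm (det2 (Q x) (U x)) \<le> D * norm (U y)" .
  qed auto
  have "det2 (P x) (Q x) * U x $ 1 = Q x $ 1 * det2 (P x) (U x) - P x $ 1 * det2 (Q x) (U x)"
    "det2 (P x) (Q x) * U x $ 2 = Q x $ 2 * det2 (P x) (U x) - P x $ 2 * det2 (Q x) (U x)"
    unfolding det2_def by (simp_all add: algebra_simps)
  then have "U x $ 1 = 0" "U x $ 2 = 0"
    using W_pos by (simp_all add: P0 Q0 det_PQ)
  then show ?thesis by (simp add: vec_eq_iff forall_2)
qed

text \<open>A weak solution coincides almost everywhere with a primitive of its weak derivative. By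
  the equation that primitive has a continuous integrand, so it is a classical solution.\<close>

lemma homogeneous_solution_zero:
  assumes w: "has_weak_derivative u v"
    and eq: "AE x in lborel. rep_L2 v x $ 1 = Complex x (l + m) * rep_L2 u x $ 2 \<and>
      rep_L2 v x $ 2 = Complex x (l - m) * rep_L2 u x $ 1"
  shows "u = 0"
proof -
  have [measurable]: "rep_L2 w \<in> borel_measurable borel" for w
    using square_integrable_rep_L2[of w] by (simp add: square_integrable_def)
  have "\<exists>c. AE x in lborel. rep_L2 u x $ i = primitive (\<lambda>x. rep_L2 v x $ i) x + c" for i
    using w by (intro weak_deriv_imp_primitive rep_L2_locally_integrable) (simp add: has_weak_derivative_iff)
  then obtain c where c: "\<And>i. AE x in lborel. rep_L2 u x $ i = primitive (\<lambda>x. rep_L2 v x $ i) x + c i" by metis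
  define U where "U x = (\<chi> i. primitive (\<lambda>x. rep_L2 v x $ i) x + c i)" for x
  have contU: "continuous_on UNIV (\<lambda>x. U x $ i)" for i
    unfolding U_def vec_lambda_beta
    by (intro continuous_intros continuous_on_primitive rep_L2_locally_integrable)
  have uU: "AE x in lborel. rep_L2 u x = U x"
    using c[of 1] c[of 2] by eventually_elim (simp add: U_def vec_eq_iff forall_2)
  have cC: "continuous_on UNIV (\<lambda>x. Complex x b * U x $ i)" for b i
    by (rule continuous_on_mult[OF _ contU]) (simp add: Complex_eq continuous_intros)
  have [measurable]: "(\<lambda>x. Complex x b * U x $ i) \<in> borel_measurable borel" for b i
    by (rule borel_measurable_continuous_onI[OF cC])
  have v1: "AE x in lborel. rep_L2 v x $ 1 = Complex x (l + m) * U x $ 2"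
    and v2: "AE x in lborel. rep_L2 v x $ 2 = Complex x (l - m) * U x $ 1"
    using eq uU by (eventually_elim, simp)+
  have p1: "primitive (\<lambda>x. rep_L2 v x $ 1) = primitive (\<lambda>x. Complex x (l + m) * U x $ 2)"
    unfolding primitive_def fun_eq_iff by (intro allI integral_cong_AE) (use v1 in \<open>auto elim: eventually_mono\<close>)
  have p2: "primitive (\<lambda>x. rep_L2 v x $ 2) = primitive (\<lambda>x. Complex x (l - m) * U x $ 1)"
    unfolding primitive_def fun_eq_iff by (intro allI integral_cong_AE) (use v2 in \<open>auto elim: eventually_mono\<close>)
  have U1: "(\<lambda>x. U x $ 1) = (\<lambda>x. primitive (\<lambda>x. Complex x (l + m) * U x $ 2) x + c 1)"
    and U2: "(\<lambda>x. U x $ 2) = (\<lambda>x. primitive (\<lambda>x. Complex x (l - m) * U x $ 1) x + c 2)"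
    using p1 p2 by (simp_all add: U_def)
  have "solves_dirac m l U"
    unfolding solves_dirac_def
  proof (intro allI conjI)
    fix x
    have "((\<lambda>x. primitive (\<lambda>x. Complex x (l + m) * U x $ 2) x + c 1) has_vector_derivative Complex x (l + m) * U x $ 2 + 0) (at x)"
      by (intro has_vector_derivative_add has_vector_derivative_const primitive_has_vector_derivative cC)
    then show "((\<lambda>x. U x $ 1) has_vector_derivative Complex x (l + m) * U x $ 2) (at x)"
      by (simp add: U1[symmetric])
    have "((\<lambda>x. primitive (\<lambda>x. Complex x (l - m) * U x $ 1) x + c 2) has_vector_derivative Complex x (l - m) * U x $ 1 + 0) (at x)"
      by (intro has_vector_derivative_add has_vector_derivative_const primitive_has_vector_derivative cC)
    then show "((\<lambda>x. U x $ 2) has_vector_derivative Complex x (l - m) * U x $ 1) (at x)"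
      by (simp add: U2[symmetric])
  qed
  moreover have "square_integrable U"
  proof (rule square_integrable_cong_AE[OF square_integrable_rep_L2 _ uU])
    show "U \<in> borel_measurable borel"
      by (rule borel_measurable_vec_complex_2) (auto intro: borel_measurable_continuous_onI contU)
  qed
  ultimately have "U x = 0" for x by (rule decaying_solution_zero)
  then have "AE x in lborel. rep_L2 u x = 0" using uU by simp
  moreover have "AE x in lborel. rep_L2 0 x = 0"
    using rep_abs_L2[OF square_integrable_zero] by (simp add: zero_L2_def)
  ultimately have "AE x in lborel. rep_L2 u x = rep_L2 0 x" by eventually_elim simp
  then show ?thesis by (simp add: L2_eq_iff)
qed

section \<open>The Green function solves the equation\<close>

definition green_deriv :: "(real \<Rightarrow> complex^2) \<Rightarrow> real \<Rightarrow> complex^2" where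
  "green_deriv f x = vector [Complex x (l + m) * green f x $ 2 + \<i> * f x $ 2, Complex x (l - m) * green f x $ 1 + \<i> * f x $ 1]"

context
  fixes f assumes f: "square_integrable f"
begin

text \<open>The determinant with \<open>Q x\<close> kills the branch of the kernel along
  \<open>Q x\<close> and returns the coefficient of \<open>P x\<close> up to a constant, and vice
  versa. Each coefficient thus inherits integrability from the kernel.\<close>

lemma ray_integrable:
  "integrable lborel (\<lambda>t. indicator {..x} t *\<^sub>R (pair2 (f t) (Q t) / W))"
  "integrable lborel (\<lambda>t. indicator {x<..} t *\<^sub>R (pair2 (f t) (P t) / W))"
proof -
  have dQ: "det2 (c *s P x) (Q x) = c * (- \<i> * of_real W)" "det2 (P x) (c *s P x) = 0"
    "det2 (c *s Q x) (Q x) = 0" "det2 (P x) (c *s Q x) = c * (- \<i> * of_real W)" for c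
  proof -
    have "det2 (c *s p) q = c * det2 p q" "det2 p (c *s q) = c * det2 p q" "det2 p p = 0" for p q
      by (simp_all add: det2_def algebra_simps)
    then show "det2 (c *s P x) (Q x) = c * (- \<i> * of_real W)" "det2 (P x) (c *s P x) = 0"
      "det2 (c *s Q x) (Q x) = 0" "det2 (P x) (c *s Q x) = c * (- \<i> * of_real W)"
      using det_PQ[of x] by simp_all
  qed
  have "integrable lborel (\<lambda>t. det2 (kern x t (f t)) (Q x) * (\<i> / of_real (W\<^sup>2)))"
    by (intro integrable_mult_left integrable_bounded_linear[OF bounded_linear_det2(1)] integrable_kern f)
  moreover have "det2 (kern x t (f t)) (Q x) * (\<i> / of_real (W\<^sup>2)) = indicator {..x} t *\<^sub>R (pair2 (f t) (Q t) / W)" for t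
    using W_pos by (auto simp: kern_def indicator_def dQ field_simps power2_eq_square)
  ultimately show "integrable lborel (\<lambda>t. indicator {..x} t *\<^sub>R (pair2 (f t) (Q t) / W))" by simp
  have "integrable lborel (\<lambda>t. det2 (P x) (kern x t (f t)) * (\<i> / of_real (W\<^sup>2)))"
    by (intro integrable_mult_left integrable_bounded_linear[OF bounded_linear_det2(2)] integrable_kern f)
  moreover have "det2 (P x) (kern x t (f t)) * (\<i> / of_real (W\<^sup>2)) = indicator {x<..} t *\<^sub>R (pair2 (f t) (P t) / W)" for t
    using W_pos by (auto simp: kern_def indicator_def dQ field_simps power2_eq_square)
  ultimately show "integrable lborel (\<lambda>t. indicator {x<..} t *\<^sub>R (pair2 (f t) (P t) / W))" by simp
qed

text \<open>Variation of constants: the coefficients of \<open>P\<close> and \<open>Q\<close> are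
  primitives up to sign and constants. In the product rule the derivatives of \<open>P\<close> and
  \<open>Q\<close> reproduce the homogeneous system, and the other terms combine through the
  Wronskian to the source \<open>\<i> \<sigma>\<^sub>1 f\<close>.\<close>

lemma green_weak_deriv: "weak_deriv (\<lambda>x. green f x $ i) (\<lambda>x. green_deriv f x $ i)"
proof -
  note [measurable] = f_measurable[OF f]
  define \<alpha> where "\<alpha> t = pair2 (f t) (Q t) / W" for t
  define \<beta> where "\<beta> t = pair2 (f t) (P t) / W" for t
  define cp where "cp x = (\<integral>t. indicator {..x} t *\<^sub>R \<alpha> t \<partial>lborel)" for x
  define cm where "cm x = (\<integral>t. indicator {x<..} t *\<^sub>R \<beta> t \<partial>lborel)" for x
  note i\<alpha> = ray_integrable(1)[folded \<alpha>_def] and i\<beta> = ray_integrable(2)[folded \<beta>_def]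
  have m[measurable]: "\<alpha> \<in> borel_measurable borel" "\<beta> \<in> borel_measurable borel"
    unfolding \<alpha>_def[abs_def] \<beta>_def[abs_def] by measurable
  have l\<alpha>: "locally_integrable \<alpha>"
    unfolding locally_integrable_def
  proof (intro conjI allI)
    fix N
    show "integrable lborel (\<lambda>x. indicator {- N..N} x *\<^sub>R \<alpha> x)"
      by (rule Bochner_Integration.integrable_bound[OF i\<alpha>[of N]]) (auto simp: indicator_def)
  qed simp
  have l\<beta>: "locally_integrable \<beta>"
    unfolding locally_integrable_def
  proof (intro conjI allI)
    fix N
    \<comment> \<open>The ray is open, so it starts one unit further to the left in order to contain
      \<open>- N\<close>.\<close>
    show "integrable lborel (\<lambda>x. indicator {- N..N} x *\<^sub>R \<beta> x)"
      by (rule Bochner_Integration.integrable_bound[OF i\<beta>[of "- N - 1"]]) (auto simp: indicator_def)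
  qed simp
  have cp: "cp x = primitive \<alpha> x + cp 0" for x
    using i\<alpha> by (simp add: cp_def primitive_def scaleR_diff_left)
  have cm: "cm x = - (primitive \<beta> x + (- cm 0))" for x
  proof -
    have "primitive \<beta> x = (\<integral>t. indicator {0<..} t *\<^sub>R \<beta> t - indicator {x<..} t *\<^sub>R \<beta> t \<partial>lborel)"
      unfolding primitive_def by (intro Bochner_Integration.integral_cong) (auto simp: indicator_def)
    then show ?thesis using i\<beta> by (simp add: cm_def)
  qed
  have green: "green f x = cp x *s P x + cm x *s Q x" for x
  proof -
    have "(1 / W) *\<^sub>R kern x t (f t) = (indicator {..x} t *\<^sub>R \<alpha> t) *s P x + (indicator {x<..} t *\<^sub>R \<beta> t) *s Q x" for t
      using W_pos by (auto simp: kern_def \<alpha>_def \<beta>_def indicator_def vec_eq_iff scaleR_conv_of_real[where 'a=complex])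
    then have "green f x = (\<integral>t. (indicator {..x} t *\<^sub>R \<alpha> t) *s P x + (indicator {x<..} t *\<^sub>R \<beta> t) *s Q x \<partial>lborel)"
      by (simp add: green_def flip: integral_scaleR_right)
    also have "\<dots> = (\<integral>t. (indicator {..x} t *\<^sub>R \<alpha> t) *s P x \<partial>lborel) + (\<integral>t. (indicator {x<..} t *\<^sub>R \<beta> t) *s Q x \<partial>lborel)"
      by (intro Bochner_Integration.integral_add integrable_bounded_linear[OF bounded_linear_smult] i\<alpha> i\<beta>)
    also have "\<dots> = cp x *s P x + cm x *s Q x"
      by (simp only: cp_def cm_def integral_bounded_linear[OF bounded_linear_smult i\<alpha>] integral_bounded_linear[OF bounded_linear_smult i\<beta>])
    finally show ?thesis .
  qed
  have comp: "green f x $ i = P x $ i * (primitive \<alpha> x + cp 0) - Q x $ i * (primitive \<beta> x + (- cm 0))" for i x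
    unfolding green cp[of x] cm[of x] by (simp add: algebra_simps)
  have cP: "continuous_on UNIV (\<lambda>x. P x $ i)" and cQ: "continuous_on UNIV (\<lambda>x. Q x $ i)" for i
    by (rule continuous_on_component[OF P_cont], rule continuous_on_component[OF Q_cont])
  have cC: "continuous_on UNIV (\<lambda>x. Complex x b)" for b unfolding Complex_eq by (intro continuous_intros)
  have lp: "locally_integrable (\<lambda>x. primitive \<alpha> x + c)" "locally_integrable (\<lambda>x. primitive \<beta> x + c)" for c
    by (intro locally_integrable_continuous continuous_intros continuous_on_primitive l\<alpha> l\<beta>)+
  note sQ = solves_dirac_reflect[OF sol]
  have key: "weak_deriv (\<lambda>x. P x $ i * (primitive \<alpha> x + cp 0) - Q x $ i * (primitive \<beta> x + (- cm 0)))
      (\<lambda>x. (Complex x b * P x $ j * (primitive \<alpha> x + cp 0) + P x $ i * \<alpha> x) - (Complex x b * Q x $ j * (primitive \<beta> x + (- cm 0)) + Q x $ i * \<beta> x))"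
    if dP: "\<And>x. ((\<lambda>x. P x $ i) has_vector_derivative Complex x b * P x $ j) (at x)"
      and dQ: "\<And>x. ((\<lambda>x. Q x $ i) has_vector_derivative Complex x b * Q x $ j) (at x)" for i j b
    by (intro weak_deriv_diff weak_deriv_mult_primitive dP dQ l\<alpha> l\<beta> continuous_on_mult cP cQ cC
        locally_integrable_continuous_mult locally_integrable_add lp)
  have det: "P x $ 1 * Q x $ 2 - P x $ 2 * Q x $ 1 = - \<i> * of_real W" for x
    using det_PQ[of x] by (simp add: det2_def)
  consider "i = 1" | "i = 2" using exhaust_2[of i] by blast
  then show ?thesis
  proof cases
    case 1
    have s: "P x $ 1 * \<alpha> x - Q x $ 1 * \<beta> x = \<i> * f x $ 2" for x
    proof -
      have "P x $ 1 * \<alpha> x - Q x $ 1 * \<beta> x = - f x $ 2 * (P x $ 1 * Q x $ 2 - P x $ 2 * Q x $ 1) / W"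
        by (simp add: \<alpha>_def \<beta>_def pair2_def algebra_simps diff_divide_distrib add_divide_distrib)
      then show ?thesis unfolding det using W_pos by simp
    qed
    have "green_deriv f x $ 1 = (Complex x (l + m) * P x $ 2 * (primitive \<alpha> x + cp 0) + P x $ 1 * \<alpha> x) - (Complex x (l + m) * Q x $ 2 * (primitive \<beta> x + (- cm 0)) + Q x $ 1 * \<beta> x)" for x
      using s[of x] by (simp add: green_deriv_def comp algebra_simps)
    then show ?thesis
      unfolding 1 using key[OF solves_diracD(1)[OF sol] solves_diracD(1)[OF sQ]] by (simp add: comp)
  next
    case 2
    have s: "P x $ 2 * \<alpha> x - Q x $ 2 * \<beta> x = \<i> * f x $ 1" for x
    proof -
      have "P x $ 2 * \<alpha> x - Q x $ 2 * \<beta> x = - f x $ 1 * (P x $ 1 * Q x $ 2 - P x $ 2 * Q x $ 1) / W"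
        by (simp add: \<alpha>_def \<beta>_def pair2_def algebra_simps diff_divide_distrib add_divide_distrib)
      then show ?thesis unfolding det using W_pos by simp
    qed
    have "green_deriv f x $ 2 = (Complex x (l - m) * P x $ 1 * (primitive \<alpha> x + cp 0) + P x $ 2 * \<alpha> x) - (Complex x (l - m) * Q x $ 1 * (primitive \<beta> x + (- cm 0)) + Q x $ 2 * \<beta> x)" for x
      using s[of x] by (simp add: green_deriv_def comp algebra_simps)
    then show ?thesis
      unfolding 2 using key[OF solves_diracD(2)[OF sol] solves_diracD(2)[OF sQ]] by (simp add: comp)
  qed
qed

end

end

section \<open>The resolvent and its norm\<close>

lemma weighted_square_integrable:
  fixes g :: "real \<Rightarrow> complex^2"
  assumes [measurable]: "g \<in> borel_measurable borel" and w: "integrable lborel (\<lambda>x. ((1 + \<bar>x\<bar>) * norm (g x))\<^sup>2)"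
  shows "square_integrable g" "square_integrable (\<lambda>x. x *\<^sub>R g x)"
proof -
  have 1: "norm (g x) \<le> (1 + \<bar>x\<bar>) * norm (g x)" and 2: "norm (x *\<^sub>R g x) \<le> (1 + \<bar>x\<bar>) * norm (g x)" for x
    by (simp_all add: distrib_right)
  have *: "integrable lborel (\<lambda>x. (norm (h x))\<^sup>2)"
    if [measurable]: "h \<in> borel_measurable borel" and le: "\<And>x. norm (h x) \<le> (1 + \<bar>x\<bar>) * norm (g x)" for h :: "real \<Rightarrow> complex^2"
    by (rule Bochner_Integration.integrable_bound[OF w]) (auto intro!: power_mono le)
  show "square_integrable g" "square_integrable (\<lambda>x. x *\<^sub>R g x)"
    using *[of g, OF _ 1] *[of "\<lambda>x. x *\<^sub>R g x", OF _ 2] by (simp_all add: square_integrable_def del: norm_scaleR)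
qed

text \<open>The Cauchy-Schwarz inequality of the inner product on \<open>L2\<close>, applied to real
  multiples of a fixed unit vector.\<close>

lemma integral_mult_le_L2:
  fixes F G :: "real \<Rightarrow> real"
  assumes [measurable]: "F \<in> borel_measurable borel" "G \<in> borel_measurable borel"
    and "integrable lborel (\<lambda>x. (F x)\<^sup>2)" "integrable lborel (\<lambda>x. (G x)\<^sup>2)"
  shows "(\<integral>x. F x * G x \<partial>lborel) \<le> sqrt (\<integral>x. (F x)\<^sup>2 \<partial>lborel) * sqrt (\<integral>x. (G x)\<^sup>2 \<partial>lborel)"
proof -
  define e :: "complex^2" where "e = vector [1, 0]"
  have "(norm e)\<^sup>2 = 1" by (simp add: norm_complex_2 e_def)
  then have ne: "norm e = 1" using power2_eq_imp_eq[of "norm e" 1] by simp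
  have si: "square_integrable (\<lambda>x. F x *\<^sub>R e)" "square_integrable (\<lambda>x. G x *\<^sub>R e)"
    using assms by (simp_all add: square_integrable_def ne)
  have "inner (abs_L2 (\<lambda>x. F x *\<^sub>R e)) (abs_L2 (\<lambda>x. G x *\<^sub>R e)) = (\<integral>x. F x * G x \<partial>lborel)"
    using si by (simp add: inner_L2.abs_eq L2_eq_def ne mult.commute flip: power2_norm_eq_inner)
  moreover have "norm (abs_L2 (\<lambda>x. F x *\<^sub>R e)) = sqrt (\<integral>x. (F x)\<^sup>2 \<partial>lborel)"
    "norm (abs_L2 (\<lambda>x. G x *\<^sub>R e)) = sqrt (\<integral>x. (G x)\<^sup>2 \<partial>lborel)"
    using si by (simp_all add: norm_abs_L2 ne)
  ultimately show ?thesis using norm_cauchy_schwarz by metis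
qed

context airy_line
begin

definition glued_norm2 :: real where "glued_norm2 = (\<integral>x. (norm (glued x))\<^sup>2 \<partial>lborel)"

lemma glued_norm2_nonneg: "glued_norm2 \<ge> 0" by (simp add: glued_norm2_def)

lemma glued_norm2_half_line:
  assumes "integrable lborel (\<lambda>x. indicator {0..} x * (norm (P x))\<^sup>2)"
  shows "glued_norm2 = 2 * (\<integral>x. indicator {0..} x * (norm (P x))\<^sup>2 \<partial>lborel)"
proof -
  have "(\<lambda>x. indicator {0..} x *\<^sub>R (norm (glued x))\<^sup>2) = (\<lambda>x. indicator {0..} x * (norm (P x))\<^sup>2)"
    by (auto simp: indicator_def norm_glued)
  with has_bochner_integral_integrable[OF assms]
  have "has_bochner_integral lborel (\<lambda>x. indicator {0..} x *\<^sub>R (norm (glued x))\<^sup>2) (\<integral>x. indicator {0..} x * (norm (P x))\<^sup>2 \<partial>lborel)" by simp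
  from has_bochner_integral_even_function[OF this] show ?thesis
    unfolding glued_norm2_def by (auto simp: norm_glued dest: has_bochner_integral_integral_eq)
qed

context
  fixes K assumes K0: "K > 0"
    and K: "\<And>x. (\<integral>\<^sup>+t. ennreal (schur_kernel x t) \<partial>lborel) \<le> ennreal K"
begin

lemma remainder_square_integrable:
  assumes f: "square_integrable f"
  shows "square_integrable (\<lambda>x. green f x - green_main f x)"
  using green_remainder(1)[OF f K0 K] green_measurable[OF f] green_main_measurable
  by (intro weighted_square_integrable(1)) auto

lemma main_weighted: "integrable lborel (\<lambda>x. ((1 + \<bar>x\<bar>) * norm (green_main f x))\<^sup>2)"
proof -
  let ?c = "of_real (1 / W) * a * (\<integral>t. pair2 (f t) (glued t) \<partial>lborel)"
  have "((1 + \<bar>x\<bar>) * norm (green_main f x))\<^sup>2 = (norm ?c)\<^sup>2 * ((1 + \<bar>x\<bar>) * norm (glued x))\<^sup>2" for x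
    unfolding green_main_def norm_vector_smult by (simp only: power_mult_distrib mult_ac)
  then show ?thesis using integrable_mult_right[OF weighted_glued_integrable] by simp
qed

lemma main_square_integrable: "square_integrable (green_main f)"
  by (rule weighted_square_integrable(1)[OF green_main_measurable main_weighted])

lemma green_square_integrable:
  assumes f: "square_integrable f"
  shows "square_integrable (green f)" "square_integrable (\<lambda>x. x *\<^sub>R green f x)"
proof -
  note [measurable] = green_measurable[OF f] green_main_measurable
  have w: "integrable lborel (\<lambda>x. ((1 + \<bar>x\<bar>) * norm (green f x))\<^sup>2)"
  proof (rule Bochner_Integration.integrable_bound)
    let ?r = "\<lambda>x. (1 + \<bar>x\<bar>) * norm (green f x - green_main f x)" and ?m = "\<lambda>x. (1 + \<bar>x\<bar>) * norm (green_main f x)"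
    show "integrable lborel (\<lambda>x. 2 * (?r x)\<^sup>2 + 2 * (?m x)\<^sup>2)"
      by (intro Bochner_Integration.integrable_add integrable_mult_right green_remainder(1)[OF f K0 K] main_weighted)
    show "AE x in lborel. norm (((1 + \<bar>x\<bar>) * norm (green f x))\<^sup>2) \<le> norm (2 * (?r x)\<^sup>2 + 2 * (?m x)\<^sup>2)"
    proof (intro AE_I2)
      fix x
      have "norm (green f x) \<le> norm (green f x - green_main f x) + norm (green_main f x)"
        using norm_triangle_ineq[of "green f x - green_main f x" "green_main f x"] by simp
      then have "(1 + \<bar>x\<bar>) * norm (green f x) \<le> (1 + \<bar>x\<bar>) * (norm (green f x - green_main f x) + norm (green_main f x))"
        by (intro mult_left_mono) auto
      then have "((1 + \<bar>x\<bar>) * norm (green f x))\<^sup>2 \<le> (?r x + ?m x)\<^sup>2"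
        by (intro power_mono) (auto simp: distrib_left)
      also have "\<dots> \<le> 2 * (?r x)\<^sup>2 + 2 * (?m x)\<^sup>2"
        using zero_le_power2[of "?r x - ?m x"] unfolding power2_sum power2_diff by linarith
      finally show "norm (((1 + \<bar>x\<bar>) * norm (green f x))\<^sup>2) \<le> norm (2 * (?r x)\<^sup>2 + 2 * (?m x)\<^sup>2)" by simp
    qed
  qed measurable
  show "square_integrable (green f)" "square_integrable (\<lambda>x. x *\<^sub>R green f x)"
    by (rule weighted_square_integrable[OF green_measurable[OF f] w])+
qed

text \<open>The derivative prescribed by the equation is controlled by \<open>x * green f x\<close>,
  \<open>green f x\<close> and \<open>f x\<close>, so the weighted bound is all that the Sobolev
  condition needs.\<close>

lemma green_deriv_square_integrable:
  assumes f: "square_integrable f"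
  shows "square_integrable (green_deriv f)"
proof (rule square_integrable_componentwise)
  note [measurable] = green_measurable[OF f] f_measurable[OF f]
  show "(\<lambda>x. green_deriv f x $ 1) \<in> borel_measurable borel" "(\<lambda>x. green_deriv f x $ 2) \<in> borel_measurable borel"
    unfolding green_deriv_def Complex_eq by simp_all
  let ?b = "4 * (l\<^sup>2 + m\<^sup>2)"
  let ?h = "\<lambda>x. 2 * (norm (x *\<^sub>R green f x))\<^sup>2 + ?b * (norm (green f x))\<^sup>2 + 2 * (norm (f x))\<^sup>2"
  show "integrable lborel ?h"
    using green_square_integrable[OF f] f
    by (intro Bochner_Integration.integrable_add integrable_mult_right) (simp_all only: square_integrable_def)
  fix x
  have c: "(norm (Complex x b * p + \<i> * q))\<^sup>2 \<le> 2 * (x\<^sup>2 * (norm p)\<^sup>2) + ?b * (norm p)\<^sup>2 + 2 * (norm q)\<^sup>2"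
    if b: "b\<^sup>2 \<le> 2 * (l\<^sup>2 + m\<^sup>2)" for p q :: complex and b
  proof -
    have "(norm (Complex x b * p + \<i> * q))\<^sup>2 \<le> 2 * ((x\<^sup>2 + b\<^sup>2) * (norm p)\<^sup>2) + 2 * (norm q)\<^sup>2"
      using norm_add_square_le[of "Complex x b * p" "\<i> * q"] by (simp add: norm_mult power_mult_distrib complex_norm)
    also have "(x\<^sup>2 + b\<^sup>2) * (norm p)\<^sup>2 \<le> (x\<^sup>2 + 2 * (l\<^sup>2 + m\<^sup>2)) * (norm p)\<^sup>2"
      using b by (intro mult_right_mono) auto
    finally show ?thesis by (simp add: algebra_simps)
  qed
  have b: "(l + m)\<^sup>2 \<le> 2 * (l\<^sup>2 + m\<^sup>2)" "(l - m)\<^sup>2 \<le> 2 * (l\<^sup>2 + m\<^sup>2)"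
    using sum_squares_bound[of l m] zero_le_power2[of "l + m"] by (simp_all add: power2_sum power2_diff)
  show "(norm (green_deriv f x $ 1))\<^sup>2 + (norm (green_deriv f x $ 2))\<^sup>2 \<le> ?h x"
    unfolding norm_scaleR power_mult_distrib norm_complex_2
    using c[OF b(1), of "green f x $ 2" "f x $ 2"] c[OF b(2), of "green f x $ 1" "f x $ 1"]
    by (simp add: green_deriv_def algebra_simps)
qed

lemma green_solves:
  shows "abs_L2 (green (rep_L2 F)) \<in> Dom_airy_dirac"
    and "airy_dirac m (abs_L2 (green (rep_L2 F))) - l *\<^sub>R abs_L2 (green (rep_L2 F)) = F"
proof -
  let ?f = "rep_L2 F"
  note f = square_integrable_rep_L2[of F]
  note sg = green_square_integrable[OF f]
  let ?u = "abs_L2 (green ?f)" and ?v = "abs_L2 (green_deriv ?f)"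
  have w: "has_weak_derivative ?u ?v"
    by (rule has_weak_derivative_abs_L2[OF sg(1) green_deriv_square_integrable[OF f] green_weak_deriv[OF f]])
  have x: "?u \<in> Dom_x"
    unfolding Dom_x_def mem_Collect_eq
  proof (rule square_integrable_cong_AE[OF sg(2)])
    have [measurable]: "rep_L2 ?u \<in> borel_measurable borel"
      using square_integrable_rep_L2[of ?u] by (simp add: square_integrable_def)
    show "(\<lambda>x. x *\<^sub>R rep_L2 ?u x) \<in> borel_measurable borel" by measurable
    show "AE x in lborel. x *\<^sub>R green ?f x = x *\<^sub>R rep_L2 ?u x"
      using rep_abs_L2[OF sg(1)] by eventually_elim simp
  qed
  show "?u \<in> Dom_airy_dirac" using w x by (auto simp: Dom_airy_dirac_def H1_def)
  show "airy_dirac m ?u - l *\<^sub>R ?u = F"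
    unfolding airy_dirac_eq_iff[OF w x]
    using rep_abs_L2[OF sg(1)] rep_abs_L2[OF green_deriv_square_integrable[OF f]]
    by eventually_elim (simp add: green_deriv_def)
qed

lemma airy_dirac_inj: "inj_on (\<lambda>u. airy_dirac m u - l *\<^sub>R u) Dom_airy_dirac"
proof (rule inj_onI)
  fix u u' assume "u \<in> Dom_airy_dirac" "u' \<in> Dom_airy_dirac"
    and eq: "airy_dirac m u - l *\<^sub>R u = airy_dirac m u' - l *\<^sub>R u'"
  then obtain v v' where w: "has_weak_derivative u v" "has_weak_derivative u' v'" and x: "u \<in> Dom_x" "u' \<in> Dom_x"
    by (auto simp: Dom_airy_dirac_def H1_def)
  define F where "F = airy_dirac m u' - l *\<^sub>R u'"
  have e: "airy_dirac m u - l *\<^sub>R u = F" "airy_dirac m u' - l *\<^sub>R u' = F" using eq by (simp_all add: F_def)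
  have "u - u' = 0"
  proof (rule homogeneous_solution_zero[OF has_weak_derivative_diff[OF w]])
    show "AE x in lborel. rep_L2 (v - v') x $ 1 = Complex x (l + m) * rep_L2 (u - u') x $ 2 \<and>
        rep_L2 (v - v') x $ 2 = Complex x (l - m) * rep_L2 (u - u') x $ 1"
      using e(1)[unfolded airy_dirac_eq_iff[OF w(1) x(1)]] e(2)[unfolded airy_dirac_eq_iff[OF w(2) x(2)]]
        rep_L2_diff[of u u'] rep_L2_diff[of v v']
      by eventually_elim (simp add: right_diff_distrib)
  qed
  then show "u = u'" by simp
qed

lemma resolvent_eq: "resolvent Dom_airy_dirac (airy_dirac m) l F = abs_L2 (green (rep_L2 F))"
  unfolding resolvent_def by (rule inv_into_f_eq[OF airy_dirac_inj green_solves])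

text \<open>Needed because \<open>rep_L2\<close> of a sum, of a multiple or of the class of a
  function is the expected function only almost everywhere.\<close>

lemma green_cong_AE:
  assumes "square_integrable f" "square_integrable g" "AE x in lborel. f x = g x"
  shows "green f x = green g x"
proof -
  have "(\<integral>t. kern x t (f t) \<partial>lborel) = (\<integral>t. kern x t (g t) \<partial>lborel)"
    using assms(3) kern_measurable[OF assms(1)] kern_measurable[OF assms(2)]
    by (intro integral_cong_AE) (auto elim: eventually_mono)
  then show ?thesis by (simp add: green_def)
qed

lemma green_add:
  assumes "square_integrable f" "square_integrable g"
  shows "green (\<lambda>x. f x + g x) x = green f x + green g x"
proof -
  have "kern x t (p + q) = kern x t p + kern x t q" for t p q
    by (simp add: kern_def pair2_def vec_eq_iff algebra_simps)
  then show ?thesis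
    using integrable_kern[OF assms(1)] integrable_kern[OF assms(2)] by (simp add: green_def scaleR_add_right)
qed

lemma green_scaleR: "green (\<lambda>x. c *\<^sub>R f x) x = c *\<^sub>R green f x"
proof -
  have "kern x t (c *\<^sub>R p) = c *\<^sub>R kern x t p" for t p
    by (simp add: kern_def pair2_def vec_eq_iff scaleR_conv_of_real[where 'a=complex] algebra_simps)
  then show ?thesis by (simp add: green_def)
qed

lemma norm_green_main:
  assumes "square_integrable f"
  shows "norm (abs_L2 (green_main f)) = norm (\<integral>t. pair2 (f t) (glued t) \<partial>lborel) / W * sqrt glued_norm2"
proof -
  let ?c = "of_real (1 / W) * a * (\<integral>t. pair2 (f t) (glued t) \<partial>lborel)"
  have "norm (abs_L2 (green_main f)) = sqrt (\<integral>x. (norm ?c)\<^sup>2 * (norm (glued x))\<^sup>2 \<partial>lborel)"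
    unfolding norm_abs_L2[OF main_square_integrable] green_main_def norm_vector_smult power_mult_distrib ..
  also have "\<dots> = norm ?c * sqrt glued_norm2" by (simp add: glued_norm2_def real_sqrt_mult)
  also have "norm ?c = norm (\<integral>t. pair2 (f t) (glued t) \<partial>lborel) / W"
    using W_pos by (simp add: norm_mult norm_divide norm_a)
  finally show ?thesis .
qed

lemma norm_green_remainder:
  assumes f: "square_integrable f"
  shows "norm (abs_L2 (\<lambda>x. green f x - green_main f x)) \<le> K * B / W * norm (abs_L2 f)"
proof -
  note [measurable] = green_measurable[OF f] green_main_measurable
  have "(\<integral>x. (norm (green f x - green_main f x))\<^sup>2 \<partial>lborel) \<le> (\<integral>x. ((1 + \<bar>x\<bar>) * norm (green f x - green_main f x))\<^sup>2 \<partial>lborel)"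
  proof (rule integral_mono)
    show "integrable lborel (\<lambda>x. (norm (green f x - green_main f x))\<^sup>2)"
      using remainder_square_integrable[OF f] by (simp add: square_integrable_def)
    show "(norm (green f x - green_main f x))\<^sup>2 \<le> ((1 + \<bar>x\<bar>) * norm (green f x - green_main f x))\<^sup>2" for x
      by (intro power_mono) (simp_all add: distrib_right)
  qed (rule green_remainder(1)[OF f K0 K])
  also have "\<dots> \<le> (K * B / W)\<^sup>2 * (\<integral>x. (norm (f x))\<^sup>2 \<partial>lborel)" by (rule green_remainder(2)[OF f K0 K])
  finally have "norm (abs_L2 (\<lambda>x. green f x - green_main f x)) \<le> sqrt ((K * B / W)\<^sup>2 * (\<integral>x. (norm (f x))\<^sup>2 \<partial>lborel))"
    by (simp add: norm_abs_L2[OF remainder_square_integrable[OF f]])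
  also have "\<dots> = K * B / W * norm (abs_L2 f)"
    using K0 B_nonneg W_pos by (simp add: real_sqrt_mult norm_abs_L2[OF f])
  finally show ?thesis .
qed

lemma norm_pairing_le:
  assumes f: "square_integrable f"
  shows "norm (\<integral>t. pair2 (f t) (glued t) \<partial>lborel) \<le> norm (abs_L2 f) * sqrt glued_norm2"
proof -
  note [measurable] = f_measurable[OF f]
  have i: "integrable lborel (\<lambda>t. norm (f t) * norm (glued t))"
    by (rule integrable_mult_square) (use f_square[OF f] square_integrable_glued in \<open>auto simp: square_integrable_def\<close>)
  have "norm (\<integral>t. pair2 (f t) (glued t) \<partial>lborel) \<le> (\<integral>t. norm (f t) * norm (glued t) \<partial>lborel)"
    by (rule Bochner_Integration.integral_norm_bound_integral[OF integrable_pair2_glued[OF f] i norm_pair2_le])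
  also have "\<dots> \<le> sqrt (\<integral>x. (norm (f x))\<^sup>2 \<partial>lborel) * sqrt (\<integral>x. (norm (glued x))\<^sup>2 \<partial>lborel)"
    by (rule integral_mult_le_L2) (use f_square[OF f] square_integrable_glued in \<open>auto simp: square_integrable_def\<close>)
  finally show ?thesis by (simp add: norm_abs_L2[OF f] glued_norm2_def)
qed

lemma abs_green_split:
  assumes f: "square_integrable f"
  shows "abs_L2 (green f) = abs_L2 (green_main f) + abs_L2 (\<lambda>x. green f x - green_main f x)"
  using abs_L2_add[OF main_square_integrable remainder_square_integrable[OF f], of f] by simp

lemma norm_green_le:
  assumes f: "square_integrable f"
  shows "norm (abs_L2 (green f)) \<le> (glued_norm2 / W + K * B / W) * norm (abs_L2 f)"
proof -
  have "norm (abs_L2 (green f)) \<le> norm (abs_L2 (green_main f)) + norm (abs_L2 (\<lambda>x. green f x - green_main f x))"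
    unfolding abs_green_split[OF f] by (rule norm_triangle_ineq)
  also have "norm (abs_L2 (green_main f)) \<le> norm (abs_L2 f) * sqrt glued_norm2 / W * sqrt glued_norm2"
    unfolding norm_green_main[OF f] using W_pos glued_norm2_nonneg
    by (intro mult_right_mono divide_right_mono norm_pairing_le[OF f]) auto
  also have "norm (abs_L2 f) * sqrt glued_norm2 / W * sqrt glued_norm2 = glued_norm2 / W * norm (abs_L2 f)"
    using glued_norm2_nonneg by (simp add: mult.assoc[symmetric] real_sqrt_mult_self)
  finally show ?thesis using norm_green_remainder[OF f] by (simp add: distrib_right)
qed

lemma bounded_linear_resolvent: "bounded_linear (resolvent Dom_airy_dirac (airy_dirac m) l)"
proof (rule bounded_linear_intro[where K="glued_norm2 / W + K * B / W"])
  note s = square_integrable_rep_L2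
  fix F G :: L2 and c :: real
  have "green (rep_L2 (F + G)) x = green (rep_L2 F) x + green (rep_L2 G) x" for x
    using green_cong_AE[OF s square_integrable_add[OF s s] rep_L2_add] by (simp add: green_add[OF s s])
  then have "green (rep_L2 (F + G)) = (\<lambda>x. green (rep_L2 F) x + green (rep_L2 G) x)" by (simp add: fun_eq_iff)
  then show "resolvent Dom_airy_dirac (airy_dirac m) l (F + G) =
      resolvent Dom_airy_dirac (airy_dirac m) l F + resolvent Dom_airy_dirac (airy_dirac m) l G"
    by (simp add: resolvent_eq abs_L2_add green_square_integrable s)
  have "green (rep_L2 (c *\<^sub>R F)) x = c *\<^sub>R green (rep_L2 F) x" for x
    using green_cong_AE[OF s square_integrable_scaleR[OF s] rep_L2_scaleR] by (simp add: green_scaleR)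
  then have "green (rep_L2 (c *\<^sub>R F)) = (\<lambda>x. c *\<^sub>R green (rep_L2 F) x)" by (simp add: fun_eq_iff)
  then show "resolvent Dom_airy_dirac (airy_dirac m) l (c *\<^sub>R F) = c *\<^sub>R resolvent Dom_airy_dirac (airy_dirac m) l F"
    by (simp add: resolvent_eq abs_L2_scaleR green_square_integrable s)
  show "norm (resolvent Dom_airy_dirac (airy_dirac m) l F) \<le> norm F * (glued_norm2 / W + K * B / W)"
    using norm_green_le[OF s[of F]] by (simp add: resolvent_eq abs_rep_L2 mult.commute)
qed

lemma real_resolvent_set: "l \<in> real_resolvent_set Dom_airy_dirac (airy_dirac m)"
proof -
  have "bij_betw (\<lambda>u. airy_dirac m u - l *\<^sub>R u) Dom_airy_dirac UNIV"
    unfolding bij_betw_def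
  proof (intro conjI airy_dirac_inj)
    show "(\<lambda>u. airy_dirac m u - l *\<^sub>R u) ` Dom_airy_dirac = UNIV"
      using green_solves by (auto simp: image_iff) metis
  qed
  then show ?thesis using bounded_linear_resolvent by (simp add: real_resolvent_set_def)
qed

text \<open>The upper bound adds the Cauchy-Schwarz bound for the rank-one part to the bound for the
  remainder. The lower bound tests with a function for which Cauchy-Schwarz is an equality.\<close>

lemma onorm_resolvent: "\<bar>onorm (resolvent Dom_airy_dirac (airy_dirac m) l) - glued_norm2 / W\<bar> \<le> K * B / W"
proof -
  let ?R = "resolvent Dom_airy_dirac (airy_dirac m) l"
  have nn: "0 \<le> glued_norm2 / W" "0 \<le> K * B / W" using glued_norm2_nonneg W_pos K0 B_nonneg by auto
  have "onorm ?R \<le> glued_norm2 / W + K * B / W"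
  proof (rule onorm_bound)
    show "norm (?R F) \<le> (glued_norm2 / W + K * B / W) * norm F" for F
      using norm_green_le[OF square_integrable_rep_L2[of F]] by (simp add: resolvent_eq abs_rep_L2)
  qed (use nn in simp)
  moreover have "glued_norm2 / W - K * B / W \<le> onorm ?R"
  proof (cases "glued_norm2 = 0")
    case True
    then show ?thesis using nn onorm_pos_le[OF bounded_linear_resolvent] by simp
  next
    case False
    then have pos: "sqrt glued_norm2 > 0" using glued_norm2_nonneg by simp
    \<comment> \<open>Conjugation together with the sign built into \<open>pair2\<close> makes the
      pairing of \<open>f0\<close> with \<open>glued\<close> the squared norm: \<open>f0\<close> is
      extremal for the rank-one part.\<close>
    define f0 :: "real \<Rightarrow> complex^2" where "f0 x = vector [cnj (glued x $ 1), - cnj (glued x $ 2)]" for x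
    have nf: "norm (f0 x) = norm (glued x)" for x
      by (rule power2_eq_imp_eq) (auto simp: norm_complex_2 f0_def)
    have f0: "square_integrable f0"
    proof (rule square_integrable_bound[OF square_integrable_glued, where C=1])
      have [measurable]: "(\<lambda>x. cnj (glued x $ i)) \<in> borel_measurable borel" for i
        by (intro borel_measurable_continuous_on[OF continuous_on_cnj[OF continuous_on_id]] borel_measurable_vec_nth_complex glued_measurable)
      show "f0 \<in> borel_measurable borel"
        by (rule borel_measurable_vec_complex_2) (simp_all add: f0_def)
    qed (simp add: nf)
    have n0: "norm (abs_L2 f0) = sqrt glued_norm2" by (simp add: norm_abs_L2[OF f0] nf glued_norm2_def)
    have "pair2 (f0 x) (glued x) = of_real ((norm (glued x))\<^sup>2)" for x
      by (simp add: pair2_def f0_def norm_complex_2 complex_norm_square mult.commute del: of_real_power)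
    then have p: "(\<integral>t. pair2 (f0 t) (glued t) \<partial>lborel) = of_real glued_norm2"
      by (simp add: glued_norm2_def del: of_real_power)
    have "glued_norm2 / W * sqrt glued_norm2 \<le> norm (abs_L2 (green f0)) + K * B / W * sqrt glued_norm2"
    proof -
      have "norm (abs_L2 (green_main f0)) \<le> norm (abs_L2 (green f0)) + norm (abs_L2 (\<lambda>x. green f0 x - green_main f0 x))"
        using norm_triangle_ineq4[of "abs_L2 (green f0)" "abs_L2 (\<lambda>x. green f0 x - green_main f0 x)"]
        by (simp add: abs_green_split[OF f0])
      then show ?thesis
        using norm_green_remainder[OF f0] glued_norm2_nonneg by (simp add: norm_green_main[OF f0] p n0)
    qed
    moreover have "?R (abs_L2 f0) = abs_L2 (green f0)"
    proof -
      have "green (rep_L2 (abs_L2 f0)) = green f0"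
        using green_cong_AE[OF square_integrable_rep_L2 f0 rep_abs_L2[OF f0]] by (simp add: fun_eq_iff)
      then show ?thesis by (simp add: resolvent_eq)
    qed
    moreover have "norm (?R (abs_L2 f0)) \<le> onorm ?R * sqrt glued_norm2"
      using onorm[OF bounded_linear_resolvent, of "abs_L2 f0"] by (simp add: n0)
    ultimately have "(glued_norm2 / W - K * B / W) * sqrt glued_norm2 \<le> onorm ?R * sqrt glued_norm2"
      by (simp add: left_diff_distrib)
    then show ?thesis using pos by (simp only: mult_le_cancel_right_pos)
  qed
  ultimately show ?thesis by (simp add: abs_le_iff)
qed

end

end

section \<open>Asymptotics of the resolvent norm\<close>

theorem theorem2p4:
  fixes m :: real
  assumes "m > 0"
  shows "\<exists>r :: real \<Rightarrow> real. r \<in> O[at_infinity](\<lambda>l. 1 / \<bar>l\<bar>\<^sup>2) \<and>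
    (\<forall>\<^sub>F l in at_infinity.
      l \<in> real_resolvent_set Dom_airy_dirac (airy_dirac m) \<and>
      onorm (resolvent Dom_airy_dirac (airy_dirac m) l) =
        Gamma (m\<^sup>2 / 2 + 1) / (2 powr (m\<^sup>2 / 2) * m) *
        (exp (l\<^sup>2) / \<bar>l\<bar> powr (m\<^sup>2)) * (1 + r l))"
proof -
  define s where "s = m\<^sup>2 / 2"
  have s: "s > 0" and m2: "m\<^sup>2 = 2 * s" using assms by (simp_all add: s_def)
  define W where "W = 2 / m * sqrt pi * Gamma s"
  have G: "Gamma s > 0" using s by (rule Gamma_real_pos)
  have W: "W > 0" using assms G by (simp add: W_def)
  obtain K where K: "K > 0" "\<And>x. (\<integral>\<^sup>+t. ennreal (schur_kernel x t) \<partial>lborel) \<le> ennreal K"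
    by (rule schur_kernel_bound) blast
  obtain C1 L where L: "L \<ge> 1" "C1 \<ge> 0" "\<And>l. \<bar>l\<bar> \<ge> L \<Longrightarrow>
      \<exists>a D. airy_line m l (airy_sol m l) W a (C1 * \<bar>l\<bar> powr s) D"
    by (rule airy_sol_line[OF assms, folded s_def, folded W_def]) (rule that)
  obtain C2 where C2: "C2 \<ge> 0"
    "\<And>l. \<bar>l\<bar> \<ge> 1 \<Longrightarrow> integrable lborel (\<lambda>x. indicator {0..} x * (norm (airy_sol m l x))\<^sup>2)"
    "\<And>l. \<bar>l\<bar> \<ge> 1 \<Longrightarrow>
      \<bar>2 * (\<integral>x. indicator {0..} x * (norm (airy_sol m l x))\<^sup>2 \<partial>lborel)
        - (Gamma s)\<^sup>2 / 2 powr s * sqrt pi * \<bar>l\<bar> powr (- (m\<^sup>2)) * exp (l\<^sup>2)\<bar>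
       \<le> C2 * \<bar>l\<bar> powr (- (m\<^sup>2) - 2) * exp (l\<^sup>2)"
    "\<And>l x. \<bar>l\<bar> \<ge> 1 \<Longrightarrow> x \<ge> 0 \<Longrightarrow>
      (norm (airy_sol m l x))\<^sup>2 \<le> C2 * norm (Complex x l) powr (- (m\<^sup>2)) * exp (l\<^sup>2 - x\<^sup>2)"
    by (rule airy_sol_asymp[OF assms, folded s_def]) (rule that)
  define c0 where "c0 = Gamma (s + 1) / (2 powr s * m)"
  have c0: "c0 > 0" using assms s Gamma_real_pos[of "s + 1"] by (simp add: c0_def)
  \<comment> \<open>The leading constant of the integral of the squared norm, divided by the
    Wronskian constant; \<open>s / m = m / 2\<close> makes the two forms agree.\<close>
  have c0_eq: "(Gamma s)\<^sup>2 / 2 powr s * sqrt pi / W = c0"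
  proof -
    have "Gamma (s + 1) = s * Gamma s" using s by (intro Gamma_plus1) (auto elim: nonpos_Ints_cases)
    then have "c0 = s / m * (Gamma s / 2 powr s)" by (simp add: c0_def)
    also have "s / m = m / 2" using assms by (simp add: s_def power2_eq_square)
    finally show ?thesis using assms G by (simp add: W_def field_simps power2_eq_square)
  qed
  define R where "R l = onorm (resolvent Dom_airy_dirac (airy_dirac m) l)" for l
  define main where "main l = c0 * (exp (l\<^sup>2) / \<bar>l\<bar> powr (m\<^sup>2))" for l :: real
  have main_eq: "main l = c0 * \<bar>l\<bar> powr (- (m\<^sup>2)) * exp (l\<^sup>2)" for l
    by (simp add: main_def powr_minus field_simps)
  have main_pos: "main l > 0" if "\<bar>l\<bar> \<ge> L" for l
    using that L(1) c0 by (simp add: main_def)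
  \<comment> \<open>The two error terms come from the Schur remainder, where \<open>B\<close> is
    \<open>C1 * \<bar>l\<bar> powr s\<close>, and from the asymptotics of the squared norm of
    \<open>glued\<close>.\<close>
  have res: "l \<in> real_resolvent_set Dom_airy_dirac (airy_dirac m)"
    and dist: "\<bar>R l - main l\<bar> \<le> K * C1 / W * \<bar>l\<bar> powr s + C2 / W * \<bar>l\<bar> powr (- (m\<^sup>2) - 2) * exp (l\<^sup>2)" if l: "\<bar>l\<bar> \<ge> L" for l
  proof -
    obtain a D where "airy_line m l (airy_sol m l) W a (C1 * \<bar>l\<bar> powr s) D" using L(3)[OF l] by blast
    then interpret airy_line m l "airy_sol m l" W a "C1 * \<bar>l\<bar> powr s" D .
    show "l \<in> real_resolvent_set Dom_airy_dirac (airy_dirac m)" by (rule real_resolvent_set[OF K])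
    have l1: "\<bar>l\<bar> \<ge> 1" using l L(1) by simp
    let ?e = "(Gamma s)\<^sup>2 / 2 powr s * sqrt pi * \<bar>l\<bar> powr (- (m\<^sup>2)) * exp (l\<^sup>2)"
    have "?e / W = ((Gamma s)\<^sup>2 / 2 powr s * sqrt pi / W) * \<bar>l\<bar> powr (- (m\<^sup>2)) * exp (l\<^sup>2)" by simp
    then have main: "main l = ?e / W" unfolding c0_eq by (simp add: main_eq)
    have "\<bar>p / W - q / W\<bar> = \<bar>p - q\<bar> / W" for p q
      using W by (simp add: abs_divide flip: diff_divide_distrib)
    then have "\<bar>glued_norm2 / W - main l\<bar> = \<bar>glued_norm2 - ?e\<bar> / W"
      unfolding main .
    also have "\<dots> \<le> (C2 * \<bar>l\<bar> powr (- (m\<^sup>2) - 2) * exp (l\<^sup>2)) / W"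
      using C2(3)[OF l1] W unfolding glued_norm2_half_line[OF C2(2)[OF l1]] by (intro divide_right_mono) auto
    finally have "\<bar>glued_norm2 / W - main l\<bar> \<le> C2 / W * \<bar>l\<bar> powr (- (m\<^sup>2) - 2) * exp (l\<^sup>2)" by simp
    moreover have "\<bar>R l - glued_norm2 / W\<bar> \<le> K * C1 / W * \<bar>l\<bar> powr s"
      using onorm_resolvent[OF K] by (simp add: R_def mult_ac)
    ultimately show "\<bar>R l - main l\<bar> \<le> K * C1 / W * \<bar>l\<bar> powr s + C2 / W * \<bar>l\<bar> powr (- (m\<^sup>2) - 2) * exp (l\<^sup>2)" by linarith
  qed
  define r where "r l = R l / main l - 1" for l
  \<comment> \<open>Relative to the main term, of order
    \<open>\<bar>l\<bar> powr (- 2 * s) * exp (l\<^sup>2)\<close>, the Schur remainder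
    \<open>\<bar>l\<bar> powr s\<close> has size
    \<open>\<bar>l\<bar> powr (3 * s) * exp (- l\<^sup>2)\<close>. The additional exponent
    \<open>2\<close> compares it with \<open>1 / l\<^sup>2\<close>.\<close>
  have "((\<lambda>y::real. y powr (3 * s + 2) * exp (- (y\<^sup>2))) \<longlongrightarrow> 0) at_top" by real_asymp
  then have "\<forall>\<^sub>F y::real in at_top. y powr (3 * s + 2) * exp (- (y\<^sup>2)) < 1"
    by (rule order_tendstoD) simp
  then obtain Y where Y: "\<And>y::real. y \<ge> Y \<Longrightarrow> y powr (3 * s + 2) * exp (- (y\<^sup>2)) < 1"
    by (auto simp: eventually_at_top_linorder)
  define M where "M = K * C1 / (W * c0) + C2 / (W * c0)"
  have r_le: "\<bar>r l\<bar> \<le> M * \<bar>1 / \<bar>l\<bar>\<^sup>2\<bar>" if l: "\<bar>l\<bar> \<ge> max L Y" for l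
  proof -
    have lL: "\<bar>l\<bar> \<ge> L" and lY: "\<bar>l\<bar> \<ge> Y" and l0: "\<bar>l\<bar> > 0" using l L(1) by auto
    have p2: "\<bar>l\<bar> powr (- 2) = 1 / \<bar>l\<bar>\<^sup>2" using l0 by (simp add: powr_minus_divide)
    have "\<bar>l\<bar> powr s = (\<bar>l\<bar> powr (3 * s + 2) * exp (- (\<bar>l\<bar>\<^sup>2))) * (\<bar>l\<bar> powr (- (m\<^sup>2)) * \<bar>l\<bar> powr (- 2) * exp (l\<^sup>2))"
    proof -
      have "\<bar>l\<bar> powr (3 * s + 2) * (\<bar>l\<bar> powr (- (m\<^sup>2)) * \<bar>l\<bar> powr (- 2)) = \<bar>l\<bar> powr s"
        by (simp add: m2 flip: powr_add)
      moreover have "exp (- (\<bar>l\<bar>\<^sup>2)) * exp (l\<^sup>2) = 1" by (simp flip: exp_add)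
      ultimately show ?thesis by (metis mult.assoc mult.left_commute mult.right_neutral)
    qed
    also have "\<dots> \<le> 1 * (\<bar>l\<bar> powr (- (m\<^sup>2)) * \<bar>l\<bar> powr (- 2) * exp (l\<^sup>2))"
      using Y[OF lY] by (intro mult_right_mono) auto
    also have "\<dots> = main l / c0 * (1 / \<bar>l\<bar>\<^sup>2)" using c0 unfolding main_eq p2 by simp
    finally have a: "\<bar>l\<bar> powr s \<le> main l / c0 * (1 / \<bar>l\<bar>\<^sup>2)" .
    have b: "\<bar>l\<bar> powr (- (m\<^sup>2) - 2) * exp (l\<^sup>2) = main l / c0 * (1 / \<bar>l\<bar>\<^sup>2)"
    proof -
      have "\<bar>l\<bar> powr (- (m\<^sup>2) - 2) = \<bar>l\<bar> powr (- (m\<^sup>2)) * \<bar>l\<bar> powr (- 2)" by (simp flip: powr_add)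
      then show ?thesis using c0 unfolding main_eq p2 by simp
    qed
    have "\<bar>R l - main l\<bar> \<le> K * C1 / W * (main l / c0 * (1 / \<bar>l\<bar>\<^sup>2)) + C2 / W * (main l / c0 * (1 / \<bar>l\<bar>\<^sup>2))"
      using dist[OF lL] mult_left_mono[OF a, of "K * C1 / W"] K(1) L(2) W unfolding mult.assoc[of "C2 / W"] b by simp
    also have "\<dots> = (M * (1 / \<bar>l\<bar>\<^sup>2)) * main l"
      by (simp add: M_def add_divide_distrib distrib_right)
    finally have "\<bar>R l - main l\<bar> / main l \<le> M * (1 / \<bar>l\<bar>\<^sup>2)"
      using main_pos[OF lL] by (simp add: divide_le_eq)
    moreover have "\<bar>r l\<bar> = \<bar>R l - main l\<bar> / main l"
    proof -
      have "r l = (R l - main l) / main l" using main_pos[OF lL] by (simp add: r_def diff_divide_distrib)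
      then show ?thesis using main_pos[OF lL] by (simp add: abs_divide)
    qed
    ultimately show ?thesis by simp
  qed
  show ?thesis
  proof (intro exI[of _ r] conjI)
    show "r \<in> O[at_infinity](\<lambda>l. 1 / \<bar>l\<bar>\<^sup>2)"
      by (rule bigoI[where c=M]) (use r_le in \<open>auto simp: eventually_at_infinity intro!: exI[of _ "max L Y"]\<close>)
    have "R l = Gamma (m\<^sup>2 / 2 + 1) / (2 powr (m\<^sup>2 / 2) * m) * (exp (l\<^sup>2) / \<bar>l\<bar> powr (m\<^sup>2)) * (1 + r l)" if "\<bar>l\<bar> \<ge> L" for l
    proof -
      have "R l = main l * (1 + r l)" using main_pos[OF that] by (simp add: r_def)
      then show ?thesis by (simp only: main_def c0_def s_def)
    qed
    then show "\<forall>\<^sub>F l in at_infinity.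
      l \<in> real_resolvent_set Dom_airy_dirac (airy_dirac m) \<and>
      onorm (resolvent Dom_airy_dirac (airy_dirac m) l) =
        Gamma (m\<^sup>2 / 2 + 1) / (2 powr (m\<^sup>2 / 2) * m) *
        (exp (l\<^sup>2) / \<bar>l\<bar> powr (m\<^sup>2)) * (1 + r l)"
      using res unfolding eventually_at_infinity R_def by (intro exI[of _ L]) auto
  qed
qed

end
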